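(* There is an algorithm that, given an instance $(X,k)$ of \textsc{Cover by Arithmetic Progressions} (\textsc{CAP}) with $|X|=n$, correctly decides it in time $2^{O(k^2)}\cdot \mathrm{poly}(n)$.
   Context: An arithmetic progression (AP) is a finite sequence of integers of the form $a, a+d, a+2d, \dots, a+xd$ for integers $a$ (start value), $d$ (difference) and $x\ge 0$; an AP is frequently identified with the set of its elements. \textsc{CAP}: given a set $X$ of $n$ integers and an integer $k$, decide whether there exist $k$ APs $s_1,\dots,s_k$, each consisting only of elements of $X$, such that $s_1\cup\dots\cup s_k = X$. *)

theory Defs
  imports Complex_Main "HOL-Library.Landau_Symbols" "HOL-Computational_Algebra.Polynomial"
begin

section \<open>Cover by arithmetic progressions\<close>

text \<open>Progressions are nonempty; the difference may be any integer, including 0.\<close>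

definition is_AP :: "int list \<Rightarrow> bool" where
  "is_AP s \<longleftrightarrow> (\<exists>(a::int) (d::int) (x::nat). s = map (\<lambda>i. a + int i * d) [0..<Suc x])"

definition CAP :: "int set \<Rightarrow> nat \<Rightarrow> bool" where
  "CAP X k \<longleftrightarrow> (\<exists>ss. length ss = k \<and> (\<forall>s \<in> set ss. is_AP s \<and> set s \<subseteq> X)
                     \<and> (\<Union>s \<in> set ss. set s) = X)"

section \<open>Algorithms: structured random access programs\<close>

text \<open>
  A program works on integer registers and integer arrays, each named by a natural number. Since a
  program is a finite piece of syntax, it can name only finitely many of them. Arrays are unbounded,
  and reads and writes may use computed indices.

  Every operation takes unit time. The only arithmetic operations are addition and subtraction;
  unit-cost multiplication is deliberately absent, since it would let a program build numbers of
  exponential bit length in polynomially many steps. Here, t steps increase the bit length of the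
  numbers involved by at most O(t), so the model is polynomially equivalent to Turing machines.
\<close>

datatype aexp =
    Const int
  | Reg nat
  | Read nat aexp  \<comment> \<open>array name, index\<close>
  | Plus aexp aexp
  | Minus aexp aexp

datatype bexp =
    Less aexp aexp
  | Equal aexp aexp
  | Neg bexp
  | Conj bexp bexp

datatype com =
    Skip
  | Assign nat aexp
  | Write nat aexp aexp  \<comment> \<open>array name, index, value\<close>
  | Seq com com
  | Cond bexp com com
  | While bexp com

type_synonym state = "(nat \<Rightarrow> int) \<times> (nat \<Rightarrow> int \<Rightarrow> int)"

primrec aval :: "aexp \<Rightarrow> state \<Rightarrow> int" where
  "aval (Const c) s = c"
| "aval (Reg r) s = fst s r"
| "aval (Read a e) s = snd s a (aval e s)"
| "aval (Plus e1 e2) s = aval e1 s + aval e2 s"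
| "aval (Minus e1 e2) s = aval e1 s - aval e2 s"

primrec bval :: "bexp \<Rightarrow> state \<Rightarrow> bool" where
  "bval (Less e1 e2) s \<longleftrightarrow> aval e1 s < aval e2 s"
| "bval (Equal e1 e2) s \<longleftrightarrow> aval e1 s = aval e2 s"
| "bval (Neg b) s \<longleftrightarrow> \<not> bval b s"
| "bval (Conj b1 b2) s \<longleftrightarrow> bval b1 s \<and> bval b2 s"

primrec acost :: "aexp \<Rightarrow> nat" where
  "acost (Const c) = 1"
| "acost (Reg r) = 1"
| "acost (Read a e) = 1 + acost e"
| "acost (Plus e1 e2) = 1 + acost e1 + acost e2"
| "acost (Minus e1 e2) = 1 + acost e1 + acost e2"

primrec bcost :: "bexp \<Rightarrow> nat" where
  "bcost (Less e1 e2) = 1 + acost e1 + acost e2"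
| "bcost (Equal e1 e2) = 1 + acost e1 + acost e2"
| "bcost (Neg b) = 1 + bcost b"
| "bcost (Conj b1 b2) = 1 + bcost b1 + bcost b2"

text \<open>\<open>exec c s t s'\<close>: started in state \<open>s\<close>, the program \<open>c\<close> halts after exactly \<open>t\<close> steps in
  state \<open>s'\<close>.\<close>

inductive exec :: "com \<Rightarrow> state \<Rightarrow> nat \<Rightarrow> state \<Rightarrow> bool" where
  Skip: "exec Skip s 1 s"
| Assign: "exec (Assign r e) s (1 + acost e) ((fst s)(r := aval e s), snd s)"
| Write: "exec (Write a i e) s (1 + acost i + acost e)
            (fst s, (snd s)(a := (snd s a)(aval i s := aval e s)))"
| Seq: "exec c1 s t1 s' \<Longrightarrow> exec c2 s' t2 s'' \<Longrightarrow> exec (Seq c1 c2) s (t1 + t2) s''"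
| CondTrue: "bval b s \<Longrightarrow> exec c1 s t s' \<Longrightarrow> exec (Cond b c1 c2) s (1 + bcost b + t) s'"
| CondFalse: "\<not> bval b s \<Longrightarrow> exec c2 s t s' \<Longrightarrow> exec (Cond b c1 c2) s (1 + bcost b + t) s'"
| WhileFalse: "\<not> bval b s \<Longrightarrow> exec (While b c) s (1 + bcost b) s"
| WhileTrue: "bval b s \<Longrightarrow> exec c s t1 s' \<Longrightarrow> exec (While b c) s' t2 s''
    \<Longrightarrow> exec (While b c) s (1 + bcost b + t1 + t2) s''"

inductive_cases SkipE: "exec Skip s t s'"
inductive_cases AssignE: "exec (Assign r e) s t s'"
inductive_cases WriteE: "exec (Write a i e) s t s'"
inductive_cases SeqE: "exec (Seq c1 c2) s t s'"
inductive_cases CondE: "exec (Cond b c1 c2) s t s'"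
inductive_cases WhileE: "exec (While b c) s t s'"

text \<open>Execution is deterministic, so the existence of one halting run with a given result and
  running time determines the behaviour of the program.\<close>

lemma exec_deterministic:
  "exec c s t s' \<Longrightarrow> exec c s u s'' \<Longrightarrow> t = u \<and> s' = s''"
proof (induction arbitrary: u s'' rule: exec.induct)
  case (Skip s)
  then show ?case by (auto elim: SkipE)
next
  case (Assign r e s)
  then show ?case by (auto elim: AssignE)
next
  case (Write a i e s)
  then show ?case by (auto elim: WriteE)
next
  case (Seq c1 s t1 s1 c2 t2 s2)
  from Seq.prems obtain v1 v2 w where
    "exec c1 s v1 w" "exec c2 w v2 s''" "u = v1 + v2" by (rule SeqE)
  with Seq.IH(1)[of v1 w] Seq.IH(2)[of v2 s''] show ?case by simp
next
  case (CondTrue b s c1 t s1 c2)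
  from CondTrue.prems show ?case
  proof (rule CondE)
    fix v assume "u = Suc (bcost b + v)" "exec c1 s v s''"
    with CondTrue.IH[of v s''] show ?thesis by simp
  qed (use CondTrue.hyps in simp)
next
  case (CondFalse b s c2 t s1 c1)
  from CondFalse.prems show ?case
  proof (rule CondE)
    fix v assume "u = Suc (bcost b + v)" "exec c2 s v s''"
    with CondFalse.IH[of v s''] show ?thesis by simp
  qed (use CondFalse.hyps in simp)
next
  case (WhileFalse b s c)
  from WhileFalse.prems show ?case
    by (rule WhileE) (use WhileFalse.hyps in simp_all)
next
  case (WhileTrue b s c t1 s1 t2 s2)
  from WhileTrue.prems show ?case
  proof (rule WhileE)
    fix v1 w v2
    assume "u = Suc (bcost b + v1 + v2)" "exec c s v1 w" "exec (While b c) w v2 s''"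
    with WhileTrue.IH(1)[of v1 w] WhileTrue.IH(2)[of v2 s''] show ?thesis by simp
  qed (use WhileTrue.hyps in simp)
qed

text \<open>
  An instance \<open>(X, k)\<close> is presented by listing the elements of \<open>X\<close> in some order: register 0 holds
  \<open>card X\<close>, register 1 holds \<open>k\<close>, cells \<open>0, \<dots>, card X - 1\<close> of array 0 hold the elements, and
  everything else is 0. The answer is returned in register 0, with 1 for yes and 0 for no.
\<close>

definition input_state :: "int list \<Rightarrow> nat \<Rightarrow> state" where
  "input_state xs k =
     ((\<lambda>r. if r = 0 then int (length xs) else if r = 1 then int k else 0),
      (\<lambda>a i. if a = 0 \<and> 0 \<le> i \<and> i < int (length xs) then xs ! nat i else 0))"

definition answer :: "state \<Rightarrow> int" where
  "answer s = fst s 0"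

end

(*
  Fix k progressions covering X and reconstruct them one at a time; C is the union of the maximal
  progressions chosen so far. While more than O(k^2) elements of X are uncovered, two of the first
  few uncovered elements lie on the same unknown progression with no endpoint of a chosen
  progression between them. By the theorem of Crittenden and Vanden Eynden they are at most 2^k
  steps of that progression apart, so 2^O(k) guesses suffice to find it. Once O(k^2) elements are
  left, inclusion-exclusion over their subsets counts the tuples of progressions that cover them:
  for each subset, count the progressions avoiding it and raise that number to the power of how many
  progressions are still available.
*)

theory Submission
  imports Defs
begin

section \<open>Arithmetic progressions\<close>

text \<open>Trying all pairs of points of \<open>X\<close> in each of \<open>k\<close> rounds would
  cost about \<open>n ^ (2 * k)\<close>; the purpose of \<open>low\<close> and
  \<open>eligible\<close> is a list of candidate pairs whose length is bounded in terms of
  \<open>k\<close> alone. A pair fixes a start and a difference but not the extent of the unknown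
  progression. Taking the maximal progression through the start is safe: it contains the unknown one
  and still lies in \<open>X\<close>, so the rest needs one progression fewer. Every sequence of
  choices yields genuine progressions, so wrong guesses cannot produce a false yes, and only the
  existence of one good guess needs an argument. The deterministic program replaces guessing by
  running through all numbers below \<open>2 ^ m\<close>, whose digits are the choices. With
  \<open>m = k * (13 * k + 1)\<close> the same number bounds the bits of a guess and the size of the
  remainder whose subsets are enumerated, so both enumerations have length
  \<open>2 ^ O(k ^ 2)\<close>. Because the machine only adds and subtracts, digits are read by
  repeated subtraction, powers of two are tabulated and products are computed by repeated
  addition.\<close>

definition exp_sum :: "(complex \<times> complex) list \<Rightarrow> nat \<Rightarrow> complex" where
  "exp_sum ts x = (\<Sum>(c, z)\<leftarrow>ts. c * z ^ x)"

lemma exp_sum_simps [simp]: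
  "exp_sum [] x = 0"
  "exp_sum ((c, z) # ts) x = c * z ^ x + exp_sum ts x"
  "exp_sum (ts @ us) x = exp_sum ts x + exp_sum us x"
  by (simp_all add: exp_sum_def)

text \<open>A term with base \<open>z\<close> gets coefficient 0, so subtracting \<open>z\<close>
  times the sum from its shift removes that term.\<close>

lemma exp_sum_shift:
  "exp_sum ts (Suc x) - z * exp_sum ts x = exp_sum (map (\<lambda>(c, w). (c * (w - z), w)) ts) x"
  by (induction ts) (auto simp: algebra_simps)

lemma exp_sum_scale:
  "exp_sum (map (\<lambda>(c, w). (- c * a, w * z)) ts) x = - a * z ^ x * exp_sum ts x"
  by (induction ts) (auto simp: algebra_simps power_mult_distrib)

text \<open>Annihilating the first term leaves a sum with one term fewer that vanishes at one
  argument fewer, hence everywhere by induction. So the original sum is geometric with ratio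
  \<open>z\<close>, and it starts at 0. Bases may repeat, which a Vandermonde determinant would not
  allow.\<close>

lemma exp_sum_eq_0:
  assumes "\<And>x. x < length ts \<Longrightarrow> exp_sum ts x = 0"
  shows "exp_sum ts y = 0"
  using assms
proof (induction "length ts" arbitrary: ts y)
  case 0
  then show ?case by simp
next
  case (Suc l)
  then obtain c z us where ts: "ts = (c, z) # us" by (cases ts) auto
  let ?vs = "map (\<lambda>(c, w). (c * (w - z), w)) us"
  have shift: "exp_sum ts (Suc x) - z * exp_sum ts x = exp_sum ?vs x" for x
    using exp_sum_shift[of ts x z] by (simp add: ts)
  have "exp_sum ?vs x = 0" for x
  proof (rule Suc.hyps(1))
    show "l = length ?vs" using Suc.hyps(2) ts by simp
    show "exp_sum ?vs x' = 0" if "x' < length ?vs" for x'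
      using Suc.prems[of x'] Suc.prems[of "Suc x'"] shift[of x'] that ts by simp
  qed
  with shift have step: "exp_sum ts (Suc x) = z * exp_sum ts x" for x by simp
  show ?case
    by (induction y) (use Suc.prems[of 0] ts step in simp_all)
qed

lemma cis_int_div_eq_1_iff:
  assumes "e > 0"
  shows "cis (2 * pi * of_int a / of_int e) = 1 \<longleftrightarrow> e dvd a"
proof
  assume "cis (2 * pi * of_int a / of_int e) = 1"
  then have "cos (2 * pi * of_int a / of_int e) = 1"
    by (metis cis.sel(1) one_complex.sel(1))
  then obtain j :: int where "2 * pi * of_int a / of_int e = of_int j * 2 * pi"
    unfolding cos_one_2pi_int by blast
  then have "real_of_int a = of_int (j * e)"
    using assms by (simp add: field_simps)
  then show "e dvd a" by (metis dvd_triv_right of_int_eq_iff)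
next
  assume "e dvd a"
  then obtain j where "a = e * j" ..
  then have "2 * pi * of_int a / of_int e = 2 * pi * of_int j"
    using assms by simp
  then show "cis (2 * pi * of_int a / of_int e) = 1"
    by (simp only: cis_multiple_2pi Ints_of_int)
qed

text \<open>The theorem of Crittenden and Vanden Eynden. The product of the factors
  \<open>1 - cis (2 * pi * (y + t * d - z) / e)\<close>, which vanishes exactly at the covered \<open>t\<close>, expands
  into an exponential sum in \<open>t\<close> with \<open>2 ^ length es\<close> terms.\<close>

lemma residue_classes_cover:
  fixes y d :: int and es :: "(int \<times> int) list"
  assumes pos: "\<And>z e. (z, e) \<in> set es \<Longrightarrow> e > 0"
    and cov: "\<And>t. t < 2 ^ length es \<Longrightarrow> \<exists>(z, e)\<in>set es. e dvd y + int t * d - z"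
  shows "\<exists>(z, e)\<in>set es. e dvd y + int t * d - z"
proof -
  define F where "F = (\<lambda>(z::int, e::int) (t::nat).
    1 - cis (2 * pi * of_int (y + int t * d - z) / of_int e))"
  have F: "F (z, e) t = 1 - cis (2 * pi * of_int (y - z) / of_int e) * cis (2 * pi * of_int d / of_int e) ^ t"
    for z e t
    by (simp add: F_def DeMoivre cis_mult add_divide_distrib diff_divide_distrib algebra_simps)
  have "\<exists>ts. length ts = 2 ^ length es \<and> (\<forall>t. exp_sum ts t = (\<Prod>p\<leftarrow>es. F p t))"
  proof (induction es)
    case Nil
    show ?case by (rule exI[of _ "[(1, 1)]"]) simp
  next
    case (Cons p es)
    obtain z e where p: "p = (z, e)" by fastforce
    from Cons obtain ts where ts: "length ts = 2 ^ length es"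
      "\<And>t. exp_sum ts t = (\<Prod>p\<leftarrow>es. F p t)" by blast
    \<comment> \<open>The new factor is 1 minus a multiple of a power, so the list of terms doubles:
      one copy unchanged, one with rescaled coefficients and bases.\<close>
    let ?us = "ts @ map (\<lambda>(c, w). (- c * cis (2 * pi * of_int (y - z) / of_int e),
      w * cis (2 * pi * of_int d / of_int e))) ts"
    have "exp_sum ?us t = (\<Prod>p\<leftarrow>p # es. F p t)" for t
      by (simp only: exp_sum_simps exp_sum_scale p F list.map prod_list.Cons ts(2)) (simp add: algebra_simps)
    then show ?case using ts(1) by (intro exI[of _ ?us]) simp
  qed
  then obtain ts where ts: "length ts = 2 ^ length es"
    "\<And>t. exp_sum ts t = (\<Prod>p\<leftarrow>es. F p t)" by blast
  have zero: "(\<Prod>p\<leftarrow>es. F p t) = 0 \<longleftrightarrow> (\<exists>(z, e)\<in>set es. e dvd y + int t * d - z)" for t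
  proof -
    have "F (z, e) t = 0 \<longleftrightarrow> e dvd y + int t * d - z" if "(z, e) \<in> set es" for z e
      unfolding F_def prod.case right_minus_eq cis_int_div_eq_1_iff[OF pos[OF that], symmetric]
      by (rule eq_commute)
    then show ?thesis unfolding prod_list_zero_iff by (force simp: image_iff)
  qed
  \<comment> \<open>The sum has exactly as many terms as the hypothesis has covered
    arguments.\<close>
  have "exp_sum ts t = 0"
    by (rule exp_sum_eq_0) (simp add: ts zero cov del: split_paired_Ex)
  then show ?thesis by (simp add: ts zero)
qed

section \<open>Progressions as sets, and walks inside a finite set\<close>

lemma is_AP_progression: "is_AP (map (\<lambda>i. a + int i * d) [0..<Suc x])"
  unfolding is_AP_def by blast

lemma set_progression: "set (map (\<lambda>i. a + int i * d) [0..<Suc x]) = (\<lambda>t. a + int t * d) ` {..x}"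
  by (auto simp del: upt_Suc)

lemma progression_rev:
  "(\<lambda>t. a + int t * d) ` {..x} = (\<lambda>t. (a + int x * d) + int t * (- d)) ` {..x}" (is "?l = ?r")
proof
  show "?l \<subseteq> ?r"
  proof
    fix p assume "p \<in> ?l"
    then obtain t where "t \<le> x" "p = a + int t * d" by auto
    then have "p = (a + int x * d) + int (x - t) * (- d)" by (simp add: of_nat_diff algebra_simps)
    then show "p \<in> ?r" by (intro image_eqI[of _ _ "x - t"]) simp_all
  qed
  show "?r \<subseteq> ?l"
  proof
    fix p assume "p \<in> ?r"
    then obtain t where "t \<le> x" "p = (a + int x * d) + int t * (- d)" by auto
    then have "p = a + int (x - t) * d" by (simp add: of_nat_diff algebra_simps)
    then show "p \<in> ?l" by (intro image_eqI[of _ _ "x - t"]) simp_all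
  qed
qed

lemma is_AP_increasing:
  assumes "is_AP s"
  obtains a d L where "d > 0" "set s = (\<lambda>t. a + int t * d) ` {..L}"
proof -
  obtain a d x where s: "set s = (\<lambda>t. a + int t * d) ` {..x}"
    using assms set_progression unfolding is_AP_def by metis
  consider "d > 0" | "d = 0" | "- d > 0" by linarith
  then show thesis
  proof cases
    case 1
    with s show ?thesis using that by blast
  next
    case 2
    \<comment> \<open>A constant progression is one point, so any positive difference describes it
      once \<open>L\<close> is 0.\<close>
    then have "set s = (\<lambda>t. a + int t * 1) ` {..0}" using s by auto
    then show ?thesis by (rule that[rotated]) simp
  next
    case 3
    with s show ?thesis using that progression_rev by metis
  qed
qed

text \<open>Separates the two endpoints from the residue class. Where the endpoints impose no
  condition, only divisibility is left, the form that \<open>residue_classes_cover\<close>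
  handles.\<close>

lemma is_AP_interval:
  assumes "is_AP s"
  obtains lo hi e where "e > 0" "set s = {p. lo \<le> p \<and> p \<le> hi \<and> e dvd p - lo}"
proof -
  obtain a d L where d: "d > 0" and s: "set s = (\<lambda>t. a + int t * d) ` {..L}"
    using is_AP_increasing[OF assms] .
  have "set s = {p. a \<le> p \<and> p \<le> a + int L * d \<and> d dvd p - a}" (is "_ = ?r")
  proof
    show "set s \<subseteq> ?r" using d by (auto simp: s mult_right_mono)
    show "?r \<subseteq> set s"
    proof
      fix p assume p: "p \<in> ?r"
      then obtain c where c: "p - a = d * c" by auto
      with p d have "0 \<le> c" using zero_le_mult_iff[of d c] by auto
      have "d * c \<le> d * int L" using p c by (simp add: mult.commute)
      then have "c \<le> int L" using d by simp
      with \<open>0 \<le> c\<close> c show "p \<in> set s" unfolding s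
        by (intro image_eqI[of _ _ "nat c"]) (auto simp: algebra_simps)
    qed
  qed
  with d that show thesis by blast
qed

text \<open>Standing still in front of a gap makes the walk total, so a loop of fixed length can run
  it without testing for the end.\<close>

definition advance :: "int set \<Rightarrow> int \<Rightarrow> int \<Rightarrow> int" where
  "advance X d p = (if p + d \<in> X then p + d else p)"

text \<open>For \<open>x\<close> in a finite \<open>X\<close> this is the longest run in
  \<open>X\<close> from \<open>x\<close> with difference \<open>d\<close>; for \<open>d = 0\<close>
  it is just \<open>{x}\<close>.\<close>

definition ray :: "int set \<Rightarrow> int \<Rightarrow> int \<Rightarrow> int set" where
  "ray X d x = (\<lambda>t. (advance X d ^^ t) x) ` {..<card X}"

text \<open>Walk from \<open>x\<close> to the last element and collect the progression on the way back; unless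
  \<open>d = 0\<close>, fewer than \<open>card X\<close> steps are possible in either direction.\<close>

definition maximal_AP :: "int set \<Rightarrow> int \<Rightarrow> int \<Rightarrow> int set" where
  "maximal_AP X d x = ray X (- d) ((advance X d ^^ card X) x)"

text \<open>\<open>L\<close> is the number of effective steps among the first \<open>n\<close>. If
  \<open>L = n\<close>, nothing is claimed about the next point, since the walk may not have
  ended.\<close>

lemma advance_pow:
  assumes "x \<in> X"
  obtains L where "L \<le> n" "\<And>t. t \<le> n \<Longrightarrow> (advance X d ^^ t) x = x + int (min t L) * d"
    "\<And>t. t \<le> L \<Longrightarrow> x + int t * d \<in> X" "L < n \<Longrightarrow> x + int (Suc L) * d \<notin> X"
proof -
  have "\<exists>L\<le>n. (\<forall>t\<le>n. (advance X d ^^ t) x = x + int (min t L) * d)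
     \<and> (\<forall>t\<le>L. x + int t * d \<in> X) \<and> (L < n \<longrightarrow> x + int (Suc L) * d \<notin> X)"
  proof (induction n)
    case 0
    then show ?case using assms by auto
  next
    case (Suc n)
    then obtain L where L: "L \<le> n" "\<And>t. t \<le> n \<Longrightarrow> (advance X d ^^ t) x = x + int (min t L) * d"
      "\<And>t. t \<le> L \<Longrightarrow> x + int t * d \<in> X" "L < n \<Longrightarrow> x + int (Suc L) * d \<notin> X" by blast
    have last: "(advance X d ^^ Suc n) x = advance X d (x + int L * d)"
      using L(1,2) by simp
    show ?case
    proof (cases "x + int (Suc L) * d \<in> X")
      case True
      then have "L = n" using L by force
      then have "advance X d (x + int L * d) = x + int (Suc n) * d"
        using True by (simp add: advance_def algebra_simps)
      with True last L(2,3) \<open>L = n\<close> show ?thesis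
        by (intro exI[of _ "Suc n"]) (auto simp: le_Suc_eq simp del: funpow.simps of_nat_Suc)
    next
      case False
      then have "advance X d (x + int L * d) = x + int L * d"
        by (simp add: advance_def algebra_simps)
      with False last L show ?thesis
        by (intro exI[of _ L]) (auto simp: le_Suc_eq simp del: funpow.simps of_nat_Suc)
    qed
  qed
  then show thesis using that by blast
qed

lemma run_length:
  fixes X :: "int set"
  assumes "finite X" "d \<noteq> 0" "\<And>t. t \<le> L \<Longrightarrow> x + int t * d \<in> X"
  shows "L < card X"
proof -
  have "card ((\<lambda>t. x + int t * d) ` {..L}) = Suc L"
    using assms(2) by (subst card_image) (auto simp: inj_on_def)
  moreover have "card ((\<lambda>t. x + int t * d) ` {..L}) \<le> card X"
    using assms by (intro card_mono) auto
  ultimately show ?thesis by simp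
qed

lemma ray_eq:
  assumes "finite X" "x \<in> X"
  obtains L where "L < card X" "ray X d x = (\<lambda>t. x + int t * d) ` {..L}"
    "\<And>t. t \<le> L \<Longrightarrow> x + int t * d \<in> X" "Suc L < card X \<Longrightarrow> x + int (Suc L) * d \<notin> X"
proof -
  have n: "card X > 0" using assms by (auto simp: card_gt_0_iff)
  obtain L where L: "L \<le> card X - 1"
    "\<And>t. t \<le> card X - 1 \<Longrightarrow> (advance X d ^^ t) x = x + int (min t L) * d"
    "\<And>t. t \<le> L \<Longrightarrow> x + int t * d \<in> X" "L < card X - 1 \<Longrightarrow> x + int (Suc L) * d \<notin> X"
    using advance_pow[OF assms(2), of "card X - 1" d] by blast
  have "ray X d x = (\<lambda>t. x + int t * d) ` {..L}"
  proof
    show "ray X d x \<subseteq> (\<lambda>t. x + int t * d) ` {..L}"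
      using L(2) by (auto simp: ray_def)
    show "(\<lambda>t. x + int t * d) ` {..L} \<subseteq> ray X d x"
    proof
      fix p assume "p \<in> (\<lambda>t. x + int t * d) ` {..L}"
      then obtain t where "t \<le> L" "p = x + int t * d" by auto
      then show "p \<in> ray X d x" unfolding ray_def using L(1,2) n
        by (intro image_eqI[of _ _ t]) auto
    qed
  qed
  with L n that[of L] show thesis by auto
qed

lemma ray_is_AP:
  assumes "finite X" "x \<in> X"
  obtains s where "is_AP s" "set s = ray X d x" "set s \<subseteq> X"
proof -
  obtain L where L: "ray X d x = (\<lambda>t. x + int t * d) ` {..L}" "\<And>t. t \<le> L \<Longrightarrow> x + int t * d \<in> X"
    using ray_eq[OF assms, of d] by metis
  show thesis
    by (rule that[OF is_AP_progression[of x d L]]) (use L in \<open>auto simp del: upt_Suc simp: set_progression\<close>)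
qed

text \<open>If the walk stops before \<open>card X - 1\<close> steps, the point after its end is
  missing from \<open>X\<close> and the given run cannot reach past it; otherwise the walk is at
  least as long as any run by \<open>run_length\<close>. For \<open>d = 0\<close> both sides are a
  single point.\<close>

lemma progression_subset_ray:
  assumes "finite X" "\<And>t. t \<le> M \<Longrightarrow> a + int t * d \<in> X"
  shows "(\<lambda>t. a + int t * d) ` {..M} \<subseteq> ray X d a"
proof -
  have a: "a \<in> X" using assms(2)[of 0] by simp
  obtain L where L: "L < card X" "ray X d a = (\<lambda>t. a + int t * d) ` {..L}"
    "\<And>t. t \<le> L \<Longrightarrow> a + int t * d \<in> X" "Suc L < card X \<Longrightarrow> a + int (Suc L) * d \<notin> X"
    using ray_eq[OF assms(1) a, of d] by blast
  show ?thesis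
  proof (cases "d = 0")
    case True
    then show ?thesis unfolding L(2) by (auto intro: image_eqI[of _ _ 0])
  next
    case False
    then have "M < card X" using assms by (intro run_length)
    moreover have "M \<le> L" if "Suc L < card X"
      using L(4)[OF that] assms(2)[of "Suc L"] by linarith
    ultimately have "M \<le> L" by linarith
    then show ?thesis by (auto simp: L)
  qed
qed

text \<open>The first two terms determine a ray, so the pairs of elements of \<open>X\<close> form a
  family of quadratic size that can replace all progressions. A single point uses
  \<open>y = x\<close>.\<close>

lemma AP_subset_ray:
  assumes "finite X" "is_AP s" "set s \<subseteq> X"
  obtains x y where "x \<in> X" "y \<in> X" "set s \<subseteq> ray X (y - x) x"
proof -
  obtain a d L where d: "d > 0" "set s = (\<lambda>t. a + int t * d) ` {..L}"
    using is_AP_increasing[OF assms(2)] .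
  then have X: "a + int t * d \<in> X" if "t \<le> L" for t using assms(3) that by auto
  show thesis
  proof (cases L)
    case 0
    with d have "set s = (\<lambda>t. a + int t * 0) ` {..0}" by simp
    then show thesis using that[of a a] progression_subset_ray[of X 0 a 0] assms(1) X[of 0] by simp
  next
    case (Suc L')
    then show thesis using that[of a "a + d"] progression_subset_ray[OF assms(1), of L a d] X
      X[of 0] X[of 1] d by auto
  qed
qed

lemma advance_pow_in: "x \<in> X \<Longrightarrow> (advance X d ^^ t) x \<in> X"
  by (induction t) (auto simp: advance_def)

lemma maximal_AP_is_AP:
  assumes "finite X" "x \<in> X"
  obtains s where "is_AP s" "set s = maximal_AP X d x" "set s \<subseteq> X"
  using ray_is_AP[OF assms(1) advance_pow_in[OF assms(2)]] unfolding maximal_AP_def .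

text \<open>The start may be any term of the progression: the walk up ends at or beyond the last
  term, and the way back passes all earlier ones.\<close>

lemma maximal_AP_contains:
  assumes "finite X" "d \<noteq> 0" "\<And>t. t \<le> M \<Longrightarrow> a + int t * d \<in> X" "t0 \<le> M"
  shows "(\<lambda>t. a + int t * d) ` {..M} \<subseteq> maximal_AP X d (a + int t0 * d)"
proof -
  let ?x = "a + int t0 * d"
  have x: "?x \<in> X" using assms by simp
  obtain L where L: "L \<le> card X"
    "\<And>t. t \<le> card X \<Longrightarrow> (advance X d ^^ t) ?x = ?x + int (min t L) * d"
    "\<And>t. t \<le> L \<Longrightarrow> ?x + int t * d \<in> X" "L < card X \<Longrightarrow> ?x + int (Suc L) * d \<notin> X"
    using advance_pow[OF x] by blast
  have "L < card X" using run_length[OF assms(1,2) L(3)] .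
  with L(4) have out: "a + int (Suc (t0 + L)) * d \<notin> X" by (simp add: algebra_simps)
  with assms(3) have M: "M \<le> t0 + L" by (meson not_less_eq_eq)
  have e: "(advance X d ^^ card X) ?x = a + int (t0 + L) * d"
    using L(1) L(2)[of "card X"] by (simp add: algebra_simps)
  have in_X: "a + int t * d \<in> X" if "t \<le> t0 + L" for t
  proof (cases "t \<le> t0")
    case True
    then show ?thesis using assms by simp
  next
    case False
    with that L(3)[of "t - t0"] show ?thesis by (simp add: of_nat_diff algebra_simps)
  qed
  have "(\<lambda>t. a + int t * d) ` {..M} \<subseteq> (\<lambda>t. a + int t * d) ` {..t0 + L}" using M by auto
  also have "\<dots> = (\<lambda>t. (a + int (t0 + L) * d) + int t * (- d)) ` {..t0 + L}" by (rule progression_rev)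
  also have "\<dots> \<subseteq> ray X (- d) (a + int (t0 + L) * d)"
  proof (rule progression_subset_ray[OF assms(1)])
    fix t assume "t \<le> t0 + L"
    with in_X[of "t0 + L - t"] show "a + int (t0 + L) * d + int t * - d \<in> X"
      by (simp add: of_nat_diff algebra_simps)
  qed
  finally show ?thesis by (simp only: maximal_AP_def e)
qed

section \<open>Guessing progressions and counting the rest\<close>

text \<open>A relaxation of \<open>CAP\<close> that asks only for a cover of \<open>U\<close>, by
  progressions that may also use elements outside \<open>U\<close>. In this form the problem
  survives a round of choices.\<close>

definition covers :: "int set \<Rightarrow> nat \<Rightarrow> int set \<Rightarrow> bool" where
  "covers X r U \<longleftrightarrow> (\<exists>ss. length ss = r \<and> (\<forall>s\<in>set ss. is_AP s \<and> set s \<subseteq> X) \<and> U \<subseteq> (\<Union>s\<in>set ss. set s))"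

text \<open>Records that \<open>j\<close> progressions have been spent on \<open>C\<close>, so that
  a cover of the rest completes to a cover of \<open>X\<close>.\<close>

definition AP_union :: "int set \<Rightarrow> nat \<Rightarrow> int set \<Rightarrow> bool" where
  "AP_union X j C \<longleftrightarrow> (\<exists>ts. length ts = j \<and> (\<forall>t\<in>set ts. is_AP t \<and> set t \<subseteq> X) \<and> C = (\<Union>t\<in>set ts. set t))"

lemma CAP_iff_covers: "CAP X k \<longleftrightarrow> covers X k X"
  unfolding CAP_def covers_def by (intro ex_cong1) blast

lemma covers_0 [simp]: "covers X 0 U \<longleftrightarrow> U = {}"
  unfolding covers_def by auto

lemma AP_union_subset: "AP_union X j C \<Longrightarrow> C \<subseteq> X"
  unfolding AP_union_def by blast

lemma AP_union_empty: "AP_union X 0 {}"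
  unfolding AP_union_def by simp

lemma AP_union_insert:
  assumes "AP_union X j C" "is_AP s" "set s \<subseteq> X"
  shows "AP_union X (Suc j) (C \<union> set s)"
proof -
  obtain ts where "length ts = j" "\<forall>t\<in>set ts. is_AP t \<and> set t \<subseteq> X" "C = (\<Union>t\<in>set ts. set t)"
    using assms(1) unfolding AP_union_def by blast
  with assms(2,3) show ?thesis unfolding AP_union_def by (intro exI[of _ "s # ts"]) auto
qed

lemma covers_AP_union:
  assumes "AP_union X j C" "covers X r (X - C)"
  shows "CAP X (j + r)"
proof -
  obtain ts where "length ts = j" "\<forall>t\<in>set ts. is_AP t \<and> set t \<subseteq> X" "C = (\<Union>t\<in>set ts. set t)"
    using assms(1) unfolding AP_union_def by blast
  moreover obtain ss where "length ss = r" "\<forall>s\<in>set ss. is_AP s \<and> set s \<subseteq> X" "X - C \<subseteq> (\<Union>s\<in>set ss. set s)"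
    using assms(2) unfolding covers_def by blast
  ultimately show ?thesis unfolding CAP_iff_covers covers_def by (intro exI[of _ "ts @ ss"]) auto
qed

section \<open>The first uncovered points and the candidate pairs\<close>

definition low :: "int set \<Rightarrow> int set \<Rightarrow> nat \<Rightarrow> int set" where
  "low X C Q = {x \<in> X - C. card {y \<in> X - C. y \<le> x} \<le> Q}"

text \<open>\<open>y\<close> is a guess for the term after \<open>x\<close> on an unknown
  progression. Demanding another point of \<open>W\<close> within \<open>Q\<close> steps is what
  keeps the number of pairs independent of \<open>X\<close>.\<close>

definition eligible :: "int set \<Rightarrow> nat \<Rightarrow> int \<Rightarrow> int \<Rightarrow> bool" where
  "eligible W Q x y \<longleftrightarrow> x \<in> W \<and> x < y \<and> (\<exists>j\<in>{1..Q}. x + int j * (y - x) \<in> W)"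

text \<open>The rank maps \<open>U\<close> injectively into \<open>{1..card U}\<close>, hence onto
  it, so points of rank at most \<open>q\<close> are as many as the ranks up to
  \<open>q\<close>.\<close>

lemma card_initial_segment:
  fixes U :: "int set"
  assumes "finite U"
  shows "card {x \<in> U. card {y \<in> U. y \<le> x} \<le> q} = min q (card U)"
proof -
  define rk where "rk x = card {y \<in> U. y \<le> x}" for x
  have less: "rk x < rk y" if "x < y" "y \<in> U" for x y
  proof -
    have "y \<in> {z \<in> U. z \<le> y}" "y \<notin> {z \<in> U. z \<le> x}" using that by auto
    moreover have "{z \<in> U. z \<le> x} \<subseteq> {z \<in> U. z \<le> y}" using that by auto
    ultimately have "{z \<in> U. z \<le> x} \<subset> {z \<in> U. z \<le> y}" by blast
    then show ?thesis unfolding rk_def using assms by (intro psubset_card_mono) auto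
  qed
  have inj: "inj_on rk U"
    by (rule linorder_inj_onI) (use less in \<open>force+\<close>)
  have "rk ` U \<subseteq> {1..card U}"
  proof
    fix c assume "c \<in> rk ` U"
    then obtain x where x: "x \<in> U" "c = rk x" by blast
    have "card {x} \<le> rk x" unfolding rk_def using x assms by (intro card_mono) auto
    moreover have "rk x \<le> card U" unfolding rk_def using assms by (intro card_mono) auto
    ultimately show "c \<in> {1..card U}" using x by simp
  qed
  then have im: "rk ` U = {1..card U}"
    by (intro card_subset_eq) (simp_all add: card_image[OF inj])
  have "card {x \<in> U. rk x \<le> q} = card (rk ` {x \<in> U. rk x \<le> q})"
    by (rule card_image[symmetric]) (rule inj_on_subset[OF inj], blast)
  also have "rk ` {x \<in> U. rk x \<le> q} = rk ` U \<inter> {..q}" by auto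
  also have "\<dots> = {1..min q (card U)}" by (auto simp: im)
  finally show ?thesis by (simp add: rk_def)
qed

lemma card_low_le: "finite X \<Longrightarrow> card (low X C Q) \<le> Q"
  using card_initial_segment[of "X - C" Q] by (simp add: low_def)

text \<open>A pair can be recovered from \<open>x\<close>, the second low point and the number of
  steps between them, with at most \<open>Q\<close> choices for each. This bounds the pairs although
  \<open>y\<close> ranges over all integers.\<close>

lemma card_eligible_le:
  assumes "finite X"
  shows "finite {(x, y). eligible (low X C Q) Q x y}"
    and "card {(x, y). eligible (low X C Q) Q x y} \<le> Q ^ 3"
proof -
  let ?W = "low X C Q" and ?E = "{(x, y). eligible (low X C Q) Q x y}"
  have fin: "finite ?W" using assms by (simp add: low_def)
  define g where "g = (\<lambda>(x, y). let j = (SOME j. j \<in> {1..Q} \<and> x + int j * (y - x) \<in> ?W)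
     in (x, x + int j * (y - x), j))"
  have g: "\<exists>j\<in>{1..Q}. g (x, y) = (x, x + int j * (y - x), j) \<and> x + int j * (y - x) \<in> ?W"
    if "(x, y) \<in> ?E" for x y
  proof -
    from that have "\<exists>j. j \<in> {1..Q} \<and> x + int j * (y - x) \<in> ?W"
      unfolding eligible_def by blast
    from someI_ex[OF this] show ?thesis unfolding g_def Let_def prod.case by blast
  qed
  have "inj_on g ?E"
  proof (rule inj_onI)
    fix p p' assume p: "p \<in> ?E" "p' \<in> ?E" "g p = g p'"
    obtain x y x' y' where xy: "p = (x, y)" "p' = (x', y')" by fastforce
    from g[of x y] g[of x' y'] p obtain j where
      "j \<ge> 1" "x = x'" "x + int j * (y - x) = x' + int j * (y' - x')"
      unfolding xy by auto
    then show "p = p'" by (simp add: xy)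
  qed
  moreover have "g ` ?E \<subseteq> ?W \<times> ?W \<times> {1..Q}"
  proof
    fix c assume "c \<in> g ` ?E"
    then obtain x y where xy: "(x, y) \<in> ?E" "c = g (x, y)" by auto
    from g[OF xy(1)] xy show "c \<in> ?W \<times> ?W \<times> {1..Q}" by (auto simp: eligible_def)
  qed
  moreover have le: "card (?W \<times> ?W \<times> {1..Q}) \<le> Q ^ 3"
    using card_low_le[OF assms, of C Q]
    by (auto simp: card_cartesian_product power3_eq_cube intro!: mult_mono)
  moreover have "finite (?W \<times> ?W \<times> {1..Q})" using fin by blast
  ultimately show "finite ?E" and "card ?E \<le> Q ^ 3"
    using inj_on_finite[of g ?E] card_inj_on_le[of g ?E] le_trans[OF _ le] by blast+
qed

text \<open>Two uncovered points that no endpoint of a chosen progression separates, consecutive among the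
  uncovered points of a progression \<open>s\<close>, are at most \<open>2 ^ j\<close> steps of \<open>s\<close> apart: otherwise the
  chosen progressions that span both points cover \<open>2 ^ j\<close> consecutive terms of \<open>s\<close> between them and
  hence all terms. The \<open>2 * j\<close> endpoints cut the line into at most \<open>2 * j + 1\<close> windows, which the
  function \<open>\<sigma>\<close> below numbers from left to right, so by pigeonhole such a pair exists as
  soon as more than \<open>(2 * j + 1) * r\<close> points are uncovered.\<close>

lemma eligible_pair_exists:
  assumes fin: "finite X" and C: "AP_union X j C" and cov: "covers X r (X - C)"
    and m: "(2 * j + 1) * r \<le> m" "m < card (X - C)" and Q: "m < Q" "2 ^ j \<le> Q"
  obtains x y where "x \<in> X" "y \<in> X" "eligible (low X C Q) Q x y"
    "covers X (r - 1) (X - (C \<union> maximal_AP X (y - x) x))"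
proof -
  define U where "U = X - C"
  obtain ts where ts': "length ts = j \<and> (\<forall>t\<in>set ts. is_AP t \<and> set t \<subseteq> X) \<and> C = (\<Union>t\<in>set ts. set t)"
    using C unfolding AP_union_def ..
  then have ts: "length ts = j" "\<And>t. t \<in> set ts \<Longrightarrow> is_AP t" "C = (\<Union>t\<in>set ts. set t)" by simp_all
  obtain ss where ss': "length ss = r \<and> (\<forall>s\<in>set ss. is_AP s \<and> set s \<subseteq> X) \<and> X - C \<subseteq> (\<Union>s\<in>set ss. set s)"
    using cov unfolding covers_def ..
  then have ss: "length ss = r" "\<And>s. s \<in> set ss \<Longrightarrow> is_AP s \<and> set s \<subseteq> X"
    "U \<subseteq> (\<Union>s\<in>set ss. set s)" by (simp_all add: U_def)
  have "\<forall>t\<in>set ts. \<exists>c. case c of (lo, hi, e) \<Rightarrow>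
    e > 0 \<and> set t = {p. lo \<le> p \<and> p \<le> hi \<and> e dvd p - lo}"
  proof
    fix t assume "t \<in> set ts"
    obtain lo hi e where "e > 0" "set t = {p. lo \<le> p \<and> p \<le> hi \<and> e dvd p - lo}"
      using is_AP_interval[OF ts(2)[OF \<open>t \<in> set ts\<close>]] .
    then show "\<exists>c. case c of (lo, hi, e) \<Rightarrow> e > 0 \<and> set t = {p. lo \<le> p \<and> p \<le> hi \<and> e dvd p - lo}"
      by (intro exI[of _ "(lo, hi, e)"]) simp
  qed
  from bchoice[OF this] obtain c where c: "\<forall>t\<in>set ts. case c t of (lo, hi, e) \<Rightarrow>
    e > 0 \<and> set t = {p. lo \<le> p \<and> p \<le> hi \<and> e dvd p - lo}" by blast
  define lo hi e where "lo t = fst (c t)" and "hi t = fst (snd (c t))" and "e t = snd (snd (c t))" for t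
  have e: "e t > 0" and set_t: "set t = {p. lo t \<le> p \<and> p \<le> hi t \<and> e t dvd p - lo t}"
    if "t \<in> set ts" for t
    using bspec[OF c that] by (simp_all add: lo_def hi_def e_def case_prod_unfold)
  define \<sigma> where "\<sigma> p = card {t \<in> set ts. lo t \<le> p} + card {t \<in> set ts. hi t < p}" for p
  have \<sigma>_le: "\<sigma> p \<le> 2 * j" for p
  proof -
    have "card {t \<in> set ts. P t} \<le> j" for P
      using card_mono[of "set ts" "{t \<in> set ts. P t}"] card_length[of ts] ts(1)
      by (metis (no_types, lifting) List.finite_set le_trans mem_Collect_eq subsetI)
    from this[of "\<lambda>t. lo t \<le> p"] this[of "\<lambda>t. hi t < p"] show ?thesis by (simp add: \<sigma>_def)
  qed
  have \<sigma>_eq: "(lo t \<le> u \<longleftrightarrow> lo t \<le> v) \<and> (hi t < u \<longleftrightarrow> hi t < v)"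
    if "\<sigma> u = \<sigma> v" "u < v" "t \<in> set ts" for u v t
  proof -
    have sub: "{t \<in> set ts. lo t \<le> u} \<subseteq> {t \<in> set ts. lo t \<le> v}"
      "{t \<in> set ts. hi t < u} \<subseteq> {t \<in> set ts. hi t < v}" using that(2) by auto
    \<comment> \<open>Both counts grow with the point, so equal sums force equal counts and then
      equal sets.\<close>
    from sub[THEN card_mono[rotated]] that(1)
    have "card {t \<in> set ts. lo t \<le> u} = card {t \<in> set ts. lo t \<le> v}"
      "card {t \<in> set ts. hi t < u} = card {t \<in> set ts. hi t < v}" by (simp_all add: \<sigma>_def)
    with sub have "{t \<in> set ts. lo t \<le> u} = {t \<in> set ts. lo t \<le> v}"
      "{t \<in> set ts. hi t < u} = {t \<in> set ts. hi t < v}" by (intro card_subset_eq sub; simp)+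
    with that(3) show ?thesis by blast
  qed
  have "\<forall>p\<in>U. \<exists>i<r. p \<in> set (ss ! i)"
  proof
    fix p assume "p \<in> U"
    then obtain s where "s \<in> set ss" "p \<in> set s" using ss(3) by blast
    then show "\<exists>i<r. p \<in> set (ss ! i)" unfolding in_set_conv_nth[of s ss] ss(1) by blast
  qed
  from bchoice[OF this] obtain ix where ix: "\<And>p. p \<in> U \<Longrightarrow> ix p < r \<and> p \<in> set (ss ! ix p)" by blast
  \<comment> \<open>The first \<open>m + 1\<close> uncovered points, more than there are
    combinations of a window and a progression.\<close>
  define W where "W = {x \<in> U. card {y \<in> U. y \<le> x} \<le> Suc m}"
  have card_W: "card W = Suc m"
    using card_initial_segment[of U "Suc m"] fin m(2) by (simp add: W_def U_def)
  have "\<not> inj_on (\<lambda>p. (\<sigma> p, ix p)) W"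
  proof
    assume "inj_on (\<lambda>p. (\<sigma> p, ix p)) W"
    moreover have "(\<lambda>p. (\<sigma> p, ix p)) ` W \<subseteq> {..2 * j} \<times> {..<r}"
      using \<sigma>_le ix by (auto simp: W_def)
    ultimately have "card W \<le> card ({..2 * j} \<times> {..<r})" by (rule card_inj_on_le) simp
    also have "\<dots> = (2 * j + 1) * r" by (simp add: card_cartesian_product)
    finally show False using card_W m(1) by simp
  qed
  then obtain u v where uv: "u \<in> W" "v \<in> W" "\<sigma> u = \<sigma> v" "ix u = ix v" "u < v"
    using linorder_inj_onI[of W "\<lambda>p. (\<sigma> p, ix p)"] by force
  define s where "s = ss ! ix u"
  have U: "u \<in> U" "v \<in> U" using uv by (auto simp: W_def)
  have s: "s \<in> set ss" "u \<in> set s" "v \<in> set s" "is_AP s" "set s \<subseteq> X"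
    using ix[OF U(1)] ix[OF U(2)] ss(1,2) uv(4) by (auto simp: s_def)
  obtain a d L where d: "d > 0" and set_s: "set s = (\<lambda>t. a + int t * d) ` {..L}"
    using is_AP_increasing[OF s(4)] .
  obtain iu iv where iu: "iu \<le> L" "u = a + int iu * d" and iv: "iv \<le> L" "v = a + int iv * d"
    using s(2,3) by (auto simp: set_s)
  have "iu < iv"
    using uv(5) d by (simp add: iu iv)
  \<comment> \<open>The next uncovered term of \<open>s\<close> after \<open>u\<close>. Since
    \<open>v\<close> qualifies, it lies at or before \<open>v\<close>, and all terms of
    \<open>s\<close> in between are covered.\<close>
  define w where "w = (LEAST i. i > iu \<and> a + int i * d \<in> U)"
  have w: "w > iu" "a + int w * d \<in> U" "w \<le> iv"
    unfolding w_def using LeastI[of "\<lambda>i. i > iu \<and> a + int i * d \<in> U" iv]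
      Least_le[of "\<lambda>i. i > iu \<and> a + int i * d \<in> U" iv] \<open>iu < iv\<close> iv U(2) by auto
  have w_min: "a + int i * d \<notin> U" if "i > iu" "i < w" for i
    using not_less_Least[of i] that unfolding w_def by blast
  define g where "g = w - iu"
  have g: "g \<ge> 1" "a + int w * d = u + int g * d"
    using w(1) by (simp_all add: g_def iu of_nat_diff algebra_simps)
  have le_v: "u + int g * d \<le> v"
    using w(3) d by (simp add: g(2)[symmetric] iv)
  have "g \<le> 2 ^ j"
  proof (rule ccontr)
    assume "\<not> g \<le> 2 ^ j"
    \<comment> \<open>Only chosen progressions that span both \<open>u\<close> and \<open>v\<close>
      can cover a term strictly between them.\<close>
    define as where "as = filter (\<lambda>t. lo t \<le> u \<and> v \<le> hi t) ts"
    let ?es = "map (\<lambda>t. (lo t, e t)) as"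
    have "length as \<le> j" unfolding as_def using ts(1) length_filter_le by metis
    then have "2 ^ length as \<le> (2 ^ j :: nat)" by (intro power_increasing) auto
    with \<open>\<not> g \<le> 2 ^ j\<close> have big: "2 ^ length as < g" by linarith
    \<comment> \<open>Counting starts at the first term after \<open>u\<close>, so
      \<open>t = g - 1\<close> is the uncovered term itself; its residue class would place it in
      \<open>C\<close>.\<close>
    have "\<exists>(z, e)\<in>set ?es. e dvd u + d + int (g - 1) * d - z"
    proof (rule residue_classes_cover)
      show "e' > 0" if "(z, e') \<in> set ?es" for z e' using that e by (auto simp: as_def)
      fix t :: nat assume "t < 2 ^ length ?es"
      with big have t: "Suc t < g" by simp
      define p where "p = u + d + int t * d"
      have p: "p = a + int (iu + Suc t) * d" by (simp add: p_def iu algebra_simps)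
      have "iu + Suc t < w" using t by (simp add: g_def)
      then have "p \<notin> U" using w_min[of "iu + Suc t"] by (simp add: p)
      moreover have "p \<in> set s" unfolding set_s p using \<open>iu + Suc t < w\<close> w(3) iv(1) by (intro imageI) simp
      ultimately have "p \<in> C" using s(5) by (auto simp: U_def)
      then obtain t' where t': "t' \<in> set ts" "p \<in> set t'" by (auto simp: ts(3))
      have "int (Suc t) * d < int g * d" using t d by (intro mult_strict_right_mono) auto
      then have "u < p" "p < v" using le_v d by (simp_all add: p_def algebra_simps add_pos_nonneg)
      \<comment> \<open>The bounds \<open>lo t' \<le> p < v\<close> and
        \<open>u < p \<le> hi t'\<close> carry over to \<open>u\<close> and \<open>v\<close>,
        because no endpoint separates these two.\<close>
      then have "lo t' \<le> u" "v \<le> hi t'"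
        using t' set_t[OF t'(1)] \<sigma>_eq[OF uv(3,5) t'(1)] by auto
      then have "t' \<in> set as" by (simp add: as_def t'(1))
      moreover have "e t' dvd p - lo t'" using t' set_t[OF t'(1)] by auto
      ultimately show "\<exists>(z, e)\<in>set ?es. e dvd u + d + int t * d - z" by (force simp: p_def)
    qed
    then obtain t where t: "t \<in> set as" "e t dvd u + int g * d - lo t"
      using g(1) by (auto simp: of_nat_diff algebra_simps)
    have "t \<in> set ts" "lo t \<le> u" "v \<le> hi t" using t(1) by (auto simp: as_def)
    moreover have "u \<le> u + int g * d" using d by simp
    ultimately have "u + int g * d \<in> set t"
      using set_t[OF \<open>t \<in> set ts\<close>] t(2) le_v by auto
    with \<open>t \<in> set ts\<close> have "u + int g * d \<in> C" by (auto simp: ts(3))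
    with w(2) g(2) show False by (simp add: U_def)
  qed
  \<comment> \<open>Uncovered points up to \<open>v\<close> have rank at most \<open>m + 1\<close>,
    and \<open>m < Q\<close>.\<close>
  have in_low: "p \<in> low X C Q" if "p \<in> U" "p \<le> v" for p
  proof -
    have "card {y \<in> U. y \<le> p} \<le> card {y \<in> U. y \<le> v}"
      using fin that by (intro card_mono) (auto simp: U_def)
    then show ?thesis using uv(2) that(1) Q(1) by (simp add: low_def U_def W_def)
  qed
  have "a + int (Suc iu) * d \<in> set s" using \<open>iu < iv\<close> iv(1) unfolding set_s by (intro imageI) simp
  then have y: "u + d \<in> X" using s(5) iu(2) by (auto simp: algebra_simps)
  have "eligible (low X C Q) Q u (u + d)"
    using in_low[of u] in_low[of "u + int g * d"] U(1) uv(5) w(2) g le_v d \<open>g \<le> 2 ^ j\<close> Q(2)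
    by (auto simp: eligible_def intro!: bexI[of _ g])
  moreover have max: "set s \<subseteq> maximal_AP X (u + d - u) u"
    using maximal_AP_contains[OF fin, of d L a iu] d iu s(5) by (auto simp: set_s)
  moreover have "covers X (r - 1) (X - (C \<union> maximal_AP X (u + d - u) u))"
    unfolding covers_def
  proof (intro exI conjI)
    show "length (remove1 s ss) = r - 1" using s(1) ss(1) by (simp add: length_remove1)
    show "\<forall>s'\<in>set (remove1 s ss). is_AP s' \<and> set s' \<subseteq> X"
      using ss(2) set_remove1_subset[of s ss] by blast
    show "X - (C \<union> maximal_AP X (u + d - u) u) \<subseteq> (\<Union>s'\<in>set (remove1 s ss). set s')"
    proof
      fix p assume p: "p \<in> X - (C \<union> maximal_AP X (u + d - u) u)"
      then have "p \<in> U" by (simp add: U_def)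
      then obtain s' where s': "s' \<in> set ss" "p \<in> set s'" using ss(3) by blast
      moreover have "s' \<noteq> s" using p max s'(2) by blast
      ultimately show "p \<in> (\<Union>s'\<in>set (remove1 s ss). set s')" by (auto simp: in_set_remove1)
    qed
  qed
  ultimately show thesis using that[of u "u + d"] y U(1) by (auto simp: U_def)
qed

section \<open>Encoding and decoding of guesses\<close>

text \<open>A guess is a number whose digits, with place values \<open>P\<close>, are positions in the list of eligible
  pairs. Subtracting \<open>P\<close> at each eligible pair until the remainder drops below \<open>P\<close> decodes the leading
  digit without division.\<close>

fun visit :: "(int \<Rightarrow> int \<Rightarrow> bool) \<Rightarrow> int \<Rightarrow> int \<Rightarrow> int \<Rightarrow> int \<times> (int \<times> int) option \<Rightarrow> int \<times> (int \<times> int) option" where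
  "visit E P x y (rem, sel) = (if E x y \<and> sel = None
     then (if rem < P then (rem, Some (x, y)) else (rem - P, None)) else (rem, sel))"

definition select :: "(int \<Rightarrow> int \<Rightarrow> bool) \<Rightarrow> int \<Rightarrow> int list \<Rightarrow> int \<Rightarrow> int \<times> (int \<times> int) option" where
  "select E P xs rem = fold (\<lambda>x. fold (visit E P x) xs) xs (rem, None)"

lemma select_eq_fold_product:
  "select E P xs rem = fold (\<lambda>(x, y). visit E P x y) (List.product xs xs) (rem, None)"
proof -
  have "fold (\<lambda>x. fold (visit E P x) ys) xs st = fold (\<lambda>(x, y). visit E P x y) (List.product xs ys) st" for ys st
    by (induction xs arbitrary: st) (simp_all add: fold_map comp_def)
  then show ?thesis by (simp add: select_def)
qed

lemma fold_visit_Some: "fold (\<lambda>(x, y). visit E P x y) ps (rem, Some p) = (rem, Some p)"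
  by (induction ps) auto

lemma fold_visit_nth:
  assumes "0 \<le> r" "r < P" "c < length (filter (\<lambda>(x, y). E x y) ps)"
  shows "fold (\<lambda>(x, y). visit E P x y) ps (int c * P + r, None) = (r, Some (filter (\<lambda>(x, y). E x y) ps ! c))"
  using assms(3)
proof (induction ps arbitrary: c)
  case (Cons p ps)
  obtain x y where p: "p = (x, y)" by fastforce
  show ?case
  proof (cases "E x y")
    case True
    show ?thesis
    proof (cases c)
      case 0
      then show ?thesis using True assms by (simp add: p fold_visit_Some)
    next
      case (Suc c')
      have "P \<le> int c * P + r" using assms by (simp add: Suc algebra_simps)
      moreover have "int c * P + r - P = int c' * P + r" by (simp add: Suc algebra_simps)
      ultimately have "visit E P x y (int c * P + r, None) = (int c' * P + r, None)"
        using True by simp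
      moreover have "filter (\<lambda>(x, y). E x y) (p # ps) ! c = filter (\<lambda>(x, y). E x y) ps ! c'"
        using True by (simp add: p Suc)
      ultimately show ?thesis using True Cons.IH[of c'] Cons.prems by (simp add: p Suc del: visit.simps)
    qed
  next
    case False
    then show ?thesis using Cons by (simp add: p)
  qed
qed simp

text \<open>A digit equal to the number of eligible pairs is used up by the subtractions and selects
  nothing. It encodes an idle round; a base strictly above the number of pairs makes room for
  it.\<close>

lemma fold_visit_none:
  assumes "0 \<le> r" "r < P"
  shows "fold (\<lambda>(x, y). visit E P x y) ps (int (length (filter (\<lambda>(x, y). E x y) ps)) * P + r, None) = (r, None)"
proof (induction ps)
  case Nil
  then show ?case by simp
next
  case (Cons p ps)
  obtain x y where p: "p = (x, y)" by fastforce
  have "0 \<le> int c * P + r" for c using assms by simp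
  from this[of "length (filter (\<lambda>(x, y). E x y) ps)"] Cons show ?case by (simp add: p algebra_simps)
qed

lemma fold_visit_sound:
  "snd (fold (\<lambda>(x, y). visit E P x y) ps (rem, None)) = Some (x, y) \<Longrightarrow> (x, y) \<in> set ps \<and> E x y"
proof (induction ps arbitrary: rem)
  case (Cons p ps)
  obtain x' y' where p: "p = (x', y')" by fastforce
  show ?case
  proof (cases "E x' y' \<and> rem < P")
    case True
    then show ?thesis using Cons.prems by (simp add: p fold_visit_Some)
  next
    case False
    then have "visit E P x' y' (rem, None) = (if E x' y' then (rem - P, None) else (rem, None))" by simp
    with Cons show ?thesis by (auto simp: p simp del: visit.simps split: if_splits)
  qed
qed simp

fun step :: "int list \<Rightarrow> nat \<Rightarrow> int \<Rightarrow> int set \<times> nat \<times> int \<Rightarrow> int set \<times> nat \<times> int" where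
  "step xs Q P (C, j, rem) = (case select (eligible (low (set xs) C Q) Q) P xs rem of
     (rem', None) \<Rightarrow> (C, j, rem')
   | (rem', Some (x, y)) \<Rightarrow> (C \<union> maximal_AP (set xs) (y - x) x, Suc j, rem'))"

text \<open>Base \<open>T\<close>, most significant digit first: with \<open>l\<close> rounds still
  to follow, the current digit has place value \<open>T ^ l\<close>.\<close>

primrec simulate :: "int list \<Rightarrow> nat \<Rightarrow> int \<Rightarrow> nat \<Rightarrow> int set \<times> nat \<times> int \<Rightarrow> int set \<times> nat \<times> int" where
  "simulate xs Q T 0 st = st"
| "simulate xs Q T (Suc l) st = simulate xs Q T l (step xs Q (T ^ l) st)"

lemma step_sound:
  assumes "AP_union (set xs) j C" "step xs Q P (C, j, rem) = (C', j', rem')"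
  shows "AP_union (set xs) j' C' \<and> j' \<le> Suc j"
proof (cases "snd (select (eligible (low (set xs) C Q) Q) P xs rem)")
  case None
  then show ?thesis using assms by (auto split: prod.splits)
next
  case (Some p)
  obtain x y where p: "p = (x, y)" by fastforce
  from fold_visit_sound[OF Some[unfolded select_eq_fold_product p]]
  have "x \<in> set xs" by simp
  then obtain s where s: "is_AP s" "set s = maximal_AP (set xs) (y - x) x" "set s \<subseteq> set xs"
    using maximal_AP_is_AP[of "set xs" x "y - x"] by auto
  show ?thesis using Some AP_union_insert[OF assms(1) s(1,3)] assms(2) by (auto simp: p s(2) split: prod.splits)
qed

text \<open>Valid for every remainder, sensible or not, which is what makes wrong guesses
  harmless.\<close>

lemma simulate_sound:
  assumes "AP_union (set xs) j C" "simulate xs Q T l (C, j, rem) = (C', j', rem')"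
  shows "AP_union (set xs) j' C' \<and> j' \<le> j + l"
  using assms
proof (induction l arbitrary: C j rem)
  case (Suc l)
  obtain C1 j1 rem1 where st: "step xs Q (T ^ l) (C, j, rem) = (C1, j1, rem1)" by (metis prod_cases3)
  from step_sound[OF Suc.prems(1) st] have "AP_union (set xs) j1 C1" "j1 \<le> Suc j" by auto
  with Suc.IH[of j1 C1 rem1] Suc.prems(2) st show ?case by simp
qed simp

text \<open>\<open>m\<close> bounds the number of combinations of a window with a progression when
  \<open>j\<close> progressions are chosen and \<open>r\<close> are to come. \<open>Q\<close> admits
  the first \<open>m + 1\<close> uncovered points and gaps of \<open>2 ^ k\<close> steps.
  \<open>T\<close> exceeds the number of eligible pairs, so that every position and the idle digit
  are valid digits.\<close>

context
  fixes xs :: "int list" and k m Q :: nat and T :: int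
  assumes dist: "distinct xs"
    and m_ge: "\<And>j r. j + r \<le> k \<Longrightarrow> (2 * j + 1) * r \<le> m"
    and Q: "m < Q" "2 ^ k \<le> Q" and T: "int Q ^ 3 < T"
begin

lemma T_pos: "T > 0"
  using T zero_le_power[of "int Q" 3] by linarith

lemma length_eligible:
  "int (length (filter (\<lambda>(x, y). eligible (low (set xs) C Q) Q x y) (List.product xs xs))) < T"
proof -
  let ?l = "filter (\<lambda>(x, y). eligible (low (set xs) C Q) Q x y) (List.product xs xs)"
  have "length ?l = card (set ?l)"
    using dist by (intro distinct_card[symmetric] distinct_filter distinct_product) auto
  also have "\<dots> \<le> card {(x, y). eligible (low (set xs) C Q) Q x y}"
    by (intro card_mono card_eligible_le(1)) auto
  also have "\<dots> \<le> Q ^ 3" by (intro card_eligible_le(2)) simp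
  finally have "int (length ?l) \<le> int (Q ^ 3)" by (simp only: of_nat_le_iff)
  with T show ?thesis unfolding of_nat_power by linarith
qed

lemma encoded_guess_bounds:
  assumes "0 \<le> r" "r < T ^ l" "int c < T"
  shows "0 \<le> int c * T ^ l + r" "int c * T ^ l + r < T ^ Suc l"
proof -
  show "0 \<le> int c * T ^ l + r" using assms T_pos by simp
  have "int c * T ^ l + r < (int c + 1) * T ^ l" using assms by (simp add: algebra_simps)
  also have "\<dots> \<le> T * T ^ l" using assms T_pos by (intro mult_right_mono) auto
  finally show "int c * T ^ l + r < T ^ Suc l" by simp
qed

text \<open>Once few points are left, the remaining rounds must do nothing; idle digits throughout
  achieve this.\<close>

lemma simulate_stay:
  "\<exists>rem. 0 \<le> rem \<and> rem < T ^ l \<and> simulate xs Q T l (C, j, rem) = (C, j, 0)"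
proof (induction l)
  case 0
  then show ?case by simp
next
  case (Suc l)
  then obtain r where r: "0 \<le> r" "r < T ^ l" "simulate xs Q T l (C, j, r) = (C, j, 0)" by blast
  let ?c = "length (filter (\<lambda>(x, y). eligible (low (set xs) C Q) Q x y) (List.product xs xs))"
  have "simulate xs Q T (Suc l) (C, j, int ?c * T ^ l + r) = (C, j, 0)"
    using r(3) by (simp add: select_eq_fold_product fold_visit_none[OF r(1,2)])
  with encoded_guess_bounds[OF r(1,2) length_eligible] show ?case by blast
qed

text \<open>While more than \<open>m\<close> points are uncovered, a good pair exists; its position
  becomes the leading digit, and the induction hypothesis for the enlarged \<open>C\<close> supplies
  the lower ones. Otherwise idle digits fill the remaining rounds.\<close>

lemma simulate_complete:
  assumes "AP_union (set xs) j C" "covers (set xs) (k - j) (set xs - C)" "j \<le> k" "k - j \<le> l"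
  shows "\<exists>rem C' j'. 0 \<le> rem \<and> rem < T ^ l \<and> simulate xs Q T l (C, j, rem) = (C', j', 0)
    \<and> covers (set xs) (k - j') (set xs - C') \<and> card (set xs - C') \<le> m"
  using assms
proof (induction l arbitrary: C j)
  case 0
  \<comment> \<open>Without rounds left, \<open>k - j\<close> is 0, and no progressions cover only
    the empty set.\<close>
  then have "set xs - C = {}" by simp
  moreover have "0 \<le> (0 :: int) \<and> 0 < T ^ 0 \<and> simulate xs Q T 0 (C, j, 0) = (C, j, 0)" by simp
  ultimately show ?case using 0 by (metis card.empty zero_le)
next
  case (Suc l)
  show ?case
  proof (cases "card (set xs - C) \<le> m")
    case True
    obtain rem where "0 \<le> rem" "rem < T ^ Suc l" "simulate xs Q T (Suc l) (C, j, rem) = (C, j, 0)"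
      using simulate_stay by blast
    with True Suc.prems(2) show ?thesis by (intro exI[of _ rem] exI[of _ C] exI[of _ j] conjI)
  next
    case False
    have "(2::nat) ^ j \<le> 2 ^ k" using Suc.prems(3) by (intro power_increasing) auto
    with Q(2) have j: "2 ^ j \<le> Q" by (rule order_trans[rotated])
    have windows: "(2 * j + 1) * (k - j) \<le> m" using Suc.prems(3) by (intro m_ge) simp
    obtain x y where xy: "x \<in> set xs" "y \<in> set xs" "eligible (low (set xs) C Q) Q x y"
      "covers (set xs) (k - j - 1) (set xs - (C \<union> maximal_AP (set xs) (y - x) x))"
      by (rule eligible_pair_exists[OF finite_set Suc.prems(1,2) windows _ Q(1) j]) (use False in simp_all)
    have "j < k"
    proof (rule ccontr)
      assume "\<not> j < k"
      then have "set xs - C = {}" using Suc.prems(2) by simp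
      then show False using False by (metis card.empty zero_le)
    qed
    let ?C = "C \<union> maximal_AP (set xs) (y - x) x"
    obtain s where "is_AP s" "set s = maximal_AP (set xs) (y - x) x" "set s \<subseteq> set xs"
      using maximal_AP_is_AP[of "set xs" x "y - x"] xy(1) by auto
    with AP_union_insert[OF Suc.prems(1)] have "AP_union (set xs) (Suc j) ?C" by metis
    moreover have "k - Suc j \<le> l" using Suc.prems(4) by linarith
    moreover have rest: "covers (set xs) (k - Suc j) (set xs - ?C)" using xy(4) by simp
    ultimately obtain r C' j' where r: "0 \<le> r" "r < T ^ l" "simulate xs Q T l (?C, Suc j, r) = (C', j', 0)"
      "covers (set xs) (k - j') (set xs - C') \<and> card (set xs - C') \<le> m"
      using Suc.IH[of "Suc j" ?C] rest \<open>j < k\<close> unfolding Suc_le_eq by blast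
    let ?l = "filter (\<lambda>(x, y). eligible (low (set xs) C Q) Q x y) (List.product xs xs)"
    have "(x, y) \<in> set ?l" using xy by simp
    then obtain c where c: "c < length ?l" "?l ! c = (x, y)" by (meson in_set_conv_nth)
    have "int c < T" using c(1) length_eligible[of C] by linarith
    moreover have "simulate xs Q T (Suc l) (C, j, int c * T ^ l + r) = (C', j', 0)"
      using r(3) fold_visit_nth[OF r(1,2) c(1)] by (simp add: select_eq_fold_product c(2))
    ultimately show ?thesis using encoded_guess_bounds[OF r(1,2), of c] r(4)
      by (intro exI[of _ "int c * T ^ l + r"] exI[of _ C'] exI[of _ j']) simp
  qed
qed

lemma CAP_iff_simulate:
  "CAP (set xs) k \<longleftrightarrow> (\<exists>rem C j rem'. 0 \<le> rem \<and> rem < T ^ k \<and> simulate xs Q T k ({}, 0, rem) = (C, j, rem')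
    \<and> card (set xs - C) \<le> m \<and> covers (set xs) (k - j) (set xs - C))" (is "_ \<longleftrightarrow> ?r")
proof
  assume "CAP (set xs) k"
  then have "covers (set xs) (k - 0) (set xs - {})" by (simp add: CAP_iff_covers)
  from simulate_complete[OF AP_union_empty this] show ?r by (metis diff_le_self le0)
next
  assume ?r
  then obtain rem C j rem' where sim: "simulate xs Q T k ({}, 0, rem) = (C, j, rem')"
    "covers (set xs) (k - j) (set xs - C)" by blast
  from simulate_sound[OF AP_union_empty sim(1)] have "AP_union (set xs) j C" "j \<le> k" by auto
  with covers_AP_union[of "set xs" j C "k - j"] sim(2) show "CAP (set xs) k" by simp
qed

end

section \<open>Inclusion-exclusion over the remaining points\<close>

lemma sum_alternating_Pow:
  assumes "finite B"
  shows "(\<Sum>A\<in>Pow B. (- 1) ^ card A) = (if B = {} then 1 else 0 :: int)"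
proof (cases "B = {}")
  case False
  then obtain b where b: "b \<in> B" by blast
  have "(\<Sum>A\<in>Pow (insert b (B - {b})). (- 1) ^ card A)
    = (\<Sum>A\<in>Pow (B - {b}). (- 1) ^ card A) + (\<Sum>A\<in>insert b ` Pow (B - {b}). (- 1 :: int) ^ card A)"
    unfolding Pow_insert using assms by (intro sum.union_disjoint) auto
  also have "(\<Sum>A\<in>insert b ` Pow (B - {b}). (- 1 :: int) ^ card A) = (\<Sum>A\<in>Pow (B - {b}). (- 1) ^ card (insert b A))"
    by (rule sum.reindex_cong[OF _ refl refl]) (rule inj_on_inverseI[of _ "\<lambda>A. A - {b}"], auto)
  also have "\<dots> = (\<Sum>A\<in>Pow (B - {b}). - ((- 1) ^ card A))"
  proof (intro sum.cong refl)
    fix A assume "A \<in> Pow (B - {b})"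
    then have "finite A" using assms finite_subset[of A B] by auto
    with \<open>A \<in> Pow (B - {b})\<close> have "card (insert b A) = Suc (card A)"
      by (intro card_insert_disjoint) auto
    then show "(- 1) ^ card (insert b A) = - ((- 1 :: int) ^ card A)" by simp
  qed
  also have "(\<Sum>A\<in>Pow (B - {b}). - ((- 1 :: int) ^ card A)) = - (\<Sum>A\<in>Pow (B - {b}). (- 1) ^ card A)"
    by (rule sum_negf)
  also have "insert b (B - {b}) = B" using b by blast
  finally show ?thesis using False by simp
qed simp

text \<open>The power counts the tuples whose sets all miss \<open>A\<close>. After exchanging the
  sums, each tuple contributes the alternating sum over the subsets of the part of \<open>U\<close>
  that it leaves uncovered, which is 0 unless that part is empty.\<close>

lemma inclusion_exclusion_tuples:
  fixes f :: "'c \<Rightarrow> 'a set"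
  assumes "finite D" "finite U"
  shows "(\<Sum>A\<in>Pow U. (- 1) ^ card A * int (card {c \<in> D. f c \<inter> A = {}}) ^ r)
    = int (card {cs. set cs \<subseteq> D \<and> length cs = r \<and> U \<subseteq> (\<Union>c\<in>set cs. f c)})"
proof -
  let ?L = "{cs. set cs \<subseteq> D \<and> length cs = r}" and ?u = "\<lambda>cs. (\<Union>c\<in>set cs. f c)"
  have fin: "finite ?L" using assms(1) by (rule finite_lists_length_eq)
  have count: "int (card {c \<in> D. f c \<inter> A = {}}) ^ r = (\<Sum>cs\<in>?L. if A \<subseteq> U - ?u cs then 1 else 0)"
    if "A \<subseteq> U" for A
  proof -
    have "int (card {c \<in> D. f c \<inter> A = {}}) ^ r = int (card {cs. set cs \<subseteq> {c \<in> D. f c \<inter> A = {}} \<and> length cs = r})"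
      using assms(1) by (subst card_lists_length_eq) auto
    also have "{cs. set cs \<subseteq> {c \<in> D. f c \<inter> A = {}} \<and> length cs = r} = {cs \<in> ?L. A \<subseteq> U - ?u cs}"
      using that by auto
    also have "int (card \<dots>) = (\<Sum>cs\<in>{cs \<in> ?L. A \<subseteq> U - ?u cs}. 1)" by simp
    also have "\<dots> = (\<Sum>cs\<in>?L. if A \<subseteq> U - ?u cs then 1 else 0)"
      using fin by (rule sum.inter_filter)
    finally show ?thesis .
  qed
  have "(\<Sum>A\<in>Pow U. (- 1) ^ card A * int (card {c \<in> D. f c \<inter> A = {}}) ^ r)
    = (\<Sum>A\<in>Pow U. \<Sum>cs\<in>?L. if A \<subseteq> U - ?u cs then (- 1) ^ card A else 0)"
  proof (intro sum.cong refl)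
    fix A assume "A \<in> Pow U"
    then have "int (card {c \<in> D. f c \<inter> A = {}}) ^ r = (\<Sum>cs\<in>?L. if A \<subseteq> U - ?u cs then 1 else 0)"
      by (intro count) simp
    then show "(- 1) ^ card A * int (card {c \<in> D. f c \<inter> A = {}}) ^ r
      = (\<Sum>cs\<in>?L. if A \<subseteq> U - ?u cs then (- 1) ^ card A else 0)"
      by (simp only: sum_distrib_left if_distrib[of "(*) _"] mult_1_right mult_zero_right)
  qed
  also have "\<dots> = (\<Sum>cs\<in>?L. \<Sum>A\<in>Pow U. if A \<subseteq> U - ?u cs then (- 1) ^ card A else 0)"
    by (rule sum.swap)
  also have "\<dots> = (\<Sum>cs\<in>?L. if U \<subseteq> ?u cs then 1 else 0)"
  proof (intro sum.cong refl)
    fix cs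
    have "(\<Sum>A\<in>Pow U. if A \<subseteq> U - ?u cs then (- 1) ^ card A else 0)
      = (\<Sum>A\<in>{A \<in> Pow U. A \<subseteq> U - ?u cs}. (- 1 :: int) ^ card A)"
      using assms(2) by (intro sum.inter_filter[symmetric]) simp
    also have "{A \<in> Pow U. A \<subseteq> U - ?u cs} = Pow (U - ?u cs)" by auto
    also have "(\<Sum>A\<in>Pow (U - ?u cs). (- 1 :: int) ^ card A) = (if U - ?u cs = {} then 1 else 0)"
      using assms(2) by (intro sum_alternating_Pow) simp
    also have "\<dots> = (if U \<subseteq> ?u cs then 1 else 0)"
      by (simp only: Diff_eq_empty_iff)
    finally show "(\<Sum>A\<in>Pow U. if A \<subseteq> U - ?u cs then (- 1 :: int) ^ card A else 0)
      = (if U \<subseteq> ?u cs then 1 else 0)" .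
  qed
  also have "\<dots> = (\<Sum>cs\<in>{cs \<in> ?L. U \<subseteq> ?u cs}. 1)"
    using fin by (rule sum.inter_filter[symmetric])
  finally show ?thesis by (simp add: conj_assoc)
qed

definition rays_avoiding :: "int set \<Rightarrow> int set \<Rightarrow> (int \<times> int) set" where
  "rays_avoiding X A = {(x, y) \<in> X \<times> X. ray X (y - x) x \<inter> A = {}}"

text \<open>Makes the progressions countable: each one extends to a ray given by a pair, and each
  ray is itself a progression in \<open>X\<close>.\<close>

lemma covers_iff_rays:
  assumes "finite X"
  shows "covers X r U \<longleftrightarrow>
    (\<exists>cs. set cs \<subseteq> X \<times> X \<and> length cs = r \<and> U \<subseteq> (\<Union>(x, y)\<in>set cs. ray X (y - x) x))"
proof
  assume "covers X r U"
  then obtain ss where ss: "length ss = r" "\<And>s. s \<in> set ss \<Longrightarrow> is_AP s \<and> set s \<subseteq> X"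
    "U \<subseteq> (\<Union>s\<in>set ss. set s)" unfolding covers_def by blast
  have "\<forall>s\<in>set ss. \<exists>p. p \<in> X \<times> X \<and> set s \<subseteq> (case p of (x, y) \<Rightarrow> ray X (y - x) x)"
  proof
    fix s assume "s \<in> set ss"
    then obtain x y where "x \<in> X" "y \<in> X" "set s \<subseteq> ray X (y - x) x"
      using AP_subset_ray[OF assms] ss(2) by blast
    then show "\<exists>p. p \<in> X \<times> X \<and> set s \<subseteq> (case p of (x, y) \<Rightarrow> ray X (y - x) x)"
      by (intro exI[of _ "(x, y)"]) simp
  qed
  from bchoice[OF this] obtain g where
    g: "\<forall>s\<in>set ss. g s \<in> X \<times> X \<and> set s \<subseteq> (case g s of (x, y) \<Rightarrow> ray X (y - x) x)" by blast
  have "U \<subseteq> (\<Union>(x, y)\<in>set (map g ss). ray X (y - x) x)"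
  proof
    fix p assume "p \<in> U"
    then obtain s where s: "s \<in> set ss" "p \<in> set s" using ss(3) by blast
    with bspec[OF g s(1)] show "p \<in> (\<Union>(x, y)\<in>set (map g ss). ray X (y - x) x)"
      by (intro UN_I[of "g s"]) auto
  qed
  with g ss(1) show "\<exists>cs. set cs \<subseteq> X \<times> X \<and> length cs = r \<and> U \<subseteq> (\<Union>(x, y)\<in>set cs. ray X (y - x) x)"
    by (intro exI[of _ "map g ss"]) auto
next
  assume "\<exists>cs. set cs \<subseteq> X \<times> X \<and> length cs = r \<and> U \<subseteq> (\<Union>(x, y)\<in>set cs. ray X (y - x) x)"
  then obtain cs where cs: "set cs \<subseteq> X \<times> X" "length cs = r" "U \<subseteq> (\<Union>(x, y)\<in>set cs. ray X (y - x) x)" by blast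
  have "\<forall>p\<in>set cs. \<exists>s. is_AP s \<and> set s \<subseteq> X \<and> set s = (case p of (x, y) \<Rightarrow> ray X (y - x) x)"
  proof
    fix p assume "p \<in> set cs"
    then obtain x y where p: "p = (x, y)" "x \<in> X" using cs(1) by auto
    obtain s where "is_AP s" "set s = ray X (y - x) x" "set s \<subseteq> X"
      using ray_is_AP[OF assms p(2)] .
    then show "\<exists>s. is_AP s \<and> set s \<subseteq> X \<and> set s = (case p of (x, y) \<Rightarrow> ray X (y - x) x)"
      by (auto simp: p)
  qed
  from bchoice[OF this] obtain g where
    g: "\<forall>p\<in>set cs. is_AP (g p) \<and> set (g p) \<subseteq> X \<and> set (g p) = (case p of (x, y) \<Rightarrow> ray X (y - x) x)" by blast
  then have "(\<Union>s\<in>set (map g cs). set s) = (\<Union>(x, y)\<in>set cs. ray X (y - x) x)" by auto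
  with g cs show "covers X r U" unfolding covers_def by (intro exI[of _ "map g cs"]) auto
qed

text \<open>The sum is the number of tuples of pairs whose rays cover \<open>U\<close>. Several
  pairs may describe the same ray, which leaves the comparison with 0 unaffected.\<close>

lemma covers_iff_sum:
  assumes "finite X" "finite U"
  shows "covers X r U \<longleftrightarrow> (\<Sum>A\<in>Pow U. (- 1) ^ card A * int (card (rays_avoiding X A)) ^ r) \<noteq> 0"
proof -
  let ?f = "\<lambda>(x, y). ray X (y - x) x"
  let ?S = "{cs. set cs \<subseteq> X \<times> X \<and> length cs = r \<and> U \<subseteq> (\<Union>c\<in>set cs. ?f c)}"
  have "rays_avoiding X A = {c \<in> X \<times> X. ?f c \<inter> A = {}}" for A
    by (auto simp: rays_avoiding_def)
  then have "(\<Sum>A\<in>Pow U. (- 1) ^ card A * int (card (rays_avoiding X A)) ^ r) = int (card ?S)"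
    using inclusion_exclusion_tuples[of "X \<times> X" U ?f r] assms by simp
  moreover have "finite ?S"
    by (rule finite_subset[OF _ finite_lists_length_eq[of "X \<times> X" r]]) (use assms in auto)
  ultimately show ?thesis
    by (simp add: covers_iff_rays[OF assms(1)] del: split_paired_Ex) blast
qed

text \<open>The binary digits of \<open>w\<close>, most significant first, name the elements to
  leave out. Comparison with a power of two and subtraction suffice to read them.\<close>

primrec decode :: "int list \<Rightarrow> int \<Rightarrow> int set" where
  "decode [] w = {}"
| "decode (u # us) w = (if 2 ^ length us \<le> w then decode us (w - 2 ^ length us) else insert u (decode us w))"

lemma decode_subset: "decode us w \<subseteq> set us"
  by (induction us arbitrary: w) (auto split: if_splits)

text \<open>The lower half of the range gives the sets that contain the first element, the upper
  half those that do not.\<close>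

lemma sum_decode:
  fixes g :: "int set \<Rightarrow> int"
  assumes "distinct us"
  shows "(\<Sum>w<2 ^ length us. g (decode us (int w))) = (\<Sum>A\<in>Pow (set us). g A)"
  using assms
proof (induction us arbitrary: g)
  case Nil
  then show ?case by (simp add: lessThan_Suc)
next
  case (Cons u us)
  let ?N = "2 ^ length us :: nat"
  have split: "(\<Sum>w<N + N. h w) = (\<Sum>w<N. h w) + (\<Sum>w\<in>{N..<N + N}. h w)" for N and h :: "nat \<Rightarrow> int"
    by (simp only: lessThan_atLeast0 sum.atLeastLessThan_concat[of 0 N "N + N"] le_add1 le0)
  have "2 ^ length (u # us) = ?N + ?N" by simp
  then have "(\<Sum>w<2 ^ length (u # us). g (decode (u # us) (int w)))
    = (\<Sum>w<?N. g (decode (u # us) (int w))) + (\<Sum>w\<in>{?N..<?N + ?N}. g (decode (u # us) (int w)))"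
    by (simp only: split)
  also have "(\<Sum>w<?N. g (decode (u # us) (int w))) = (\<Sum>w<?N. g (insert u (decode us (int w))))"
  proof (intro sum.cong refl)
    fix w assume "w \<in> {..<?N}"
    then have "int w < int ?N" by (simp only: lessThan_iff of_nat_less_iff)
    then have "\<not> 2 ^ length us \<le> int w" by simp
    then show "g (decode (u # us) (int w)) = g (insert u (decode us (int w)))" by simp
  qed
  also have "\<dots> = (\<Sum>A\<in>Pow (set us). g (insert u A))" using Cons by simp
  also have "\<dots> = (\<Sum>A\<in>insert u ` Pow (set us). g A)"
    by (rule sum.reindex_cong[OF _ refl refl, symmetric])
      (rule inj_on_inverseI[of _ "\<lambda>A. A - {u}"], use Cons.prems in auto)
  also have "(\<Sum>w\<in>{?N..<?N + ?N}. g (decode (u # us) (int w))) = (\<Sum>w<?N. g (decode us (int w)))"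
  proof (rule sum.reindex_bij_witness[of _ "\<lambda>w. w + ?N" "\<lambda>w. w - ?N"])
    fix w assume "w \<in> {?N..<?N + ?N}"
    then have "?N \<le> w" by simp
    then have "2 ^ length us \<le> int w" "int (w - ?N) = int w - 2 ^ length us"
      by (simp_all only: of_nat_diff of_nat_power of_nat_numeral flip: of_nat_le_iff[where 'a = int])
    then show "g (decode us (int (w - ?N))) = g (decode (u # us) (int w))" by simp
  qed auto
  also have "\<dots> = (\<Sum>A\<in>Pow (set us). g A)" using Cons by simp
  also have "(\<Sum>A\<in>insert u ` Pow (set us). g A) + (\<Sum>A\<in>Pow (set us). g A) = (\<Sum>A\<in>Pow (set (u # us)). g A)"
  proof -
    have "(\<Sum>A\<in>Pow (set us) \<union> insert u ` Pow (set us). g A)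
      = (\<Sum>A\<in>Pow (set us). g A) + (\<Sum>A\<in>insert u ` Pow (set us). g A)"
      using Cons.prems by (intro sum.union_disjoint) auto
    then show ?thesis by (simp add: Pow_insert)
  qed
  finally show ?case .
qed

section \<open>Cost-bounded program verification\<close>

notation Seq (infixr ";;" 60)

text \<open>Collects the registers that are written, which is what framing needs.\<close>

primrec regs :: "com \<Rightarrow> nat set" where
  "regs Skip = {}"
| "regs (Assign r e) = {r}"
| "regs (Write a i e) = {}"
| "regs (Seq c1 c2) = regs c1 \<union> regs c2"
| "regs (Cond b c1 c2) = regs c1 \<union> regs c2"
| "regs (While b c) = regs c"

primrec arrs :: "com \<Rightarrow> nat set" where
  "arrs Skip = {}"
| "arrs (Assign r e) = {}"
| "arrs (Write a i e) = {a}"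
| "arrs (Seq c1 c2) = arrs c1 \<union> arrs c2"
| "arrs (Cond b c1 c2) = arrs c1 \<union> arrs c2"
| "arrs (While b c) = arrs c"

definition frame :: "com \<Rightarrow> state \<Rightarrow> state \<Rightarrow> bool" where
  "frame c s s' \<longleftrightarrow> (\<forall>r. r \<notin> regs c \<longrightarrow> fst s' r = fst s r) \<and> (\<forall>a. a \<notin> arrs c \<longrightarrow> snd s' a = snd s a)"

lemma frame_reg: "frame c s s' \<Longrightarrow> r \<notin> regs c \<Longrightarrow> fst s' r = fst s r"
  and frame_arr: "frame c s s' \<Longrightarrow> a \<notin> arrs c \<Longrightarrow> snd s' a = snd s a"
  by (simp_all add: frame_def)

lemma exec_frame: "exec c s t s' \<Longrightarrow> frame c s s'"
  by (induction rule: exec.induct) (auto simp: frame_def)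

text \<open>Total correctness with an upper bound on the time; exact times would have to follow
  every branch.\<close>

definition runs :: "com \<Rightarrow> nat \<Rightarrow> state \<Rightarrow> (state \<Rightarrow> bool) \<Rightarrow> bool" where
  "runs c T s Q \<longleftrightarrow> (\<exists>t s'. exec c s t s' \<and> t \<le> T \<and> Q s')"

text \<open>The frame fact comes for free in the new postcondition, so specifications need to
  mention only what a program computes.\<close>

lemma runs_mono: "runs c T s P \<Longrightarrow> T \<le> T' \<Longrightarrow> (\<And>s'. frame c s s' \<Longrightarrow> P s' \<Longrightarrow> Q s') \<Longrightarrow> runs c T' s Q"
  unfolding runs_def using exec_frame le_trans by blast

lemma runs_Seq:
  assumes "runs c1 T1 s P" "\<And>s'. frame c1 s s' \<Longrightarrow> P s' \<Longrightarrow> runs c2 T2 s' Q"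
  shows "runs (c1 ;; c2) (T1 + T2) s Q"
proof -
  obtain t1 s1 where 1: "exec c1 s t1 s1" "t1 \<le> T1" "P s1" using assms(1) unfolding runs_def by blast
  obtain t2 s2 where 2: "exec c2 s1 t2 s2" "t2 \<le> T2" "Q s2"
    using assms(2)[OF exec_frame[OF 1(1)] 1(3)] unfolding runs_def by blast
  show ?thesis unfolding runs_def using exec.Seq[OF 1(1) 2(1)] 1(2) 2(2,3) add_mono by blast
qed

lemma runs_Cond:
  assumes "bval b s \<Longrightarrow> runs c1 T s Q" "\<not> bval b s \<Longrightarrow> runs c2 T s Q"
  shows "runs (Cond b c1 c2) (1 + bcost b + T) s Q"
proof (cases "bval b s")
  case True
  then obtain t s' where "exec c1 s t s'" "t \<le> T" "Q s'" using assms(1) unfolding runs_def by blast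
  with CondTrue[OF True] show ?thesis unfolding runs_def by (meson add_le_mono le_refl)
next
  case False
  then obtain t s' where "exec c2 s t s'" "t \<le> T" "Q s'" using assms(2) unfolding runs_def by blast
  with CondFalse[OF False] show ?thesis unfolding runs_def by (meson add_le_mono le_refl)
qed

section \<open>Loop-free programs and counting loops\<close>

primrec straight :: "com \<Rightarrow> bool" where
  "straight Skip = True"
| "straight (Assign r e) = True"
| "straight (Write a i e) = True"
| "straight (Seq c1 c2) = (straight c1 \<and> straight c2)"
| "straight (Cond b c1 c2) = (straight c1 \<and> straight c2)"
| "straight (While b c) = False"

text \<open>Lets the simplifier execute loop-free code symbolically. The value at
  \<open>While\<close> is a dummy, excluded by \<open>straight\<close>.\<close>

primrec effect :: "com \<Rightarrow> state \<Rightarrow> state" where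
  "effect Skip s = s"
| "effect (Assign r e) s = ((fst s)(r := aval e s), snd s)"
| "effect (Write a i e) s = (fst s, (snd s)(a := (snd s a)(aval i s := aval e s)))"
| "effect (Seq c1 c2) s = effect c2 (effect c1 s)"
| "effect (Cond b c1 c2) s = (if bval b s then effect c1 s else effect c2 s)"
| "effect (While b c) s = s"

primrec max_cost :: "com \<Rightarrow> nat" where
  "max_cost Skip = 1"
| "max_cost (Assign r e) = 1 + acost e"
| "max_cost (Write a i e) = 1 + acost i + acost e"
| "max_cost (Seq c1 c2) = max_cost c1 + max_cost c2"
| "max_cost (Cond b c1 c2) = 1 + bcost b + max (max_cost c1) (max_cost c2)"
| "max_cost (While b c) = 0"

lemma runs_straight:
  assumes "straight c" "Q (effect c s)"
  shows "runs c (max_cost c) s Q"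
proof -
  have "\<exists>t. exec c s t (effect c s) \<and> t \<le> max_cost c" using assms(1)
  proof (induction c arbitrary: s)
    case (Seq c1 c2)
    then obtain t1 t2 where t: "exec c1 s t1 (effect c1 s)" "t1 \<le> max_cost c1"
      "exec c2 (effect c1 s) t2 (effect c2 (effect c1 s))" "t2 \<le> max_cost c2" by fastforce
    with exec.Seq[OF t(1,3)] show ?case by (auto intro!: exI[of _ "t1 + t2"])
  next
    case (Cond b c1 c2)
    then have "straight c1" "straight c2" by simp_all
    with Cond.IH obtain t1 t2 where t: "exec c1 s t1 (effect c1 s)" "t1 \<le> max_cost c1"
      "exec c2 s t2 (effect c2 s)" "t2 \<le> max_cost c2" by metis
    show ?case
    proof (cases "bval b s")
      case True
      with CondTrue[OF True t(1), of c2] t(2) show ?thesis by (auto intro!: exI[of _ "1 + bcost b + t1"])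
    next
      case False
      with CondFalse[OF False t(3), of c1] t(4) show ?thesis by (auto intro!: exI[of _ "1 + bcost b + t2"])
    qed
  next
    case Skip
    show ?case using exec.Skip[of s] by auto
  next
    case (Assign r e)
    show ?case using exec.Assign[of r e s] by auto
  next
    case (Write a i e)
    show ?case using exec.Write[of a i e s] by auto
  qed simp
  with assms(2) show ?thesis unfolding runs_def by blast
qed

definition For :: "nat \<Rightarrow> aexp \<Rightarrow> com \<Rightarrow> com" where
  "For r e c = Assign r (Const 0) ;; While (Less (Reg r) e) (c ;; Assign r (Plus (Reg r) (Const 1)))"

lemma regs_For [simp]: "regs (For r e c) = insert r (regs c)"
  and arrs_For [simp]: "arrs (For r e c) = arrs c"
  by (auto simp: For_def)

abbreviation set_reg :: "nat \<Rightarrow> int \<Rightarrow> state \<Rightarrow> state" where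
  "set_reg r v s \<equiv> ((fst s)(r := v), snd s)"

text \<open>The bound \<open>e\<close> is evaluated before every round, so it must keep the value
  \<open>M\<close> under everything the loop can change. The next invariant refers to the state
  after the counter has been raised, hence \<open>set_reg r (1 + int i)\<close>. A round pays
  \<open>acost e + 3\<close> for the test and 4 for the increment; the first assignment costs 2 and
  the last test \<open>acost e + 3\<close>.\<close>

lemma runs_For:
  assumes r: "r \<notin> regs c"
    and init: "I 0 (set_reg r 0 s)"
    and bound: "\<And>s'. frame (For r e c) s s' \<Longrightarrow> aval e s' = M"
    and step: "\<And>i s'. i < nat M \<Longrightarrow> frame (For r e c) s s' \<Longrightarrow> fst s' r = int i \<Longrightarrow> I i s'
      \<Longrightarrow> runs c T s' (\<lambda>s''. I (Suc i) (set_reg r (1 + int i) s''))"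
    and post: "\<And>s'. frame (For r e c) s s' \<Longrightarrow> I (nat M) s' \<Longrightarrow> Q s'"
  shows "runs (For r e c) (nat M * (T + acost e + 7) + acost e + 5) s Q"
proof -
  let ?b = "Less (Reg r) e" and ?c = "c ;; Assign r (Plus (Reg r) (Const 1))"
  have loop: "runs (While ?b ?c) (d * (T + acost e + 7) + acost e + 3) s' Q"
    if "frame (For r e c) s s'" "fst s' r = int i" "I i s'" "i \<le> nat M" "d = nat M - i" for d i s'
    using that
  proof (induction d arbitrary: i s')
    case 0
    then have "\<not> bval ?b s'" using bound[of s'] by simp
    from exec.WhileFalse[OF this] show ?case
      unfolding runs_def using 0 post by (fastforce intro!: exI)
  next
    case (Suc d)
    then have b: "bval ?b s'" "i < nat M" using bound[of s'] by simp_all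
    obtain t s1 where 1: "exec c s' t s1" "t \<le> T" "I (Suc i) (set_reg r (1 + int i) s1)"
      using step[OF b(2)] Suc.prems unfolding runs_def by blast
    note f = exec_frame[OF 1(1)]
    have "aval (Plus (Reg r) (Const 1)) s1 = 1 + int i"
      using frame_reg[OF f r] Suc.prems(2) by simp
    then have c: "exec ?c s' (t + 4) (set_reg r (1 + int i) s1)"
      using exec.Seq[OF 1(1) exec.Assign[of r "Plus (Reg r) (Const 1)" s1]]
      by (simp add: eval_nat_numeral add.commute)
    have "frame (For r e c) s (set_reg r (1 + int i) s1)"
      using f Suc.prems(1) by (simp add: frame_def)
    moreover have "fst (set_reg r (1 + int i) s1) r = int (Suc i)" "Suc i \<le> nat M" "d = nat M - Suc i"
      using b(2) Suc.prems(5) by simp_all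
    ultimately have "runs (While ?b ?c) (d * (T + acost e + 7) + acost e + 3) (set_reg r (1 + int i) s1) Q"
      using Suc.IH 1(3) by blast
    then obtain t' s2 where 2: "exec (While ?b ?c) (set_reg r (1 + int i) s1) t' s2"
      "t' \<le> d * (T + acost e + 7) + acost e + 3" "Q s2" unfolding runs_def by blast
    show ?case unfolding runs_def
      using exec.WhileTrue[OF b(1) c 2(1)] 1(2) 2(2,3) by (fastforce intro!: exI simp: algebra_simps)
  qed
  have a: "exec (Assign r (Const 0)) s 2 (set_reg r 0 s)"
    using exec.Assign[of r "Const 0" s] by (simp add: numeral_2_eq_2)
  have "frame (For r e c) s (set_reg r 0 s)" by (simp add: frame_def)
  from loop[OF this _ init _ refl] obtain t s' where
    w: "exec (While ?b ?c) (set_reg r 0 s) t s'" "t \<le> nat M * (T + acost e + 7) + acost e + 3" "Q s'"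
    unfolding runs_def by auto
  show ?thesis unfolding runs_def
    using exec.Seq[OF a w(1)] w(2,3) by (fastforce intro!: exI simp: For_def)
qed

section \<open>Running times up to monomials\<close>

locale cost_bounds =
  fixes A B :: nat
  assumes A_pos: "1 \<le> A" and B_pos: "1 \<le> B"
begin

text \<open>A time is a number times a monomial in \<open>A\<close> and \<open>B\<close>. Sequencing
  adds the numbers and takes the larger exponents, a loop adds exponents, so the side conditions are
  inequalities between numerals.\<close>

definition runs_in :: "nat \<Rightarrow> nat \<Rightarrow> nat \<Rightarrow> com \<Rightarrow> state \<Rightarrow> (state \<Rightarrow> bool) \<Rightarrow> bool" where
  "runs_in C i j c s Q \<longleftrightarrow> runs c (C * (A ^ i * B ^ j)) s Q"

lemma monomial_mono: "i \<le> i' \<Longrightarrow> j \<le> j' \<Longrightarrow> A ^ i * B ^ j \<le> A ^ i' * B ^ j'"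
  using A_pos B_pos by (intro mult_mono power_increasing) auto

lemma monomial_pos: "1 \<le> A ^ i * B ^ j"
  using A_pos B_pos by simp

lemma runs_in_mono:
  assumes "runs_in C i j c s P" "C \<le> C'" "i \<le> i'" "j \<le> j'" "\<And>s'. frame c s s' \<Longrightarrow> P s' \<Longrightarrow> Q s'"
  shows "runs_in C' i' j' c s Q"
  using assms(1) unfolding runs_in_def
  by (rule runs_mono[OF _ mult_le_mono[OF assms(2) monomial_mono[OF assms(3,4)]] assms(5)])

lemma runs_in_Seq:
  assumes "runs_in C1 i1 j1 c1 s P" "\<And>s'. frame c1 s s' \<Longrightarrow> P s' \<Longrightarrow> runs_in C2 i2 j2 c2 s' Q"
    "C1 + C2 \<le> C" "i1 \<le> i" "i2 \<le> i" "j1 \<le> j" "j2 \<le> j"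
  shows "runs_in C i j (c1 ;; c2) s Q"
  unfolding runs_in_def
proof (rule runs_mono)
  show "runs (c1 ;; c2) (C1 * (A ^ i1 * B ^ j1) + C2 * (A ^ i2 * B ^ j2)) s Q"
    using runs_Seq assms(1,2) unfolding runs_in_def .
  have "C1 * (A ^ i1 * B ^ j1) + C2 * (A ^ i2 * B ^ j2) \<le> C1 * (A ^ i * B ^ j) + C2 * (A ^ i * B ^ j)"
    by (intro add_mono mult_le_mono2 monomial_mono assms)
  also have "\<dots> \<le> C * (A ^ i * B ^ j)"
    unfolding distrib_right[symmetric] using assms(3) by (rule mult_right_mono) simp
  finally show "C1 * (A ^ i1 * B ^ j1) + C2 * (A ^ i2 * B ^ j2) \<le> C * (A ^ i * B ^ j)" .
qed

lemma runs_in_straight: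
  assumes "straight c" "max_cost c \<le> C" "Q (effect c s)"
  shows "runs_in C i j c s Q"
  unfolding runs_in_def
proof (rule runs_mono[OF runs_straight[where Q = Q, OF assms(1,3)]])
  show "max_cost c \<le> C * (A ^ i * B ^ j)"
    using mult_le_mono[OF assms(2) monomial_pos] by simp
qed

lemma runs_in_Cond:
  assumes "bval b s \<Longrightarrow> runs_in C i j c1 s Q" "\<not> bval b s \<Longrightarrow> runs_in C i j c2 s Q"
    "Suc (bcost b) + C \<le> C'"
  shows "runs_in C' i j (Cond b c1 c2) s Q"
  unfolding runs_in_def
proof (rule runs_mono)
  show "runs (Cond b c1 c2) (1 + bcost b + C * (A ^ i * B ^ j)) s Q"
    by (intro runs_Cond) (use assms(1,2) in \<open>auto simp: runs_in_def\<close>)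
  have "1 + bcost b + C * (A ^ i * B ^ j) \<le> Suc (bcost b) * (A ^ i * B ^ j) + C * (A ^ i * B ^ j)"
    using mult_le_mono2[OF monomial_pos[of i j], of "Suc (bcost b)"] by simp
  also have "\<dots> \<le> C' * (A ^ i * B ^ j)"
    unfolding distrib_right[symmetric] using assms(3) by (rule mult_right_mono) simp
  finally show "1 + bcost b + C * (A ^ i * B ^ j) \<le> C' * (A ^ i * B ^ j)" .
qed

text \<open>The 18 absorbs the overhead of the loop: with \<open>acost e \<le> 3\<close> a round
  costs at most 10 beyond the body, and first assignment and last test together at most 8.\<close>

lemma runs_in_For:
  assumes r: "r \<notin> regs c"
    and bound: "\<And>s'. frame (For r e c) s s' \<Longrightarrow> aval e s' = M"
    and M: "nat M \<le> A ^ a * B ^ b"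
    and init: "I 0 (set_reg r 0 s)"
    and step: "\<And>i s'. i < nat M \<Longrightarrow> frame (For r e c) s s' \<Longrightarrow> fst s' r = int i \<Longrightarrow> I i s'
      \<Longrightarrow> runs_in C p t c s' (\<lambda>s''. I (Suc i) (set_reg r (1 + int i) s''))"
    and post: "\<And>s'. frame (For r e c) s s' \<Longrightarrow> I (nat M) s' \<Longrightarrow> Q s'"
    and C': "C + 18 \<le> C'" "acost e \<le> 3" "a + p \<le> p'" "b + t \<le> t'"
  shows "runs_in C' p' t' (For r e c) s Q"
  unfolding runs_in_def
proof (rule runs_mono)
  let ?X = "A ^ p * B ^ t" and ?Y = "A ^ a * B ^ b"
  show "runs (For r e c) (nat M * (C * ?X + acost e + 7) + acost e + 5) s Q"
    by (rule runs_For[where I = I]) (use assms in \<open>auto simp: runs_in_def\<close>)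
  have "nat M * (C * ?X + acost e + 7) \<le> ?Y * (C * ?X + 10 * ?X)"
    using C'(2) monomial_pos[of p t] by (intro mult_le_mono M) linarith
  moreover have "acost e + 5 \<le> 8 * (?Y * ?X)"
    using C'(2) mult_le_mono[OF monomial_pos[of a b] monomial_pos[of p t]] by linarith
  ultimately have "nat M * (C * ?X + acost e + 7) + acost e + 5 \<le> (C + 18) * (?Y * ?X)"
    by (simp add: algebra_simps)
  also have "?Y * ?X = A ^ (a + p) * B ^ (b + t)" by (simp add: power_add)
  also have "(C + 18) * \<dots> \<le> C' * (A ^ p' * B ^ t')"
    by (intro mult_le_mono monomial_mono C')
  finally show "nat M * (C * ?X + acost e + 7) + acost e + 5 \<le> C' * (A ^ p' * B ^ t')" .
qed

end

text \<open>Arrays are indexed by all integers, so a set is stored as its characteristic function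
  with the elements themselves as indices, and membership takes one read.\<close>

definition ind :: "int set \<Rightarrow> int \<Rightarrow> int" where
  "ind S v = (if v \<in> S then 1 else 0)"

lemma ind_eq_1 [simp]: "ind S v = 1 \<longleftrightarrow> v \<in> S"
  and ind_eq_0 [simp]: "ind S v = 0 \<longleftrightarrow> v \<notin> S"
  by (simp_all add: ind_def)

lemma ind_upd [simp]:
  "(ind S)(x := 1) = ind (insert x S)"
  "(ind S)(x := 0) = ind (S - {x})"
  by (auto simp: ind_def fun_eq_iff)

section \<open>The program\<close>

text \<open>Register and array 1 are written \<open>Suc 0\<close> because the simplifier normalises the numeral.\<close>

abbreviation (input) "vn \<equiv> 0 :: nat"
abbreviation (input) "vk \<equiv> Suc 0"
abbreviation (input) "vq \<equiv> 2 :: nat"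
abbreviation (input) "vm \<equiv> 3 :: nat"
abbreviation (input) "vQ \<equiv> 4 :: nat"
abbreviation (input) "vans \<equiv> 5 :: nat"
abbreviation (input) "vguess \<equiv> 6 :: nat"
abbreviation (input) "vj \<equiv> 7 :: nat"
abbreviation (input) "vrem \<equiv> 8 :: nat"
abbreviation (input) "vidx \<equiv> 9 :: nat"
abbreviation (input) "vl \<equiv> 10 :: nat"
abbreviation (input) "vi \<equiv> 11 :: nat"
abbreviation (input) "vh \<equiv> 12 :: nat"
abbreviation (input) "vc \<equiv> 13 :: nat"
abbreviation (input) "vsel \<equiv> 14 :: nat"
abbreviation (input) "vd \<equiv> 15 :: nat"
abbreviation (input) "vp \<equiv> 16 :: nat"
abbreviation (input) "vf \<equiv> 17 :: nat"
abbreviation (input) "vt \<equiv> 18 :: nat"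
abbreviation (input) "vx \<equiv> 19 :: nat"
abbreviation (input) "vy \<equiv> 20 :: nat"
abbreviation (input) "vu \<equiv> 21 :: nat"
abbreviation (input) "vsum \<equiv> 22 :: nat"
abbreviation (input) "vw \<equiv> 23 :: nat"
abbreviation (input) "vsgn \<equiv> 24 :: nat"
abbreviation (input) "vpw \<equiv> 25 :: nat"
abbreviation (input) "vz \<equiv> 26 :: nat"

text \<open>\<open>arr_in\<close>, \<open>arr_cov\<close>, \<open>arr_low\<close> and
  \<open>arr_ban\<close> hold the characteristic functions of \<open>X\<close>, of the covered
  points, of the first uncovered points and of the current subset in inclusion-exclusion.
  \<open>arr_pow\<close> tabulates powers of two, the source of place values and of exponential loop
  bounds.\<close>

abbreviation (input) "arr_X \<equiv> 0 :: nat"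
abbreviation (input) "arr_in \<equiv> Suc 0"
abbreviation (input) "arr_cov \<equiv> 2 :: nat"
abbreviation (input) "arr_low \<equiv> 3 :: nat"
abbreviation (input) "arr_ban \<equiv> 4 :: nat"
abbreviation (input) "arr_pow \<equiv> 5 :: nat"

abbreviation (input) "Xi \<equiv> Read arr_X (Reg vi)"
abbreviation (input) "Xh \<equiv> Read arr_X (Reg vh)"

text \<open>Clearing the cells at elements of \<open>X\<close> is enough, since the covered set
  never leaves \<open>X\<close>.\<close>

definition reset_com :: com where
  "reset_com = For vi (Reg vn) (Write arr_cov Xi (Const 0))"

definition low_com :: com where
  "low_com = For vi (Reg vn) (
     (Assign vc (Const 0) ;;
      For vh (Reg vn)
        (Cond (Conj (Equal (Read arr_cov Xh) (Const 0)) (Neg (Less Xi Xh)))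
          (Assign vc (Plus (Reg vc) (Const 1))) Skip)) ;;
     Cond (Conj (Equal (Read arr_cov Xi) (Const 0)) (Neg (Less (Reg vQ) (Reg vc))))
       (Write arr_low Xi (Const 1)) (Write arr_low Xi (Const 0)))"

definition eligible_com :: com where
  "eligible_com = (Assign vd (Minus Xh Xi) ;; Assign vp Xi ;; Assign vf (Const 0)) ;;
     For vt (Reg vQ)
       (Assign vp (Plus (Reg vp) (Reg vd)) ;;
        Cond (Equal (Read arr_low (Reg vp)) (Const 1)) (Assign vf (Const 1)) Skip)"

definition visit_com :: com where
  "visit_com = eligible_com ;;
     Cond (Conj (Conj (Equal (Read arr_low Xi) (Const 1)) (Less Xi Xh))
                (Conj (Equal (Reg vf) (Const 1)) (Equal (Reg vsel) (Const 0))))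
       (Cond (Less (Reg vrem) (Read arr_pow (Reg vidx)))
         (Assign vsel (Const 1) ;; Assign vx Xi ;; Assign vy Xh)
         (Assign vrem (Minus (Reg vrem) (Read arr_pow (Reg vidx)))))
       Skip"

definition select_com :: com where
  "select_com = Assign vsel (Const 0) ;; For vi (Reg vn) (For vh (Reg vn) visit_com)"

definition advance_com :: com where
  "advance_com = Cond (Equal (Read arr_in (Plus (Reg vp) (Reg vd))) (Const 1))
     (Assign vp (Plus (Reg vp) (Reg vd))) Skip"

definition mark_com :: com where
  "mark_com = (Assign vp (Reg vx) ;; Assign vd (Minus (Reg vy) (Reg vx))) ;;
     For vt (Reg vn) advance_com ;;
     Assign vd (Minus (Const 0) (Reg vd)) ;;
     For vt (Reg vn) (Write arr_cov (Reg vp) (Const 1) ;; advance_com)"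

text \<open>In base \<open>2 ^ q\<close>, moving to the next digit lowers the exponent in
  \<open>vidx\<close> by \<open>q\<close>.\<close>

definition step_com :: com where
  "step_com = Assign vidx (Minus (Reg vidx) (Reg vq)) ;; low_com ;; select_com ;;
     Cond (Equal (Reg vsel) (Const 1)) (mark_com ;; Assign vj (Plus (Reg vj) (Const 1))) Skip"

definition simulate_com :: com where
  "simulate_com = (Assign vj (Const 0) ;; Assign vrem (Reg vguess) ;; Assign vidx (Reg vm)) ;;
     For vl (Reg vk) step_com"

definition count_uncovered_com :: com where
  "count_uncovered_com = Assign vu (Const 0) ;;
     For vi (Reg vn)
       (Cond (Equal (Read arr_cov Xi) (Const 0)) (Assign vu (Plus (Reg vu) (Const 1))) Skip)"

text \<open>Follows \<open>decode\<close> on the uncovered elements and maintains the sign of the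
  subset along the way.\<close>

definition ban_com :: com where
  "ban_com = (Assign vrem (Reg vw) ;; Assign vidx (Reg vu) ;; Assign vsgn (Const 1)) ;;
     For vi (Reg vn)
       (Write arr_ban Xi (Const 0) ;;
        Cond (Equal (Read arr_cov Xi) (Const 0))
          (Assign vidx (Minus (Reg vidx) (Const 1)) ;;
           Cond (Less (Reg vrem) (Read arr_pow (Reg vidx)))
             (Write arr_ban Xi (Const 1) ;; Assign vsgn (Minus (Const 0) (Reg vsgn)))
             (Assign vrem (Minus (Reg vrem) (Read arr_pow (Reg vidx)))))
          Skip)"

definition test_ray_com :: com where
  "test_ray_com = (Assign vd (Minus Xh Xi) ;; Assign vp Xi ;; Assign vf (Const 0)) ;;
     For vt (Reg vn)
       (Cond (Equal (Read arr_ban (Reg vp)) (Const 1)) (Assign vf (Const 1)) Skip ;; advance_com)"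

definition count_rays_com :: com where
  "count_rays_com = Assign vc (Const 0) ;;
     For vi (Reg vn) (For vh (Reg vn) (test_ray_com ;;
       Cond (Equal (Reg vf) (Const 0)) (Assign vc (Plus (Reg vc) (Const 1))) Skip))"

text \<open>Starting from the sign yields the signed summand; each multiplication is a loop of
  additions.\<close>

definition power_com :: com where
  "power_com = Assign vpw (Reg vsgn) ;;
     For vi (Minus (Reg vk) (Reg vj))
       ((Assign vz (Const 0) ;; For vh (Reg vc) (Assign vz (Plus (Reg vz) (Reg vpw)))) ;;
        Assign vpw (Reg vz))"

definition sum_com :: com where
  "sum_com = Assign vsum (Const 0) ;;
     For vw (Read arr_pow (Reg vu))
       (ban_com ;; count_rays_com ;; power_com ;; Assign vsum (Plus (Reg vsum) (Reg vpw)))"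

text \<open>\<open>vans\<close> is only ever raised, so in the end it tells whether some guess
  succeeded. The comparison with \<open>vm\<close> also ensures that the loop bound of
  \<open>sum_com\<close> is in the table of powers.\<close>

definition guess_com :: com where
  "guess_com = reset_com ;; simulate_com ;; count_uncovered_com ;;
     Cond (Less (Reg vm) (Reg vu)) Skip
       (sum_com ;; Cond (Equal (Reg vsum) (Const 0)) Skip (Assign vans (Const 1)))"

text \<open>The number \<open>13 * k + 1\<close> is reached by additions through
  \<open>2 * k\<close>, \<open>3 * k\<close>, \<open>6 * k\<close> and \<open>12 * k\<close>;
  \<open>m\<close> then takes \<open>k\<close> further additions.\<close>

definition setup_com :: com where
  "setup_com = For vi (Reg vn) (Write arr_in Xi (Const 1)) ;;
     (Assign vq (Plus (Reg vk) (Reg vk)) ;; Assign vq (Plus (Reg vq) (Reg vk)) ;;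
      Assign vq (Plus (Reg vq) (Reg vq)) ;; Assign vq (Plus (Reg vq) (Reg vq)) ;;
      Assign vq (Plus (Plus (Reg vq) (Reg vk)) (Const 1)) ;;
      Assign vm (Const 0) ;; Write arr_pow (Const 0) (Const 1)) ;;
     For vi (Reg vk) (Assign vm (Plus (Reg vm) (Reg vq))) ;;
     For vi (Reg vm) (Write arr_pow (Plus (Reg vi) (Const 1))
       (Plus (Read arr_pow (Reg vi)) (Read arr_pow (Reg vi)))) ;;
     Assign vQ (Read arr_pow (Plus (Plus (Reg vk) (Reg vk)) (Plus (Reg vk) (Reg vk))))"

definition main_com :: com where
  "main_com = setup_com ;; For vguess (Read arr_pow (Reg vm)) guess_com ;; Assign vn (Reg vans)"

text \<open>Computed once, so that later frame arguments reduce to membership in explicit finite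
  sets.\<close>

lemma footprints [simp]:
  "regs reset_com = {vi}" "arrs reset_com = {arr_cov}"
  "regs low_com = {vi, vh, vc}" "arrs low_com = {arr_low}"
  "regs eligible_com = {vd, vp, vf, vt}" "arrs eligible_com = {}"
  "regs visit_com = {vd, vp, vf, vt, vsel, vx, vy, vrem}" "arrs visit_com = {}"
  "regs select_com = {vi, vh, vd, vp, vf, vt, vsel, vx, vy, vrem}" "arrs select_com = {}"
  "regs advance_com = {vp}" "arrs advance_com = {}"
  "regs mark_com = {vd, vp, vt}" "arrs mark_com = {arr_cov}"
  "regs step_com = {vidx, vj, vi, vh, vc, vd, vp, vf, vt, vsel, vx, vy, vrem}"
  "arrs step_com = {arr_low, arr_cov}"
  "regs simulate_com = {vidx, vj, vl, vi, vh, vc, vd, vp, vf, vt, vsel, vx, vy, vrem}"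
  "arrs simulate_com = {arr_low, arr_cov}"
  "regs count_uncovered_com = {vi, vu}" "arrs count_uncovered_com = {}"
  "regs ban_com = {vi, vrem, vidx, vsgn}" "arrs ban_com = {arr_ban}"
  "regs test_ray_com = {vd, vp, vf, vt}" "arrs test_ray_com = {}"
  "regs count_rays_com = {vi, vh, vc, vd, vp, vf, vt}" "arrs count_rays_com = {}"
  "regs power_com = {vi, vh, vz, vpw}" "arrs power_com = {}"
  "regs sum_com = {vw, vsum, vi, vh, vc, vrem, vidx, vsgn, vd, vp, vf, vt, vz, vpw}"
  "arrs sum_com = {arr_ban}"
  "regs guess_com = {vans, vu, vidx, vj, vl, vsel, vx, vy, vw, vsum, vi, vh, vc, vrem, vsgn, vd, vp, vf, vt, vz, vpw}"
  "arrs guess_com = {arr_low, arr_cov, arr_ban}"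
  by (auto simp: reset_com_def low_com_def eligible_com_def visit_com_def select_com_def advance_com_def
    mark_com_def step_com_def simulate_com_def count_uncovered_com_def ban_com_def test_ray_com_def
    count_rays_com_def power_com_def sum_com_def guess_com_def)

section \<open>Correctness and cost of the components on a fixed instance\<close>

locale cap_instance =
  fixes xs :: "int list" and k :: nat
  assumes distinct_xs: "distinct xs"
begin

abbreviation "X \<equiv> set xs"
abbreviation "n \<equiv> length xs"

text \<open>There are at most \<open>Q ^ 3 < 2 ^ q\<close> eligible pairs, so \<open>k\<close> choices fit into \<open>m\<close> bits. The same
  \<open>m\<close> serves as the threshold below which the uncovered points are handled by inclusion-exclusion.\<close>

definition q :: nat where "q = 13 * k + 1"
definition m :: nat where "m = k * q"
text \<open>\<open>Q\<close> has to exceed \<open>m\<close> and to reach \<open>2 ^ k\<close>;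
  \<open>16 ^ k\<close> does both, and its cube \<open>2 ^ (12 * k)\<close> stays below
  \<open>2 ^ q\<close>.\<close>

definition Q :: nat where "Q = 2 ^ (4 * k)"

text \<open>\<open>Suc n\<close> keeps the base positive for empty \<open>X\<close>. As
  \<open>m\<close> is quadratic in \<open>k\<close>, any fixed power of \<open>2 ^ m\<close> is
  affordable.\<close>

sublocale cost_bounds "Suc n" "2 ^ m"
  by unfold_locales simp_all

text \<open>The part of the state that setup establishes and the loop over guesses only
  reads.\<close>

definition env :: "state \<Rightarrow> bool" where
  "env s \<longleftrightarrow> fst s vn = int n \<and> fst s vk = int k \<and> fst s vq = int q \<and> fst s vm = int m \<and> fst s vQ = int Q
    \<and> (\<forall>i<n. snd s arr_X (int i) = xs ! i) \<and> snd s arr_in = ind X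
    \<and> (\<forall>i\<le>m. snd s arr_pow (int i) = 2 ^ i)"

lemma env_frame:
  assumes "frame c s s'" "env s" "regs c \<inter> {vn, vk, vq, vm, vQ} = {}" "arrs c \<inter> {arr_X, arr_in, arr_pow} = {}"
  shows "env s'"
proof -
  have "\<And>r. r \<in> {vn, vk, vq, vm, vQ} \<Longrightarrow> fst s' r = fst s r"
    "\<And>a. a \<in> {arr_X, arr_in, arr_pow} \<Longrightarrow> snd s' a = snd s a"
    using assms(3,4) frame_reg[OF assms(1)] frame_arr[OF assms(1)] by blast+
  then show ?thesis using assms(2) by (simp add: env_def)
qed

lemma envD:
  assumes "env s"
  shows "fst s vn = int n" "fst s vk = int k" "fst s vq = int q" "fst s vm = int m" "fst s vQ = int Q"
    "\<And>i. i < n \<Longrightarrow> snd s arr_X (int i) = xs ! i" "snd s arr_in = ind X"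
    "\<And>i. i \<le> m \<Longrightarrow> snd s arr_pow (int i) = 2 ^ i"
  using assms by (auto simp: env_def)

lemma n_le: "nat (int n) \<le> Suc n ^ 1 * (2 ^ m) ^ 0"
  by simp

lemma set_take_Suc: "i < n \<Longrightarrow> set (take (Suc i) xs) = insert (xs ! i) (set (take i xs))"
  by (simp add: take_Suc_conv_app_nth)

lemma Diff_set_take_Suc: "i < n \<Longrightarrow> C - set (take (Suc i) xs) = C - set (take i xs) - {xs ! i}"
  by (auto simp: set_take_Suc)

lemma reset_run:
  assumes "env s" "snd s arr_cov = ind C" "C \<subseteq> X"
  shows "runs_in 30 1 0 reset_com s (\<lambda>s'. snd s' arr_cov = ind {})"
  unfolding reset_com_def
proof (rule runs_in_For[where I = "\<lambda>i s'. snd s' arr_cov = ind (C - set (take i xs))", OF _ _ n_le])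
  fix i s'
  assume i: "i < nat (int n)" "fst s' vi = int i" "snd s' arr_cov = ind (C - set (take i xs))"
    and f: "frame (For vi (Reg vn) (Write arr_cov Xi (Const 0))) s s'"
  have e: "env s'" by (rule env_frame[OF f assms(1)]) auto
  show "runs_in 10 0 0 (Write arr_cov Xi (Const 0)) s'
    (\<lambda>s''. snd (set_reg vi (1 + int i) s'') arr_cov = ind (C - set (take (Suc i) xs)))"
    using i by (intro runs_in_straight) (auto simp: envD[OF e] Diff_set_take_Suc)
next
  fix s' assume "snd s' arr_cov = ind (C - set (take (nat (int n)) xs))"
  then show "snd s' arr_cov = ind {}" using assms(3) by (simp add: Diff_eq_empty_iff[THEN iffD2])
qed (use assms in \<open>auto simp: frame_reg envD\<close>)

text \<open>The array is overwritten in place, so the invariant mixes new values on the elements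
  passed with old values elsewhere. \<open>L \<subseteq> X\<close> makes the cells off
  \<open>X\<close> zero from the start.\<close>

lemma low_run:
  assumes "env s" "snd s arr_cov = ind C" "snd s arr_low = ind L" "L \<subseteq> X"
  shows "runs_in 200 2 0 low_com s (\<lambda>s'. snd s' arr_low = ind (low X C Q))"
  unfolding low_com_def
proof (rule runs_in_For[where I = "\<lambda>i s'. snd s' arr_low =
    (\<lambda>v. if v \<in> set (take i xs) then ind (low X C Q) v else ind L v)", OF _ _ n_le])
  let ?count = "For vh (Reg vn)
        (Cond (Conj (Equal (Read arr_cov Xh) (Const 0)) (Neg (Less Xi Xh)))
          (Assign vc (Plus (Reg vc) (Const 1))) Skip)"
  fix i s'
  assume i: "i < nat (int n)" "fst s' vi = int i"
    and I: "snd s' arr_low = (\<lambda>v. if v \<in> set (take i xs) then ind (low X C Q) v else ind L v)"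
    and f: "frame (For vi (Reg vn) ((Assign vc (Const 0) ;; ?count) ;;
     Cond (Conj (Equal (Read arr_cov Xi) (Const 0)) (Neg (Less (Reg vQ) (Reg vc))))
       (Write arr_low Xi (Const 1)) (Write arr_low Xi (Const 0)))) s s'"
  have e: "env s'" by (rule env_frame[OF f assms(1)]) auto
  have cov: "snd s' arr_cov = ind C" using frame_arr[OF f] assms(2) by simp
  let ?P = "\<lambda>y. y \<notin> C \<and> y \<le> xs ! i"
  have count: "runs_in 100 1 0 (Assign vc (Const 0) ;; ?count) s'
    (\<lambda>s''. fst s'' vc = int (card {y \<in> X - C. y \<le> xs ! i}))"
  proof (rule runs_in_Seq)
    show "runs_in 2 0 0 (Assign vc (Const 0)) s' (\<lambda>s''. fst s'' vc = 0)"
      by (rule runs_in_straight) auto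
    fix s1 assume f1: "frame (Assign vc (Const 0)) s' s1" and c: "fst s1 vc = 0"
    have e1: "env s1" by (rule env_frame[OF f1 e]) auto
    show "runs_in 80 1 0 ?count s1 (\<lambda>s''. fst s'' vc = int (card {y \<in> X - C. y \<le> xs ! i}))"
    proof (rule runs_in_For[where I = "\<lambda>h s'. fst s' vc = int (length (filter ?P (take h xs)))", OF _ _ n_le])
      fix h s2
      assume h: "h < nat (int n)" "fst s2 vh = int h" "fst s2 vc = int (length (filter ?P (take h xs)))"
        and f2: "frame ?count s1 s2"
      have e2: "env s2" by (rule env_frame[OF f2 e1]) auto
      have "fst s2 vi = int i" "snd s2 arr_cov = ind C"
        using frame_reg[OF f2] frame_reg[OF f1] frame_arr[OF f2] frame_arr[OF f1] i cov by auto
      with h i show "runs_in 40 0 0 (Cond (Conj (Equal (Read arr_cov Xh) (Const 0)) (Neg (Less Xi Xh)))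
          (Assign vc (Plus (Reg vc) (Const 1))) Skip) s2
          (\<lambda>s''. fst (set_reg vh (1 + int h) s'') vc = int (length (filter ?P (take (Suc h) xs))))"
        by (intro runs_in_straight) (auto simp: envD[OF e2] take_Suc_conv_app_nth)
    next
      fix s2 assume "fst s2 vc = int (length (filter ?P (take (nat (int n)) xs)))"
      moreover have "{x. ?P x} \<inter> X = {y \<in> X - C. y \<le> xs ! i}" by auto
      ultimately show "fst s2 vc = int (card {y \<in> X - C. y \<le> xs ! i})"
        using distinct_xs by (simp add: distinct_length_filter)
    qed (use c e1 in \<open>auto simp: frame_reg envD\<close>)
  qed simp_all
  show "runs_in 150 1 0 ((Assign vc (Const 0) ;; ?count) ;;
     Cond (Conj (Equal (Read arr_cov Xi) (Const 0)) (Neg (Less (Reg vQ) (Reg vc))))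
       (Write arr_low Xi (Const 1)) (Write arr_low Xi (Const 0))) s'
    (\<lambda>s''. snd (set_reg vi (1 + int i) s'') arr_low =
      (\<lambda>v. if v \<in> set (take (Suc i) xs) then ind (low X C Q) v else ind L v))"
  proof (rule runs_in_Seq[OF count])
    fix s1
    assume f1: "frame (Assign vc (Const 0) ;; ?count) s' s1"
      and c: "fst s1 vc = int (card {y \<in> X - C. y \<le> xs ! i})"
    have e1: "env s1" by (rule env_frame[OF f1 e]) auto
    have "fst s1 vi = int i" "snd s1 arr_cov = ind C" "snd s1 arr_low = snd s' arr_low"
      using frame_reg[OF f1] frame_arr[OF f1] i cov by auto
    with c i I show "runs_in 40 0 0 (Cond (Conj (Equal (Read arr_cov Xi) (Const 0)) (Neg (Less (Reg vQ) (Reg vc))))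
       (Write arr_low Xi (Const 1)) (Write arr_low Xi (Const 0))) s1
       (\<lambda>s''. snd (set_reg vi (1 + int i) s'') arr_low =
      (\<lambda>v. if v \<in> set (take (Suc i) xs) then ind (low X C Q) v else ind L v))"
      by (intro runs_in_straight) (auto simp: envD[OF e1] take_Suc_conv_app_nth fun_eq_iff low_def ind_def)
  qed simp_all
next
  fix s' assume "snd s' arr_low = (\<lambda>v. if v \<in> set (take (nat (int n)) xs) then ind (low X C Q) v else ind L v)"
  then show "snd s' arr_low = ind (low X C Q)" using assms(4) by (auto simp: fun_eq_iff low_def ind_def)
qed (use assms in \<open>auto simp: frame_reg envD\<close>)


lemma card_X: "card X = n"
  using distinct_xs by (rule distinct_card)

lemma four_k_le: "4 * k \<le> m"
  unfolding m_def q_def by (cases k) auto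

text \<open>Loops of length \<open>Q\<close>, \<open>k\<close> or \<open>m\<close> are all charged a
  full factor \<open>2 ^ m\<close>, which affects only the constant in the exponent.\<close>

lemma Q_le: "nat (int Q) \<le> Suc n ^ 0 * (2 ^ m) ^ 1"
proof -
  have "(2::nat) ^ (4 * k) \<le> 2 ^ m" using four_k_le by (intro power_increasing) auto
  then show ?thesis by (simp add: Q_def)
qed

lemma eligible_run:
  assumes "env s" "snd s arr_low = ind L" "fst s vi = int i" "i < n" "fst s vh = int h" "h < n"
  shows "runs_in 100 0 1 eligible_com s (\<lambda>s'. fst s' vf =
    (if \<exists>j\<in>{1..Q}. xs ! i + int j * (xs ! h - xs ! i) \<in> L then 1 else 0))"
  unfolding eligible_com_def
proof (rule runs_in_Seq)
  let ?init = "Assign vd (Minus Xh Xi) ;; Assign vp Xi ;; Assign vf (Const 0)"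
    and ?loop = "For vt (Reg vQ) (Assign vp (Plus (Reg vp) (Reg vd)) ;;
        Cond (Equal (Read arr_low (Reg vp)) (Const 1)) (Assign vf (Const 1)) Skip)"
  let ?I = "\<lambda>t s'. fst s' vp = xs ! i + int t * (xs ! h - xs ! i)
    \<and> fst s' vf = (if \<exists>j\<in>{1..t}. xs ! i + int j * (xs ! h - xs ! i) \<in> L then 1 else 0)"
  show "runs_in 20 0 0 ?init s (\<lambda>s'. fst s' vd = xs ! h - xs ! i \<and> ?I 0 s')"
    by (rule runs_in_straight) (use assms in \<open>auto simp: envD\<close>)
  fix s1 assume f1: "frame ?init s s1" and s1: "fst s1 vd = xs ! h - xs ! i \<and> ?I 0 s1"
  have e1: "env s1" by (rule env_frame[OF f1 assms(1)]) auto
  show "runs_in 60 0 1 ?loop s1 (\<lambda>s'. fst s' vf =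
    (if \<exists>j\<in>{1..Q}. xs ! i + int j * (xs ! h - xs ! i) \<in> L then 1 else 0))"
  proof (rule runs_in_For[where I = ?I, OF _ _ Q_le])
    fix t s2 assume t: "?I t s2" and f2: "frame ?loop s1 s2"
    have "fst s2 vd = xs ! h - xs ! i" "snd s2 arr_low = ind L"
      using frame_reg[OF f2] frame_arr[OF f2] frame_arr[OF f1] s1 assms by auto
    moreover from this t have "fst s2 vp + fst s2 vd = xs ! i + int (Suc t) * (xs ! h - xs ! i)"
      by (simp add: algebra_simps)
    ultimately show "runs_in 40 0 0 (Assign vp (Plus (Reg vp) (Reg vd)) ;;
        Cond (Equal (Read arr_low (Reg vp)) (Const 1)) (Assign vf (Const 1)) Skip) s2
      (\<lambda>s'. ?I (Suc t) (set_reg vt (1 + int t) s'))"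
      using t by (intro runs_in_straight) (auto simp: atLeastAtMostSuc_conv simp del: of_nat_Suc)
  qed (use s1 e1 in \<open>auto simp: frame_reg envD\<close>)
qed simp_all

definition selected :: "state \<Rightarrow> int \<times> (int \<times> int) option \<Rightarrow> bool" where
  "selected s st \<longleftrightarrow> fst s vrem = fst st \<and> (case snd st of None \<Rightarrow> fst s vsel = 0
     | Some (x, y) \<Rightarrow> fst s vsel = 1 \<and> fst s vx = x \<and> fst s vy = y)"

lemma selected_set_reg:
  "r \<notin> {vrem, vsel, vx, vy} \<Longrightarrow> selected (set_reg r v s) st \<longleftrightarrow> selected s st"
  by (auto simp: selected_def split: option.splits)

lemma visit_run:
  assumes "env s" "snd s arr_low = ind L" "fst s vi = int i" "i < n" "fst s vh = int h" "h < n"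
    "fst s vidx = int e" "e \<le> m" "selected s st"
  shows "runs_in 200 0 1 visit_com s (\<lambda>s'. selected s' (visit (eligible L Q) (2 ^ e) (xs ! i) (xs ! h) st))"
  unfolding visit_com_def
proof (rule runs_in_Seq[OF eligible_run[OF assms(1-6)]])
  fix s1
  assume f1: "frame eligible_com s s1" and s1: "fst s1 vf =
    (if \<exists>j\<in>{1..Q}. xs ! i + int j * (xs ! h - xs ! i) \<in> L then 1 else 0)"
  have e1: "env s1" by (rule env_frame[OF f1 assms(1)]) auto
  obtain rem sel where st: "st = (rem, sel)" by fastforce
  have eq: "fst s1 vi = int i" "fst s1 vh = int h" "fst s1 vidx = int e" "fst s1 vrem = fst s vrem"
    "fst s1 vsel = fst s vsel" "fst s1 vx = fst s vx" "fst s1 vy = fst s vy" "snd s1 arr_low = ind L"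
    using frame_reg[OF f1] frame_arr[OF f1] assms by auto
  have "fst s1 vf = 1 \<longleftrightarrow> (\<exists>j\<in>{1..Q}. xs ! i + int j * (xs ! h - xs ! i) \<in> L)"
    using s1 by simp
  then show "runs_in 100 0 1 (Cond (Conj (Conj (Equal (Read arr_low Xi) (Const 1)) (Less Xi Xh))
                (Conj (Equal (Reg vf) (Const 1)) (Equal (Reg vsel) (Const 0))))
       (Cond (Less (Reg vrem) (Read arr_pow (Reg vidx)))
         (Assign vsel (Const 1) ;; Assign vx Xi ;; Assign vy Xh)
         (Assign vrem (Minus (Reg vrem) (Read arr_pow (Reg vidx)))))
       Skip) s1 (\<lambda>s'. selected s' (visit (eligible L Q) (2 ^ e) (xs ! i) (xs ! h) st))"
    using assms(4,6,8,9) by (intro runs_in_straight)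
      (auto simp: envD[OF e1] eq st selected_def eligible_def split: option.splits)
qed simp_all

lemma select_run:
  assumes "env s" "snd s arr_low = ind L" "fst s vidx = int e" "e \<le> m"
  shows "runs_in 300 2 1 select_com s (\<lambda>s'. selected s' (select (eligible L Q) (2 ^ e) xs (fst s vrem)))"
  unfolding select_com_def
proof (rule runs_in_Seq)
  let ?v = "visit (eligible L Q) (2 ^ e)"
  let ?row = "For vh (Reg vn) visit_com"
  let ?loop = "For vi (Reg vn) ?row"
  show "runs_in 2 0 0 (Assign vsel (Const 0)) s (\<lambda>s'. selected s' (fst s vrem, None))"
    by (rule runs_in_straight) (auto simp: selected_def)
  fix s1 assume f1: "frame (Assign vsel (Const 0)) s s1" and s1: "selected s1 (fst s vrem, None)"
  have e1: "env s1" by (rule env_frame[OF f1 assms(1)]) auto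
  show "runs_in 250 2 1 ?loop s1 (\<lambda>s'. selected s' (select (eligible L Q) (2 ^ e) xs (fst s vrem)))"
  proof (rule runs_in_For[where I = "\<lambda>i s'. selected s' (fold (\<lambda>x. fold (?v x) xs) (take i xs) (fst s vrem, None))",
      OF _ _ n_le])
    fix i s2
    let ?st = "fold (\<lambda>x. fold (?v x) xs) (take i xs) (fst s vrem, None)"
    assume i: "i < nat (int n)" "fst s2 vi = int i" "selected s2 ?st" and f2: "frame ?loop s1 s2"
    have e2: "env s2" by (rule env_frame[OF f2 e1]) auto
    show "runs_in 220 1 1 ?row s2 (\<lambda>s'. selected (set_reg vi (1 + int i) s')
      (fold (\<lambda>x. fold (?v x) xs) (take (Suc i) xs) (fst s vrem, None)))"
    proof (rule runs_in_For[where I = "\<lambda>h s'. selected s' (fold (?v (xs ! i)) (take h xs) ?st)", OF _ _ n_le])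
      fix h s3
      assume h: "h < nat (int n)" "fst s3 vh = int h" "selected s3 (fold (?v (xs ! i)) (take h xs) ?st)"
        and f3: "frame ?row s2 s3"
      have e3: "env s3" by (rule env_frame[OF f3 e2]) auto
      have "snd s3 arr_low = ind L" "fst s3 vi = int i" "fst s3 vidx = int e"
        using frame_arr[OF f3] frame_arr[OF f2] frame_arr[OF f1] frame_reg[OF f3] frame_reg[OF f2]
          frame_reg[OF f1] assms i by auto
      then have "runs_in 200 0 1 visit_com s3 (\<lambda>s'. selected s' (?v (xs ! i) (xs ! h)
        (fold (?v (xs ! i)) (take h xs) ?st)))"
        using h i assms(4) by (intro visit_run[OF e3]) auto
      then show "runs_in 200 0 1 visit_com s3 (\<lambda>s'. selected (set_reg vh (1 + int h) s')
        (fold (?v (xs ! i)) (take (Suc h) xs) ?st))"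
        by (rule runs_in_mono) (use h in \<open>simp_all add: selected_set_reg take_Suc_conv_app_nth\<close>)
    qed (use i e2 in \<open>simp_all add: frame_reg envD selected_set_reg take_Suc_conv_app_nth\<close>)
  qed (use s1 e1 in \<open>simp_all add: frame_reg envD selected_set_reg select_def\<close>)
qed simp_all

lemma advance_effect:
  assumes "env s"
  shows "effect advance_com s = set_reg vp (advance X (fst s vd) (fst s vp)) s"
  using assms by (simp add: advance_com_def advance_def envD)

lemma advance_straight: "straight advance_com" "max_cost advance_com = 11"
  by (simp_all add: advance_com_def)

lemma mark_run:
  assumes "env s" "snd s arr_cov = ind C" "fst s vx = x" "fst s vy = y"
  shows "runs_in 200 1 0 mark_com s (\<lambda>s'. snd s' arr_cov = ind (C \<union> maximal_AP X (y - x) x))"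
  unfolding mark_com_def
proof (rule runs_in_Seq)
  let ?init = "Assign vp (Reg vx) ;; Assign vd (Minus (Reg vy) (Reg vx))"
    and ?up = "For vt (Reg vn) advance_com" and ?turn = "Assign vd (Minus (Const 0) (Reg vd))"
    and ?down = "For vt (Reg vn) (Write arr_cov (Reg vp) (Const 1) ;; advance_com)"
  let ?z = "(advance X (y - x) ^^ n) x"
  let ?post = "\<lambda>s'. snd s' arr_cov = ind (C \<union> maximal_AP X (y - x) x)"
  show "runs_in 10 0 0 ?init s (\<lambda>s'. fst s' vp = x \<and> fst s' vd = y - x)"
    by (rule runs_in_straight) (use assms in auto)
  fix s1 assume f1: "frame ?init s s1" and s1: "fst s1 vp = x \<and> fst s1 vd = y - x"
  have e1: "env s1" by (rule env_frame[OF f1 assms(1)]) auto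
  show "runs_in 150 1 0 (?up ;; ?turn ;; ?down) s1 ?post"
  proof (rule runs_in_Seq)
    show "runs_in 50 1 0 ?up s1 (\<lambda>s'. fst s' vp = ?z)"
    proof (rule runs_in_For[where I = "\<lambda>t s'. fst s' vp = (advance X (y - x) ^^ t) x", OF _ _ n_le])
      fix t s2 assume t: "fst s2 vp = (advance X (y - x) ^^ t) x" and f2: "frame ?up s1 s2"
      have e2: "env s2" by (rule env_frame[OF f2 e1]) auto
      have "fst s2 vd = y - x" using frame_reg[OF f2] s1 by simp
      then show "runs_in 20 0 0 advance_com s2
        (\<lambda>s'. fst (set_reg vt (1 + int t) s') vp = (advance X (y - x) ^^ Suc t) x)"
        using t by (intro runs_in_straight) (auto simp: advance_effect[OF e2] advance_straight)
    qed (use s1 e1 in \<open>auto simp: frame_reg envD\<close>)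
    fix s2 assume f2: "frame ?up s1 s2" and s2: "fst s2 vp = ?z"
    have e2: "env s2" by (rule env_frame[OF f2 e1]) auto
    show "runs_in 80 1 0 (?turn ;; ?down) s2 ?post"
    proof (rule runs_in_Seq)
      show "runs_in 10 0 0 ?turn s2 (\<lambda>s'. fst s' vd = - (y - x))"
        by (rule runs_in_straight) (use s1 frame_reg[OF f2] in auto)
      fix s3 assume f3: "frame ?turn s2 s3" and s3: "fst s3 vd = - (y - x)"
      have e3: "env s3" by (rule env_frame[OF f3 e2]) auto
      let ?w = "\<lambda>t. (advance X (- (y - x)) ^^ t) ?z"
      show "runs_in 60 1 0 ?down s3 ?post"
      proof (rule runs_in_For[where I = "\<lambda>t s'. fst s' vp = ?w t \<and> snd s' arr_cov = ind (C \<union> ?w ` {..<t})",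
          OF _ _ n_le])
        fix t s4 assume t: "fst s4 vp = ?w t \<and> snd s4 arr_cov = ind (C \<union> ?w ` {..<t})"
          and f4: "frame ?down s3 s4"
        have e4: "env s4" by (rule env_frame[OF f4 e3]) auto
        have d: "fst s4 vd = - (y - x)" using frame_reg[OF f4] s3 by simp
        \<comment> \<open>\<open>advance_effect\<close> is applied in the state after the write,
          which therefore has to satisfy \<open>env\<close> as well.\<close>
        have e5: "env (fst s4, (snd s4)(arr_cov := (snd s4 arr_cov)(fst s4 vp := 1)))"
          using e4 by (simp add: env_def)
        have eff: "effect (Write arr_cov (Reg vp) (Const 1) ;; advance_com) s4 =
          ((fst s4)(vp := advance X (fst s4 vd) (fst s4 vp)), (snd s4)(arr_cov := (snd s4 arr_cov)(fst s4 vp := 1)))"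
          using advance_effect[OF e5] by simp
        have "insert (?w t) (C \<union> ?w ` {..<t}) = C \<union> ?w ` {..<Suc t}"
          by (auto simp: lessThan_Suc)
        then show "runs_in 30 0 0 (Write arr_cov (Reg vp) (Const 1) ;; advance_com) s4
          (\<lambda>s'. fst (set_reg vt (1 + int t) s') vp = ?w (Suc t) \<and>
            snd (set_reg vt (1 + int t) s') arr_cov = ind (C \<union> ?w ` {..<Suc t}))"
        proof (intro runs_in_straight)
          assume "insert (?w t) (C \<union> ?w ` {..<t}) = C \<union> ?w ` {..<Suc t}"
          then show "fst (set_reg vt (1 + int t) (effect (Write arr_cov (Reg vp) (Const 1) ;; advance_com) s4)) vp = ?w (Suc t) \<and>
            snd (set_reg vt (1 + int t) (effect (Write arr_cov (Reg vp) (Const 1) ;; advance_com) s4)) arr_cov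
              = ind (C \<union> ?w ` {..<Suc t})"
            unfolding eff using t d by simp
        qed (simp_all add: advance_straight)
      next
        fix s4 assume "fst s4 vp = ?w (nat (int n)) \<and> snd s4 arr_cov = ind (C \<union> ?w ` {..<nat (int n)})"
        then show "?post s4" by (simp add: maximal_AP_def ray_def card_X)
      qed (use s2 e3 frame_reg[OF f3] frame_arr[OF f3] frame_arr[OF f2] frame_arr[OF f1] assms in \<open>auto simp: frame_reg envD\<close>)
    qed simp_all
  qed simp_all
qed simp_all

text \<open>Each round recomputes \<open>arr_low\<close> on \<open>X\<close>, so between rounds it
  only has to vanish off \<open>X\<close>.\<close>

fun sim_state :: "state \<Rightarrow> int set \<times> nat \<times> int \<Rightarrow> bool" where
  "sim_state s (C, j, rem) \<longleftrightarrow> snd s arr_cov = ind C \<and> fst s vj = int j \<and> fst s vrem = rem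
     \<and> (\<exists>L\<subseteq>X. snd s arr_low = ind L)"

lemma step_run:
  assumes "env s" "sim_state s st" "fst s vidx = int (q * Suc l)" "l < k"
  shows "runs_in 1000 2 1 step_com s (\<lambda>s'. sim_state s' (step xs Q ((2 ^ q) ^ l) st) \<and> fst s' vidx = int (q * l))"
  unfolding step_com_def
proof (rule runs_in_Seq)
  obtain C j rem where st: "st = (C, j, rem)" by (metis prod_cases3)
  obtain L where L: "L \<subseteq> X" "snd s arr_low = ind L" using assms(2) by (auto simp: st)
  let ?c0 = "Assign vidx (Minus (Reg vidx) (Reg vq))"
    and ?c3 = "Cond (Equal (Reg vsel) (Const 1)) (mark_com ;; Assign vj (Plus (Reg vj) (Const 1))) Skip"
  let ?post = "\<lambda>s'. sim_state s' (step xs Q ((2 ^ q) ^ l) st) \<and> fst s' vidx = int (q * l)"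
  \<comment> \<open>Keeps the place value within the table of powers.\<close>
  have "q * l \<le> m" unfolding m_def using assms(4) by (simp add: mult.commute)
  show "runs_in 10 0 0 ?c0 s (\<lambda>s'. fst s' vidx = int (q * l))"
    by (rule runs_in_straight) (use assms in \<open>auto simp: envD algebra_simps\<close>)
  fix s1 assume f1: "frame ?c0 s s1" and s1: "fst s1 vidx = int (q * l)"
  have e1: "env s1" by (rule env_frame[OF f1 assms(1)]) auto
  have C1: "snd s1 arr_cov = ind C" "snd s1 arr_low = ind L" "fst s1 vj = int j" "fst s1 vrem = rem"
    using frame_reg[OF f1] frame_arr[OF f1] assms(2) L by (auto simp: st)
  show "runs_in 900 2 1 (low_com ;; select_com ;; ?c3) s1 ?post"
  proof (rule runs_in_Seq[OF low_run[OF e1 C1(1,2) L(1)]])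
    fix s2 assume f2: "frame low_com s1 s2" and s2: "snd s2 arr_low = ind (low X C Q)"
    have e2: "env s2" by (rule env_frame[OF f2 e1]) auto
    have C2: "snd s2 arr_cov = ind C" "fst s2 vj = int j" "fst s2 vrem = rem" "fst s2 vidx = int (q * l)"
      using frame_reg[OF f2] frame_arr[OF f2] C1 s1 by auto
    show "runs_in 650 2 1 (select_com ;; ?c3) s2 ?post"
    proof (rule runs_in_Seq[OF select_run[OF e2 s2 C2(4) \<open>q * l \<le> m\<close>]])
      fix s3 assume f3: "frame select_com s2 s3"
        and s3: "selected s3 (select (eligible (low X C Q) Q) (2 ^ (q * l)) xs (fst s2 vrem))"
      have e3: "env s3" by (rule env_frame[OF f3 e2]) auto
      have C3: "snd s3 arr_cov = ind C" "fst s3 vj = int j" "fst s3 vidx = int (q * l)"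
        "snd s3 arr_low = ind (low X C Q)"
        using frame_reg[OF f3] frame_arr[OF f3] C2 s2 by auto
      obtain rem' sel where sel: "select (eligible (low X C Q) Q) ((2 ^ q) ^ l) xs rem = (rem', sel)"
        by fastforce
      have S: "selected s3 (rem', sel)" using s3 by (simp add: power_mult C2 sel)
      have low: "\<exists>L\<subseteq>X. ind (low X C Q) = ind L" by (rule exI[of _ "low X C Q"]) (auto simp: low_def)
      show "runs_in 300 2 1 ?c3 s3 ?post"
      proof (rule runs_in_Cond)
        assume "bval (Equal (Reg vsel) (Const 1)) s3"
        then obtain x y where xy: "sel = Some (x, y)" "fst s3 vx = x" "fst s3 vy = y" "fst s3 vrem = rem'"
          using S by (auto simp: selected_def split: option.splits)
        show "runs_in 250 2 1 (mark_com ;; Assign vj (Plus (Reg vj) (Const 1))) s3 ?post"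
        proof (rule runs_in_Seq[OF mark_run[OF e3 C3(1) xy(2,3)]])
          fix s4 assume f4: "frame mark_com s3 s4" and s4: "snd s4 arr_cov = ind (C \<union> maximal_AP X (y - x) x)"
          have "fst s4 vj = int j" "fst s4 vidx = int (q * l)" "fst s4 vrem = rem'" "snd s4 arr_low = ind (low X C Q)"
            using frame_reg[OF f4] frame_arr[OF f4] C3 xy by auto
          then show "runs_in 10 0 0 (Assign vj (Plus (Reg vj) (Const 1))) s4 ?post"
            using s4 low by (intro runs_in_straight) (simp_all add: st sel xy)
        qed simp_all
      next
        assume "\<not> bval (Equal (Reg vsel) (Const 1)) s3"
        then have "sel = None" "fst s3 vrem = rem'"
          using S by (auto simp: selected_def split: option.splits)
        then show "runs_in 250 2 1 Skip s3 ?post"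
          using C3 low by (intro runs_in_straight) (simp_all add: st sel)
      qed simp
    qed simp_all
  qed simp_all
qed simp_all

lemma k_le: "nat (int k) \<le> Suc n ^ 0 * (2 ^ m) ^ 1"
proof -
  have "k \<le> m" by (simp add: m_def q_def)
  then have "k < 2 ^ m" using less_exp[of m] by linarith
  then show ?thesis by simp
qed

lemma simulate_run:
  assumes "env s" "snd s arr_cov = ind {}" "snd s arr_low = ind L" "L \<subseteq> X"
  shows "runs_in 1100 2 2 simulate_com s
    (\<lambda>s'. sim_state s' (simulate xs Q (2 ^ q) k ({}, 0, fst s vguess)))"
  unfolding simulate_com_def
proof (rule runs_in_Seq)
  let ?init = "Assign vj (Const 0) ;; Assign vrem (Reg vguess) ;; Assign vidx (Reg vm)"
    and ?loop = "For vl (Reg vk) step_com"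
  let ?st = "({}, 0, fst s vguess)"
  \<comment> \<open>\<open>simulate\<close> passes its state along while counting down, so the
    invariant says that finishing from the current state gives the result of the whole run.\<close>
  let ?I = "\<lambda>i s'. (\<exists>st. sim_state s' st \<and> simulate xs Q (2 ^ q) (k - i) st = simulate xs Q (2 ^ q) k ?st)
    \<and> fst s' vidx = int (q * (k - i))"
  show "runs_in 10 0 0 ?init s (\<lambda>s'. sim_state s' ?st \<and> fst s' vidx = int m)"
    by (rule runs_in_straight) (use assms in \<open>auto simp: envD\<close>)
  fix s1 assume f1: "frame ?init s s1" and s1: "sim_state s1 ?st \<and> fst s1 vidx = int m"
  have e1: "env s1" by (rule env_frame[OF f1 assms(1)]) auto
  show "runs_in 1050 2 2 ?loop s1 (\<lambda>s'. sim_state s' (simulate xs Q (2 ^ q) k ?st))"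
  proof (rule runs_in_For[where I = ?I, OF _ _ k_le])
    fix i s2 assume i: "i < nat (int k)" "?I i s2" and f2: "frame ?loop s1 s2"
    have e2: "env s2" by (rule env_frame[OF f2 e1]) auto
    define l where "l = k - Suc i"
    have l: "k - i = Suc l" "l < k" using i(1) by (auto simp: l_def)
    from i(2) obtain st where st: "sim_state s2 st" "simulate xs Q (2 ^ q) (Suc l) st = simulate xs Q (2 ^ q) k ?st"
      "fst s2 vidx = int (q * Suc l)" unfolding l(1) by blast
    show "runs_in 1000 2 1 step_com s2 (\<lambda>s'. ?I (Suc i) (set_reg vl (1 + int i) s'))"
    proof (rule runs_in_mono[OF step_run[OF e2 st(1,3) l(2)]])
      fix s' assume s': "sim_state s' (step xs Q ((2 ^ q) ^ l) st) \<and> fst s' vidx = int (q * l)"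
      then have "sim_state (set_reg vl (1 + int i) s') (step xs Q ((2 ^ q) ^ l) st)"
        by (cases "step xs Q ((2 ^ q) ^ l) st") simp
      moreover have "simulate xs Q (2 ^ q) l (step xs Q ((2 ^ q) ^ l) st) = simulate xs Q (2 ^ q) k ?st"
        using st(2) by simp
      ultimately show "?I (Suc i) (set_reg vl (1 + int i) s')"
        using s' unfolding l_def[symmetric]
        by (intro conjI exI[of _ "step xs Q ((2 ^ q) ^ l) st"]) simp_all
    qed simp_all
  next
    fix s' assume "?I (nat (int k)) s'"
    then obtain st where "sim_state s' st" "simulate xs Q (2 ^ q) (k - nat (int k)) st = simulate xs Q (2 ^ q) k ?st"
      by blast
    then show "sim_state s' (simulate xs Q (2 ^ q) k ?st)" by simp
  next
    show "?I 0 (set_reg vl 0 s1)" using s1 by (auto simp: m_def mult.commute)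
  qed (use e1 in \<open>auto simp: frame_reg envD\<close>)
qed simp_all


section \<open>Evaluating the inclusion-exclusion sum\<close>

lemma count_uncovered_run:
  assumes "env s" "snd s arr_cov = ind C"
  shows "runs_in 60 1 0 count_uncovered_com s (\<lambda>s'. fst s' vu = int (card (X - C)))"
  unfolding count_uncovered_com_def
proof (rule runs_in_Seq)
  let ?loop = "For vi (Reg vn)
       (Cond (Equal (Read arr_cov Xi) (Const 0)) (Assign vu (Plus (Reg vu) (Const 1))) Skip)"
  show "runs_in 2 0 0 (Assign vu (Const 0)) s (\<lambda>s'. fst s' vu = 0)"
    by (rule runs_in_straight) auto
  fix s1 assume f1: "frame (Assign vu (Const 0)) s s1" and s1: "fst s1 vu = 0"
  have e1: "env s1" by (rule env_frame[OF f1 assms(1)]) auto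
  show "runs_in 50 1 0 ?loop s1 (\<lambda>s'. fst s' vu = int (card (X - C)))"
  proof (rule runs_in_For[where I = "\<lambda>i s'. fst s' vu = int (length (filter (\<lambda>x. x \<notin> C) (take i xs)))", OF _ _ n_le])
    fix i s2 assume i: "i < nat (int n)" "fst s2 vi = int i"
      "fst s2 vu = int (length (filter (\<lambda>x. x \<notin> C) (take i xs)))" and f2: "frame ?loop s1 s2"
    have e2: "env s2" by (rule env_frame[OF f2 e1]) auto
    have "snd s2 arr_cov = ind C" using frame_arr[OF f2] frame_arr[OF f1] assms by simp
    with i show "runs_in 20 0 0 (Cond (Equal (Read arr_cov Xi) (Const 0)) (Assign vu (Plus (Reg vu) (Const 1))) Skip) s2
      (\<lambda>s'. fst (set_reg vi (1 + int i) s') vu = int (length (filter (\<lambda>x. x \<notin> C) (take (Suc i) xs))))"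
      by (intro runs_in_straight) (auto simp: envD[OF e2] take_Suc_conv_app_nth)
  next
    fix s2 :: state assume "fst s2 vu = int (length (filter (\<lambda>x. x \<notin> C) (take (nat (int n)) xs)))"
    moreover have "{x. x \<notin> C} \<inter> X = X - C" by auto
    ultimately show "fst s2 vu = int (card (X - C))"
      using distinct_xs by (simp add: distinct_length_filter)
  qed (use s1 e1 in \<open>auto simp: frame_reg envD\<close>)
qed simp_all

definition uncovered :: "int set \<Rightarrow> int list" where
  "uncovered C = filter (\<lambda>x. x \<notin> C) xs"

lemma length_uncovered: "length (uncovered C) = card (X - C)"
proof -
  have "{x. x \<notin> C} \<inter> X = X - C" by auto
  then show ?thesis unfolding uncovered_def using distinct_xs by (simp add: distinct_length_filter)
qed

lemma nth_notin_take: "i < n \<Longrightarrow> xs ! i \<notin> set (take i xs)"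
  using distinct_xs by (auto simp: in_set_conv_nth nth_eq_iff_index_eq)

text \<open>\<open>D\<close> holds the decisions on the first \<open>i\<close> elements; joined with
  what the current remainder decodes to on the other elements, it is always the target set. Cells
  not yet reached still show the previous subset \<open>D0\<close>.\<close>

definition ban_inv :: "int set \<Rightarrow> int set \<Rightarrow> int \<Rightarrow> nat \<Rightarrow> int set \<Rightarrow> state \<Rightarrow> bool" where
  "ban_inv C D0 w i D s \<longleftrightarrow> D \<subseteq> set (take i xs)
    \<and> D \<union> decode (filter (\<lambda>x. x \<notin> C) (drop i xs)) (fst s vrem) = decode (uncovered C) w
    \<and> fst s vidx = int (length (filter (\<lambda>x. x \<notin> C) (drop i xs))) \<and> fst s vsgn = (- 1) ^ card D
    \<and> snd s arr_ban = (\<lambda>v. if v \<in> set (take i xs) then ind D v else ind D0 v)"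

lemma ban_inv_step:
  assumes e: "env s" and i: "i < n" "fst s vi = int i" and cov: "snd s arr_cov = ind C"
    and u: "length (uncovered C) \<le> m" and inv: "ban_inv C D0 w i D s"
  shows "\<exists>D'. ban_inv C D0 w (Suc i) D' (set_reg vi v (effect (Write arr_ban Xi (Const 0) ;;
        Cond (Equal (Read arr_cov Xi) (Const 0))
          (Assign vidx (Minus (Reg vidx) (Const 1)) ;;
           Cond (Less (Reg vrem) (Read arr_pow (Reg vidx)))
             (Write arr_ban Xi (Const 1) ;; Assign vsgn (Minus (Const 0) (Reg vsgn)))
             (Assign vrem (Minus (Reg vrem) (Read arr_pow (Reg vidx)))))
          Skip) s))"
proof -
  let ?us = "filter (\<lambda>x. x \<notin> C) (drop (Suc i) xs)"
  have drop: "drop i xs = xs ! i # drop (Suc i) xs" using i(1) by (simp add: Cons_nth_drop_Suc)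
  have take: "set (take (Suc i) xs) = insert (xs ! i) (set (take i xs))" by (rule set_take_Suc[OF i(1)])
  have D: "D \<subseteq> set (take i xs)" "xs ! i \<notin> D" "finite D"
    using inv nth_notin_take[OF i(1)] finite_subset[of D] by (auto simp: ban_inv_def)
  have "length ?us \<le> length (uncovered C)"
  proof -
    have "uncovered C = filter (\<lambda>x. x \<notin> C) (take (Suc i) xs) @ ?us"
      unfolding uncovered_def by (metis append_take_drop_id filter_append)
    then show ?thesis by simp
  qed
  then have pow: "snd s arr_pow (int (length ?us)) = 2 ^ length ?us" using u envD(8)[OF e] by simp
  note inv' = inv[unfolded ban_inv_def drop]
  \<comment> \<open>A covered element, a clear bit (the element joins and the sign flips) and a set
    bit.\<close>
  consider "xs ! i \<in> C" | "xs ! i \<notin> C" "fst s vrem < 2 ^ length ?us" | "xs ! i \<notin> C" "\<not> fst s vrem < 2 ^ length ?us"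
    by blast
  then show ?thesis
  proof cases
    case 1
    then show ?thesis
      using inv' D i by (intro exI[of _ D])
        (auto simp: ban_inv_def envD[OF e] cov take fun_eq_iff ind_def)
  next
    case 2
    then have "insert (xs ! i) D \<union> decode ?us (fst s vrem) = decode (uncovered C) w"
      using inv' by auto
    with 2 show ?thesis
      using inv' D i pow by (intro exI[of _ "insert (xs ! i) D"])
        (auto simp: ban_inv_def envD[OF e] cov take fun_eq_iff ind_def)
  next
    case 3
    then have "D \<union> decode ?us (fst s vrem - 2 ^ length ?us) = decode (uncovered C) w"
      using inv' by auto
    with 3 show ?thesis
      using inv' D i pow by (intro exI[of _ D])
        (auto simp: ban_inv_def envD[OF e] cov take fun_eq_iff ind_def)
  qed
qed

lemma ban_run:
  assumes "env s" "snd s arr_cov = ind C" "fst s vu = int (card (X - C))" "card (X - C) \<le> m"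
    "snd s arr_ban = ind D0" "D0 \<subseteq> X" "fst s vw = w"
  shows "runs_in 150 1 0 ban_com s (\<lambda>s'. snd s' arr_ban = ind (decode (uncovered C) w)
    \<and> fst s' vsgn = (- 1) ^ card (decode (uncovered C) w))"
  unfolding ban_com_def
proof (rule runs_in_Seq)
  let ?init = "Assign vrem (Reg vw) ;; Assign vidx (Reg vu) ;; Assign vsgn (Const 1)"
    and ?body = "Write arr_ban Xi (Const 0) ;;
        Cond (Equal (Read arr_cov Xi) (Const 0))
          (Assign vidx (Minus (Reg vidx) (Const 1)) ;;
           Cond (Less (Reg vrem) (Read arr_pow (Reg vidx)))
             (Write arr_ban Xi (Const 1) ;; Assign vsgn (Minus (Const 0) (Reg vsgn)))
             (Assign vrem (Minus (Reg vrem) (Read arr_pow (Reg vidx)))))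
          Skip"
  let ?loop = "For vi (Reg vn) ?body"
  show "runs_in 10 0 0 ?init s (ban_inv C D0 w 0 {})"
    by (rule runs_in_straight)
      (use assms length_uncovered[of C] in \<open>auto simp: ban_inv_def uncovered_def\<close>)
  fix s1 assume f1: "frame ?init s s1" and s1: "ban_inv C D0 w 0 {} s1"
  have e1: "env s1" by (rule env_frame[OF f1 assms(1)]) auto
  show "runs_in 120 1 0 ?loop s1 (\<lambda>s'. snd s' arr_ban = ind (decode (uncovered C) w)
    \<and> fst s' vsgn = (- 1) ^ card (decode (uncovered C) w))"
  proof (rule runs_in_For[where I = "\<lambda>i s'. \<exists>D. ban_inv C D0 w i D s'", OF _ _ n_le])
    fix i s2
    assume i: "i < nat (int n)" "fst s2 vi = int i" "\<exists>D. ban_inv C D0 w i D s2"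
      and f2: "frame ?loop s1 s2"
    have e2: "env s2" by (rule env_frame[OF f2 e1]) auto
    have "snd s2 arr_cov = ind C" using frame_arr[OF f2] frame_arr[OF f1] assms by simp
    moreover obtain D where "ban_inv C D0 w i D s2" using i(3) ..
    ultimately have "\<exists>D'. ban_inv C D0 w (Suc i) D' (set_reg vi (1 + int i) (effect ?body s2))"
      using i assms(4) by (intro ban_inv_step[OF e2]) (auto simp: length_uncovered)
    then show "runs_in 60 0 0 ?body s2 (\<lambda>s'. \<exists>D. ban_inv C D0 w (Suc i) D (set_reg vi (1 + int i) s'))"
      by (intro runs_in_straight) simp_all
  next
    fix s2 :: state assume "\<exists>D. ban_inv C D0 w (nat (int n)) D s2"
    then obtain D where "ban_inv C D0 w n D s2" by auto
    then have "D = decode (uncovered C) w" "fst s2 vsgn = (- 1) ^ card D"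
      "snd s2 arr_ban = (\<lambda>v. if v \<in> X then ind D v else ind D0 v)" "D \<subseteq> X"
      by (auto simp: ban_inv_def)
    then show "snd s2 arr_ban = ind (decode (uncovered C) w) \<and> fst s2 vsgn = (- 1) ^ card (decode (uncovered C) w)"
      using assms(6) by (auto simp: fun_eq_iff ind_def)
  next
    show "\<exists>D. ban_inv C D0 w 0 D (set_reg vi 0 s1)"
      using s1 by (intro exI[of _ "{}"]) (auto simp: ban_inv_def)
  qed (use e1 in \<open>auto simp: frame_reg envD\<close>)
qed simp_all

lemma test_ray_run:
  assumes "env s" "snd s arr_ban = ind D" "fst s vi = int i" "i < n" "fst s vh = int h" "h < n"
  shows "runs_in 100 1 0 test_ray_com s
    (\<lambda>s'. fst s' vf = 0 \<longleftrightarrow> ray X (xs ! h - xs ! i) (xs ! i) \<inter> D = {})"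
  unfolding test_ray_com_def
proof (rule runs_in_Seq)
  let ?init = "Assign vd (Minus Xh Xi) ;; Assign vp Xi ;; Assign vf (Const 0)"
    and ?body = "Cond (Equal (Read arr_ban (Reg vp)) (Const 1)) (Assign vf (Const 1)) Skip ;; advance_com"
  let ?loop = "For vt (Reg vn) ?body"
  let ?d = "xs ! h - xs ! i"
  let ?I = "\<lambda>t s'. fst s' vp = (advance X ?d ^^ t) (xs ! i)
    \<and> (fst s' vf = 0 \<longleftrightarrow> (\<forall>t'<t. (advance X ?d ^^ t') (xs ! i) \<notin> D))"
  show "runs_in 20 0 0 ?init s (\<lambda>s'. fst s' vd = ?d \<and> ?I 0 s')"
    by (rule runs_in_straight) (use assms in \<open>auto simp: envD\<close>)
  fix s1 assume f1: "frame ?init s s1" and s1: "fst s1 vd = ?d \<and> ?I 0 s1"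
  have e1: "env s1" by (rule env_frame[OF f1 assms(1)]) auto
  show "runs_in 60 1 0 ?loop s1 (\<lambda>s'. fst s' vf = 0 \<longleftrightarrow> ray X ?d (xs ! i) \<inter> D = {})"
  proof (rule runs_in_For[where I = ?I, OF _ _ n_le])
    fix t s2 assume t: "?I t s2" and f2: "frame ?loop s1 s2"
    have e2: "env s2" by (rule env_frame[OF f2 e1]) auto
    have s2: "fst s2 vd = ?d" "snd s2 arr_ban = ind D"
      using frame_reg[OF f2] frame_arr[OF f2] frame_arr[OF f1] s1 assms by auto
    let ?s = "if fst s2 vp \<in> D then set_reg vf 1 s2 else s2"
    have "effect ?body s2 = effect advance_com ?s" using s2 by simp
    also have "env ?s" using e2 by (simp add: env_def)
    then have "effect advance_com ?s = set_reg vp (advance X ?d (fst s2 vp)) ?s"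
      using s2 by (simp add: advance_effect)
    finally have eff: "effect ?body s2 = set_reg vp (advance X ?d (fst s2 vp)) ?s" .
    show "runs_in 40 0 0 ?body s2 (\<lambda>s'. ?I (Suc t) (set_reg vt (1 + int t) s'))"
    proof (rule runs_in_straight)
      show "?I (Suc t) (set_reg vt (1 + int t) (effect ?body s2))"
        unfolding eff using t by (auto simp: less_Suc_eq)
    qed (simp_all add: advance_straight)
  next
    fix s2 :: state assume "?I (nat (int n)) s2"
    then show "fst s2 vf = 0 \<longleftrightarrow> ray X ?d (xs ! i) \<inter> D = {}"
      by (auto simp: ray_def card_X)
  qed (use s1 e1 in \<open>auto simp: frame_reg envD\<close>)
qed simp_all

lemma card_rays_avoiding:
  "card (rays_avoiding X D) = (\<Sum>x\<leftarrow>xs. length (filter (\<lambda>y. ray X (y - x) x \<inter> D = {}) xs))"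
proof -
  have "rays_avoiding X D = (SIGMA x:X. {y. ray X (y - x) x \<inter> D = {}} \<inter> X)"
    by (auto simp: rays_avoiding_def)
  then have "card (rays_avoiding X D) = (\<Sum>x\<in>X. card ({y. ray X (y - x) x \<inter> D = {}} \<inter> X))"
    by simp
  then show ?thesis
    using distinct_xs by (simp add: sum_list_distinct_conv_sum_set distinct_length_filter)
qed

lemma count_rays_run:
  assumes "env s" "snd s arr_ban = ind D"
  shows "runs_in 200 3 0 count_rays_com s (\<lambda>s'. fst s' vc = int (card (rays_avoiding X D)))"
  unfolding count_rays_com_def
proof (rule runs_in_Seq)
  let ?test = "Cond (Equal (Reg vf) (Const 0)) (Assign vc (Plus (Reg vc) (Const 1))) Skip"
  let ?row = "For vh (Reg vn) (test_ray_com ;; ?test)"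
  let ?loop = "For vi (Reg vn) ?row"
  let ?P = "\<lambda>x y. ray X (y - x) x \<inter> D = {}"
  let ?c = "\<lambda>i. \<Sum>x\<leftarrow>take i xs. length (filter (?P x) xs)"
  show "runs_in 2 0 0 (Assign vc (Const 0)) s (\<lambda>s'. fst s' vc = 0)"
    by (rule runs_in_straight) auto
  fix s1 assume f1: "frame (Assign vc (Const 0)) s s1" and s1: "fst s1 vc = 0"
  have e1: "env s1" by (rule env_frame[OF f1 assms(1)]) auto
  show "runs_in 190 3 0 ?loop s1 (\<lambda>s'. fst s' vc = int (card (rays_avoiding X D)))"
  proof (rule runs_in_For[where I = "\<lambda>i s'. fst s' vc = int (?c i)", OF _ _ n_le])
    fix i s2 assume i: "i < nat (int n)" "fst s2 vi = int i" "fst s2 vc = int (?c i)"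
      and f2: "frame ?loop s1 s2"
    have e2: "env s2" by (rule env_frame[OF f2 e1]) auto
    show "runs_in 160 2 0 ?row s2 (\<lambda>s'. fst (set_reg vi (1 + int i) s') vc = int (?c (Suc i)))"
    proof (rule runs_in_For[where I = "\<lambda>h s'. fst s' vc = int (?c i + length (filter (?P (xs ! i)) (take h xs)))",
        OF _ _ n_le])
      fix h s3 assume h: "h < nat (int n)" "fst s3 vh = int h"
        "fst s3 vc = int (?c i + length (filter (?P (xs ! i)) (take h xs)))"
        and f3: "frame ?row s2 s3"
      have e3: "env s3" by (rule env_frame[OF f3 e2]) auto
      have s3: "snd s3 arr_ban = ind D" "fst s3 vi = int i"
        using frame_arr[OF f3] frame_arr[OF f2] frame_arr[OF f1] frame_reg[OF f3] assms i by auto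
      show "runs_in 130 1 0 (test_ray_com ;; ?test) s3 (\<lambda>s'. fst (set_reg vh (1 + int h) s') vc =
        int (?c i + length (filter (?P (xs ! i)) (take (Suc h) xs))))"
      proof (rule runs_in_Seq[OF test_ray_run[OF e3 s3 _ h(2)]])
        fix s4 assume f4: "frame test_ray_com s3 s4" and s4: "(fst s4 vf = 0) = ?P (xs ! i) (xs ! h)"
        have "fst s4 vc = fst s3 vc" using frame_reg[OF f4] by simp
        with s4 h show "runs_in 20 1 0 ?test s4 (\<lambda>s'. fst (set_reg vh (1 + int h) s') vc =
          int (?c i + length (filter (?P (xs ! i)) (take (Suc h) xs))))"
          by (intro runs_in_straight) (auto simp: take_Suc_conv_app_nth)
      qed (use h i in simp_all)
    qed (use i e2 in \<open>auto simp: frame_reg envD take_Suc_conv_app_nth\<close>)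
  qed (use s1 e1 in \<open>auto simp: frame_reg envD card_rays_avoiding\<close>)
qed simp_all

lemma power_run:
  assumes "env s" "fst s vj = int j" "fst s vc = int c" "c \<le> n * n" "fst s vsgn = sg"
  shows "runs_in 100 2 1 power_com s (\<lambda>s'. fst s' vpw = sg * int c ^ (k - j))"
  unfolding power_com_def
proof (rule runs_in_Seq)
  let ?inner = "For vh (Reg vc) (Assign vz (Plus (Reg vz) (Reg vpw)))"
  let ?body = "(Assign vz (Const 0) ;; ?inner) ;; Assign vpw (Reg vz)"
  let ?loop = "For vi (Minus (Reg vk) (Reg vj)) ?body"
  \<comment> \<open>The counter is at most \<open>n * n\<close>, so multiplying by it costs two
    factors \<open>Suc n\<close>.\<close>
  have c_le: "nat (int c) \<le> Suc n ^ 2 * (2 ^ m) ^ 0" using assms(4) by (simp add: power2_eq_square)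
  have kj_le: "nat (int k - int j) \<le> Suc n ^ 0 * (2 ^ m) ^ 1"
    by (rule order_trans[OF nat_mono k_le]) simp
  show "runs_in 2 0 0 (Assign vpw (Reg vsgn)) s (\<lambda>s'. fst s' vpw = sg)"
    by (rule runs_in_straight) (use assms in auto)
  fix s1 assume f1: "frame (Assign vpw (Reg vsgn)) s s1" and s1: "fst s1 vpw = sg"
  have e1: "env s1" by (rule env_frame[OF f1 assms(1)]) auto
  have s1': "fst s1 vj = int j" "fst s1 vc = int c" using frame_reg[OF f1] assms by auto
  show "runs_in 90 2 1 ?loop s1 (\<lambda>s'. fst s' vpw = sg * int c ^ (k - j))"
  proof (rule runs_in_For[where I = "\<lambda>i s'. fst s' vpw = sg * int c ^ i", OF _ _ kj_le])
    fix i s2 assume i: "fst s2 vpw = sg * int c ^ i" and f2: "frame ?loop s1 s2"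
    have s2: "fst s2 vc = int c" using frame_reg[OF f2] s1' by simp
    show "runs_in 60 2 0 ?body s2 (\<lambda>s'. fst (set_reg vi (1 + int i) s') vpw = sg * int c ^ Suc i)"
    proof (rule runs_in_Seq)
      show "runs_in 50 2 0 (Assign vz (Const 0) ;; ?inner) s2 (\<lambda>s'. fst s' vz = int c * (sg * int c ^ i))"
      proof (rule runs_in_Seq)
        show "runs_in 2 0 0 (Assign vz (Const 0)) s2 (\<lambda>s'. fst s' vz = 0)"
          by (rule runs_in_straight) auto
        fix s3 assume f3: "frame (Assign vz (Const 0)) s2 s3" and s3: "fst s3 vz = 0"
        have s3': "fst s3 vc = int c" "fst s3 vpw = sg * int c ^ i" using frame_reg[OF f3] s2 i by auto
        show "runs_in 40 2 0 ?inner s3 (\<lambda>s'. fst s' vz = int c * (sg * int c ^ i))"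
        proof (rule runs_in_For[where I = "\<lambda>h s'. fst s' vz = int h * (sg * int c ^ i)", OF _ _ c_le])
          fix h s4 assume h: "fst s4 vz = int h * (sg * int c ^ i)" and f4: "frame ?inner s3 s4"
          have "fst s4 vpw = sg * int c ^ i" using frame_reg[OF f4] s3' by simp
          with h show "runs_in 10 0 0 (Assign vz (Plus (Reg vz) (Reg vpw))) s4
            (\<lambda>s'. fst (set_reg vh (1 + int h) s') vz = int (Suc h) * (sg * int c ^ i))"
            by (intro runs_in_straight) (auto simp: algebra_simps)
        qed (use s3 s3' in \<open>auto simp: frame_reg\<close>)
      qed simp_all
      fix s3 :: state assume "fst s3 vz = int c * (sg * int c ^ i)"
      then show "runs_in 10 0 0 (Assign vpw (Reg vz)) s3
        (\<lambda>s'. fst (set_reg vi (1 + int i) s') vpw = sg * int c ^ Suc i)"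
        by (intro runs_in_straight) auto
    qed simp_all
  next
    fix s2 :: state assume "fst s2 vpw = sg * int c ^ nat (int k - int j)"
    \<comment> \<open>A negative bound means no rounds, in agreement with truncated
      subtraction.\<close>
    moreover have "nat (int k - int j) = k - j" by linarith
    ultimately show "fst s2 vpw = sg * int c ^ (k - j)" by simp
  qed (use s1 s1' e1 in \<open>auto simp: frame_reg envD\<close>)
qed simp_all

lemma card_rays_le: "card (rays_avoiding X D) \<le> n * n"
proof -
  have "card (rays_avoiding X D) \<le> card (X \<times> X)"
    by (rule card_mono) (auto simp: rays_avoiding_def)
  then show ?thesis by (simp add: card_cartesian_product card_X)
qed

text \<open>As \<open>vw\<close> runs through the numbers below \<open>2 ^ card (X - C)\<close>,
  \<open>decode\<close> runs through the subsets of \<open>X - C\<close>, which turns the loop into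
  the sum of \<open>covers_iff_sum\<close>.\<close>

lemma sum_run:
  assumes "env s" "snd s arr_cov = ind C" "fst s vj = int j" "fst s vu = int (card (X - C))"
    "card (X - C) \<le> m" "snd s arr_ban = ind D0" "D0 \<subseteq> X"
  shows "runs_in 600 3 2 sum_com s (\<lambda>s'. (fst s' vsum \<noteq> 0 \<longleftrightarrow> covers X (k - j) (X - C))
    \<and> (\<exists>D\<subseteq>X. snd s' arr_ban = ind D))"
  unfolding sum_com_def
proof (rule runs_in_Seq)
  define g where "g A = (- 1) ^ card A * int (card (rays_avoiding X A)) ^ (k - j)" for A
  let ?u = "card (X - C)"
  let ?I = "\<lambda>i s'. fst s' vsum = (\<Sum>w<i. g (decode (uncovered C) (int w))) \<and> (\<exists>D\<subseteq>X. snd s' arr_ban = ind D)"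
  let ?body = "ban_com ;; count_rays_com ;; power_com ;; Assign vsum (Plus (Reg vsum) (Reg vpw))"
  let ?loop = "For vw (Read arr_pow (Reg vu)) ?body"
  have N: "nat (2 ^ ?u) = 2 ^ ?u" by (simp add: nat_power_eq)
  have "(2::nat) ^ ?u \<le> 2 ^ m" using assms(5) by (intro power_increasing) auto
  then have N_le: "nat (2 ^ ?u) \<le> Suc n ^ 0 * (2 ^ m) ^ 1" by (simp add: N)
  show "runs_in 2 0 0 (Assign vsum (Const 0)) s (?I 0)"
    by (rule runs_in_straight) (use assms in auto)
  fix s1 assume f1: "frame (Assign vsum (Const 0)) s s1" and s1: "?I 0 s1"
  have e1: "env s1" by (rule env_frame[OF f1 assms(1)]) auto
  have s1': "snd s1 arr_cov = ind C" "fst s1 vj = int j" "fst s1 vu = int ?u"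
    using frame_reg[OF f1] frame_arr[OF f1] assms by auto
  show "runs_in 550 3 2 ?loop s1 (\<lambda>s'. (fst s' vsum \<noteq> 0 \<longleftrightarrow> covers X (k - j) (X - C))
    \<and> (\<exists>D\<subseteq>X. snd s' arr_ban = ind D))"
  proof (rule runs_in_For[where I = ?I, OF _ _ N_le])
    fix w s2 assume w: "fst s2 vw = int w" "?I w s2" and f2: "frame ?loop s1 s2"
    have e2: "env s2" by (rule env_frame[OF f2 e1]) auto
    have s2: "snd s2 arr_cov = ind C" "fst s2 vj = int j" "fst s2 vu = int ?u"
      using frame_reg[OF f2] frame_arr[OF f2] s1' by auto
    obtain D where D: "D \<subseteq> X" "snd s2 arr_ban = ind D" using w(2) by blast
    let ?A = "decode (uncovered C) (int w)"
    have A: "?A \<subseteq> X" using decode_subset[of "uncovered C" "int w"] by (auto simp: uncovered_def)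
    show "runs_in 500 3 1 ?body s2 (\<lambda>s'. ?I (Suc w) (set_reg vw (1 + int w) s'))"
    proof (rule runs_in_Seq[OF ban_run[OF e2 s2(1,3) assms(5) D(2,1) w(1)]])
      fix s3 assume f3: "frame ban_com s2 s3"
        and s3: "snd s3 arr_ban = ind ?A \<and> fst s3 vsgn = (- 1) ^ card ?A"
      have e3: "env s3" by (rule env_frame[OF f3 e2]) auto
      show "runs_in 340 3 1 (count_rays_com ;; power_com ;; Assign vsum (Plus (Reg vsum) (Reg vpw))) s3
        (\<lambda>s'. ?I (Suc w) (set_reg vw (1 + int w) s'))"
      proof (rule runs_in_Seq[OF count_rays_run[OF e3 conjunct1[OF s3]]])
        fix s4 assume f4: "frame count_rays_com s3 s4" and s4: "fst s4 vc = int (card (rays_avoiding X ?A))"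
        have e4: "env s4" by (rule env_frame[OF f4 e3]) auto
        have s4': "fst s4 vj = int j" "fst s4 vsgn = (- 1) ^ card ?A"
          using frame_reg[OF f4] frame_reg[OF f3] s3 s2 by auto
        show "runs_in 130 3 1 (power_com ;; Assign vsum (Plus (Reg vsum) (Reg vpw))) s4
          (\<lambda>s'. ?I (Suc w) (set_reg vw (1 + int w) s'))"
        proof (rule runs_in_Seq[OF power_run[OF e4 s4'(1) s4 card_rays_le s4'(2)]])
          fix s5 assume f5: "frame power_com s4 s5"
            and s5: "fst s5 vpw = (- 1) ^ card ?A * int (card (rays_avoiding X ?A)) ^ (k - j)"
          have "fst s5 vsum = fst s2 vsum" "snd s5 arr_ban = ind ?A"
            using frame_reg[OF f5] frame_reg[OF f4] frame_reg[OF f3] frame_arr[OF f5] frame_arr[OF f4] s3 by auto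
          then show "runs_in 10 3 1 (Assign vsum (Plus (Reg vsum) (Reg vpw))) s5
            (\<lambda>s'. ?I (Suc w) (set_reg vw (1 + int w) s'))"
            using w(2) s5 A by (intro runs_in_straight) (auto simp: g_def)
        qed simp_all
      qed simp_all
    qed simp_all
  next
    fix s2 assume s2: "?I (nat (2 ^ ?u)) s2"
    have "(\<Sum>w<2 ^ ?u. g (decode (uncovered C) (int w))) = (\<Sum>A\<in>Pow (X - C). g A)"
      using sum_decode[of "uncovered C" g] distinct_xs length_uncovered[of C]
      by (simp add: uncovered_def set_diff_eq)
    then show "(fst s2 vsum \<noteq> 0 \<longleftrightarrow> covers X (k - j) (X - C)) \<and> (\<exists>D\<subseteq>X. snd s2 arr_ban = ind D)"
      using s2 covers_iff_sum[of X "X - C" "k - j"] by (simp add: g_def N)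
  next
    fix s2 assume f2: "frame ?loop s1 s2"
    have e2: "env s2" by (rule env_frame[OF f2 e1]) auto
    show "aval (Read arr_pow (Reg vu)) s2 = 2 ^ ?u"
      using frame_reg[OF f2] s1' envD(8)[OF e2 assms(5)] by simp
  qed (use s1 in auto)
qed simp_all

section \<open>One guess, the setup and the whole program\<close>

definition good :: "int \<Rightarrow> bool" where
  "good G \<longleftrightarrow> (case simulate xs Q (2 ^ q) k ({}, 0, G) of
     (C, j, rem) \<Rightarrow> card (X - C) \<le> m \<and> covers X (k - j) (X - C))"

text \<open>What one guess must leave behind for the next: the scratch arrays vanish off
  \<open>X\<close>, while their cells at elements of \<open>X\<close> are overwritten before
  use.\<close>

definition tidy :: "state \<Rightarrow> bool" where
  "tidy s \<longleftrightarrow> (\<forall>a\<in>{arr_cov, arr_low, arr_ban}. \<exists>S\<subseteq>X. snd s a = ind S)"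

lemma guess_run:
  assumes "env s" "tidy s" "fst s vguess = G"
  shows "runs_in 2000 3 2 guess_com s (\<lambda>s'. tidy s' \<and> fst s' vans = (if good G then 1 else fst s vans))"
  unfolding guess_com_def
proof -
  obtain C0 L0 D0 where 0: "C0 \<subseteq> X" "snd s arr_cov = ind C0" "L0 \<subseteq> X" "snd s arr_low = ind L0"
    "D0 \<subseteq> X" "snd s arr_ban = ind D0" using assms(2) by (auto simp: tidy_def)
  let ?final = "Cond (Equal (Reg vsum) (Const 0)) Skip (Assign vans (Const 1))"
  let ?post = "\<lambda>s'. tidy s' \<and> fst s' vans = (if good G then 1 else fst s vans)"
  let ?c3 = "Cond (Less (Reg vm) (Reg vu)) Skip (sum_com ;; ?final)"
  show "runs_in 2000 3 2 (reset_com ;; simulate_com ;; count_uncovered_com ;; ?c3) s ?post"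
  proof (rule runs_in_Seq[OF reset_run[OF assms(1) 0(2,1)]])
    fix s1 assume f1: "frame reset_com s s1" and s1: "snd s1 arr_cov = ind {}"
    have e1: "env s1" by (rule env_frame[OF f1 assms(1)]) auto
    have s1': "snd s1 arr_low = ind L0" "snd s1 arr_ban = ind D0" "fst s1 vans = fst s vans" "fst s1 vguess = G"
      using frame_arr[OF f1] frame_reg[OF f1] 0 assms by auto
    obtain C j rem where sim: "simulate xs Q (2 ^ q) k ({}, 0, G) = (C, j, rem)" by (metis prod_cases3)
    \<comment> \<open>Soundness of the simulation applies to every guess, so the covered set stays
      inside \<open>X\<close>.\<close>
    have C: "C \<subseteq> X" using simulate_sound[OF AP_union_empty sim] AP_union_subset by blast
    show "runs_in 1900 3 2 (simulate_com ;; count_uncovered_com ;; ?c3) s1 ?post"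
    proof (rule runs_in_Seq[OF simulate_run[OF e1 s1 s1'(1) 0(3)]])
      fix s2 assume f2: "frame simulate_com s1 s2"
        and "sim_state s2 (simulate xs Q (2 ^ q) k ({}, 0, fst s1 vguess))"
      then have s2: "snd s2 arr_cov = ind C" "fst s2 vj = int j" "\<exists>L\<subseteq>X. snd s2 arr_low = ind L"
        by (auto simp: s1' sim)
      have e2: "env s2" by (rule env_frame[OF f2 e1]) auto
      have s2': "snd s2 arr_ban = ind D0" "fst s2 vans = fst s vans"
        using frame_arr[OF f2] frame_reg[OF f2] s1' by auto
      show "runs_in 750 3 2 (count_uncovered_com ;; ?c3) s2 ?post"
      proof (rule runs_in_Seq[OF count_uncovered_run[OF e2 s2(1)]])
        fix s3 assume f3: "frame count_uncovered_com s2 s3" and s3: "fst s3 vu = int (card (X - C))"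
        have e3: "env s3" by (rule env_frame[OF f3 e2]) auto
        have s3': "snd s3 arr_cov = ind C" "fst s3 vj = int j" "\<exists>L\<subseteq>X. snd s3 arr_low = ind L"
          "snd s3 arr_ban = ind D0" "fst s3 vans = fst s vans"
          using frame_arr[OF f3] frame_reg[OF f3] s2 s2' by auto
        show "runs_in 680 3 2 ?c3 s3 ?post"
        proof (rule runs_in_Cond)
          assume "bval (Less (Reg vm) (Reg vu)) s3"
          then have "\<not> card (X - C) \<le> m" by (simp add: s3 envD[OF e3])
          then show "runs_in 660 3 2 Skip s3 ?post"
            using s3' C 0(5) by (intro runs_in_straight) (auto simp: tidy_def good_def sim)
        next
          assume "\<not> bval (Less (Reg vm) (Reg vu)) s3"
          then have m: "card (X - C) \<le> m" by (simp add: s3 envD[OF e3])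
          show "runs_in 660 3 2 (sum_com ;; ?final) s3 ?post"
          proof (rule runs_in_Seq[OF sum_run[OF e3 s3'(1,2) s3 m s3'(4) 0(5)]])
            fix s4 assume f4: "frame sum_com s3 s4"
              and s4: "(fst s4 vsum \<noteq> 0 \<longleftrightarrow> covers X (k - j) (X - C)) \<and> (\<exists>D\<subseteq>X. snd s4 arr_ban = ind D)"
            have "snd s4 arr_cov = ind C" "\<exists>L\<subseteq>X. snd s4 arr_low = ind L" "fst s4 vans = fst s vans"
              using frame_arr[OF f4] frame_reg[OF f4] s3' by auto
            then show "runs_in 20 3 2 ?final s4 ?post"
              using s4 C m by (intro runs_in_straight) (auto simp: tidy_def good_def sim)
          qed simp_all
        qed simp
      qed simp_all
    qed simp_all
  qed simp_all
qed


lemma m_le: "nat (int m) \<le> Suc n ^ 0 * (2 ^ m) ^ 1"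
  using less_exp[of m] by simp

lemma regs_setup: "regs setup_com = {vi, vq, vm, vQ}" and arrs_setup: "arrs setup_com = {arr_in, arr_pow}"
  by (auto simp: setup_com_def)

lemma setup_run: "runs_in 300 1 1 setup_com (input_state xs k) env"
proof -
  define s where "s = input_state xs k"
  have s: "fst s vn = int n" "fst s vk = int k" "snd s arr_in = ind {}"
    "\<And>i. i < n \<Longrightarrow> snd s arr_X (int i) = xs ! i"
    by (auto simp: s_def input_state_def ind_def)
  let ?l1 = "For vi (Reg vn) (Write arr_in Xi (Const 1))"
    and ?b = "Assign vq (Plus (Reg vk) (Reg vk)) ;; Assign vq (Plus (Reg vq) (Reg vk)) ;;
      Assign vq (Plus (Reg vq) (Reg vq)) ;; Assign vq (Plus (Reg vq) (Reg vq)) ;;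
      Assign vq (Plus (Plus (Reg vq) (Reg vk)) (Const 1)) ;;
      Assign vm (Const 0) ;; Write arr_pow (Const 0) (Const 1)"
    and ?l2 = "For vi (Reg vk) (Assign vm (Plus (Reg vm) (Reg vq)))"
    and ?double = "Write arr_pow (Plus (Reg vi) (Const 1))
       (Plus (Read arr_pow (Reg vi)) (Read arr_pow (Reg vi)))"
    and ?q = "Assign vQ (Read arr_pow (Plus (Plus (Reg vk) (Reg vk)) (Plus (Reg vk) (Reg vk))))"
  let ?l3 = "For vi (Reg vm) ?double"
  have "runs_in 300 1 1 (?l1 ;; ?b ;; ?l2 ;; ?l3 ;; ?q) s env"
  proof (rule runs_in_Seq)
    show "runs_in 40 1 0 ?l1 s (\<lambda>s'. snd s' arr_in = ind X)"
    proof (rule runs_in_For[where I = "\<lambda>i s'. snd s' arr_in = ind (set (take i xs))", OF _ _ n_le])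
      fix i s' assume i: "i < nat (int n)" "fst s' vi = int i" "snd s' arr_in = ind (set (take i xs))"
        and f: "frame ?l1 s s'"
      have "snd s' arr_X (int i) = xs ! i" using i(1) s frame_arr[OF f] by simp
      with i show "runs_in 10 0 0 (Write arr_in Xi (Const 1)) s'
        (\<lambda>s''. snd (set_reg vi (1 + int i) s'') arr_in = ind (set (take (Suc i) xs)))"
        by (intro runs_in_straight) (auto simp: set_take_Suc)
    qed (use s in \<open>auto simp: frame_reg\<close>)
    fix s1 assume f1: "frame ?l1 s s1" and s1: "snd s1 arr_in = ind X"
    have s1': "fst s1 vn = int n" "fst s1 vk = int k" "\<And>i. i < n \<Longrightarrow> snd s1 arr_X (int i) = xs ! i"
      using frame_reg[OF f1] frame_arr[OF f1] s by auto
    show "runs_in 250 1 1 (?b ;; ?l2 ;; ?l3 ;; ?q) s1 env"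
    proof (rule runs_in_Seq)
      show "runs_in 60 0 0 ?b s1 (\<lambda>s'. fst s' vq = int q \<and> fst s' vm = 0 \<and> snd s' arr_pow 0 = 1)"
        by (rule runs_in_straight) (use s1' in \<open>auto simp: q_def\<close>)
      fix s2 assume f2: "frame ?b s1 s2" and s2: "fst s2 vq = int q \<and> fst s2 vm = 0 \<and> snd s2 arr_pow 0 = 1"
      have s2': "fst s2 vn = int n" "fst s2 vk = int k" "\<And>i. i < n \<Longrightarrow> snd s2 arr_X (int i) = xs ! i"
        "snd s2 arr_in = ind X"
        using frame_reg[OF f2] frame_arr[OF f2] s1 s1' by auto
      show "runs_in 190 1 1 (?l2 ;; ?l3 ;; ?q) s2 env"
      proof (rule runs_in_Seq)
        show "runs_in 40 0 1 ?l2 s2 (\<lambda>s'. fst s' vm = int m)"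
        proof (rule runs_in_For[where I = "\<lambda>i s'. fst s' vm = int (i * q)", OF _ _ k_le])
          fix i s' assume i: "fst s' vm = int (i * q)" and f: "frame ?l2 s2 s'"
          have "fst s' vq = int q" using frame_reg[OF f] s2 by simp
          with i show "runs_in 10 0 0 (Assign vm (Plus (Reg vm) (Reg vq))) s'
            (\<lambda>s''. fst (set_reg vi (1 + int i) s'') vm = int (Suc i * q))"
            by (intro runs_in_straight) (auto simp: algebra_simps)
        qed (use s2 s2' in \<open>auto simp: frame_reg m_def\<close>)
        fix s3 assume f3: "frame ?l2 s2 s3" and s3: "fst s3 vm = int m"
        have s3': "fst s3 vn = int n" "fst s3 vk = int k" "\<And>i. i < n \<Longrightarrow> snd s3 arr_X (int i) = xs ! i"
          "snd s3 arr_in = ind X" "fst s3 vq = int q" "snd s3 arr_pow 0 = 1"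
          using frame_reg[OF f3] frame_arr[OF f3] s2 s2' by auto
        show "runs_in 140 1 1 (?l3 ;; ?q) s3 env"
        proof (rule runs_in_Seq)
          show "runs_in 50 0 1 ?l3 s3 (\<lambda>s'. \<forall>j\<le>m. snd s' arr_pow (int j) = 2 ^ j)"
          proof (rule runs_in_For[where I = "\<lambda>i s'. \<forall>j\<le>i. snd s' arr_pow (int j) = 2 ^ j", OF _ _ m_le])
            fix i and s' :: state assume "fst s' vi = int i" "\<forall>j\<le>i. snd s' arr_pow (int j) = 2 ^ j"
            then show "runs_in 15 0 0 ?double s'
              (\<lambda>s''. \<forall>j\<le>Suc i. snd (set_reg vi (1 + int i) s'') arr_pow (int j) = 2 ^ j)"
              by (intro runs_in_straight) (auto simp: le_Suc_eq)
          qed (use s3 s3' in \<open>auto simp: frame_reg\<close>)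
          fix s4 assume f4: "frame ?l3 s3 s4" and s4: "\<forall>j\<le>m. snd s4 arr_pow (int j) = 2 ^ j"
          \<comment> \<open>The table reaches \<open>4 * k\<close>, so \<open>Q\<close> can be read
            off it.\<close>
          have "snd s4 arr_pow (int (4 * k)) = 2 ^ (4 * k)" using s4 four_k_le by blast
          moreover have "fst s4 vn = int n" "fst s4 vk = int k" "\<And>i. i < n \<Longrightarrow> snd s4 arr_X (int i) = xs ! i"
            "snd s4 arr_in = ind X" "fst s4 vq = int q" "fst s4 vm = int m"
            using frame_reg[OF f4] frame_arr[OF f4] s3 s3' by auto
          ultimately show "runs_in 20 1 1 ?q s4 env"
            using s4 by (intro runs_in_straight) (auto simp: env_def Q_def)
        qed simp_all
      qed simp_all
    qed simp_all
  qed simp_all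
  then show ?thesis by (simp only: setup_com_def s_def)
qed

text \<open>In the induction the factor 16 absorbs the growth of the quadratic. The strict
  inequality supplies an extra 1, which becomes 16 and outweighs the constant 14.\<close>

lemma m_less_Q: "m < Q"
proof -
  have "l * (13 * l + 1) < 16 ^ l" for l :: nat
  proof (induction l)
    case (Suc l)
    have "Suc l * (13 * Suc l + 1) = 13 * (l * l) + 27 * l + 14" by (simp add: algebra_simps)
    also have "\<dots> < 208 * (l * l) + 16 * l + 16" using le_square[of l] by linarith
    also have "\<dots> = 16 * Suc (l * (13 * l + 1))" by (simp add: algebra_simps)
    also have "\<dots> \<le> 16 * 16 ^ l" using Suc by (intro mult_le_mono2) simp
    finally show ?case by simp
  qed simp
  then show ?thesis by (simp add: m_def q_def Q_def power_mult)
qed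

lemma CAP_iff_good: "CAP X k \<longleftrightarrow> (\<exists>G<2 ^ m. good (int G))"
proof -
  \<comment> \<open>Here \<open>2 * j + 1 \<le> 13 * k + 1\<close> and
    \<open>r \<le> k\<close>.\<close>
  have windows: "(2 * j + 1) * r \<le> m" if "j + r \<le> k" for j r
    unfolding m_def q_def using that by (subst mult.commute) (intro mult_le_mono; simp)
  have good_iff: "good G \<longleftrightarrow> (\<exists>C j rem. simulate xs Q (2 ^ q) k ({}, 0, G) = (C, j, rem)
    \<and> card (X - C) \<le> m \<and> covers X (k - j) (X - C))" for G
    by (auto simp: good_def split: prod.splits)
  have "(2::nat) ^ k \<le> Q" unfolding Q_def by (intro power_increasing) auto
  moreover have "int Q ^ 3 < 2 ^ q"
  proof -
    have "int Q ^ 3 = 2 ^ (12 * k)" by (simp add: Q_def mult.commute flip: power_mult)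
    also have "\<dots> < 2 ^ q" unfolding q_def by (rule power_strict_increasing) simp_all
    finally show ?thesis .
  qed
  ultimately have "CAP X k \<longleftrightarrow> (\<exists>G. 0 \<le> G \<and> G < (2 ^ q) ^ k \<and> good G)"
    using CAP_iff_simulate[where T = "2 ^ q", OF distinct_xs windows m_less_Q] good_iff by simp
  also have "(2 ^ q) ^ k = (2 ^ m :: int)" by (simp add: m_def mult.commute flip: power_mult)
  also have "(\<exists>G. 0 \<le> G \<and> G < 2 ^ m \<and> good G) \<longleftrightarrow> (\<exists>G<2 ^ m. good (int G))"
  proof
    assume "\<exists>G. 0 \<le> G \<and> G < 2 ^ m \<and> good G"
    then obtain G where "0 \<le> G" "G < 2 ^ m" "good G" by blast
    then have "nat G < 2 ^ m" "good (int (nat G))" by (simp_all add: nat_less_iff)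
    then show "\<exists>G<2 ^ m. good (int G)" by blast
  next
    assume "\<exists>G<2 ^ m. good (int G)"
    then obtain G :: nat where "G < 2 ^ m" "good (int G)" by blast
    then have "int G < 2 ^ m" by simp
    with \<open>good (int G)\<close> show "\<exists>G. 0 \<le> G \<and> G < 2 ^ m \<and> good G" by (intro exI[of _ "int G"]) simp
  qed
  finally show ?thesis .
qed

text \<open>The cube of \<open>Suc n\<close> comes from walking \<open>n\<close> steps along each of
  \<open>n * n\<close> rays. The cube of \<open>2 ^ m\<close> comes from the guesses, the subsets
  and the loop that computes powers, whose at most \<open>k\<close> rounds are charged
  \<open>2 ^ m\<close>.\<close>

lemma main_run: "runs_in 2500 3 3 main_com (input_state xs k) (\<lambda>s. answer s = (if CAP X k then 1 else 0))"
  unfolding main_com_def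
proof (rule runs_in_Seq[OF setup_run])
  let ?loop = "For vguess (Read arr_pow (Reg vm)) guess_com"
  let ?I = "\<lambda>i s'. tidy s' \<and> fst s' vans = (if \<exists>G<i. good (int G) then 1 else 0)"
  fix s assume f: "frame setup_com (input_state xs k) s" and e: "env s"
  have "\<And>a. a \<in> {arr_cov, arr_low, arr_ban} \<Longrightarrow> snd s a = ind {}"
    using frame_arr[OF f] by (auto simp: arrs_setup input_state_def ind_def fun_eq_iff)
  then have s: "tidy s" "fst s vans = 0"
    using frame_reg[OF f] by (auto simp: tidy_def regs_setup input_state_def)
  have N: "nat (2 ^ m) = 2 ^ m" by (simp add: nat_power_eq)
  then have N_le: "nat (2 ^ m) \<le> Suc n ^ 0 * (2 ^ m) ^ 1" by simp
  show "runs_in 2200 3 3 (?loop ;; Assign vn (Reg vans)) s (\<lambda>s. answer s = (if CAP X k then 1 else 0))"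
  proof (rule runs_in_Seq)
    show "runs_in 2100 3 3 ?loop s (?I (2 ^ m))"
    proof (rule runs_in_For[where I = ?I, OF _ _ N_le])
      fix i s1 assume i: "fst s1 vguess = int i" "?I i s1" and f1: "frame ?loop s s1"
      have e1: "env s1" by (rule env_frame[OF f1 e]) auto
      show "runs_in 2000 3 2 guess_com s1 (\<lambda>s'. ?I (Suc i) (set_reg vguess (1 + int i) s'))"
      proof (rule runs_in_mono[OF guess_run[OF e1 conjunct1[OF i(2)] i(1)]])
        fix s' :: state assume "tidy s' \<and> fst s' vans = (if good (int i) then 1 else fst s1 vans)"
        then show "?I (Suc i) (set_reg vguess (1 + int i) s')"
          using i(2) by (auto simp: tidy_def less_Suc_eq)
      qed simp_all
    next
      fix s1 assume f1: "frame ?loop s s1"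
      have e1: "env s1" by (rule env_frame[OF f1 e]) auto
      show "aval (Read arr_pow (Reg vm)) s1 = 2 ^ m" using envD[OF e1] by simp
    next
      fix s1 :: state assume "?I (nat (2 ^ m)) s1"
      then show "?I (2 ^ m) s1" by (simp only: N)
    qed (use s in \<open>auto simp: tidy_def\<close>)
    fix s1 :: state assume "?I (2 ^ m) s1"
    then show "runs_in 10 3 3 (Assign vn (Reg vans)) s1 (\<lambda>s. answer s = (if CAP X k then 1 else 0))"
      by (intro runs_in_straight) (simp_all add: answer_def CAP_iff_good)
  qed simp_all
qed simp_all

end

lemma main_com_correct:
  assumes "distinct xs"
  shows "\<exists>t s. exec main_com (input_state xs k) t s
    \<and> answer s = (if CAP (set xs) k then 1 else 0)
    \<and> real t \<le> 2 powr real (3 * (k * (13 * k + 1))) * real (poly (smult 2500 ([:1, 1:] ^ 3)) (length xs))"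
proof -
  interpret cap_instance xs k by unfold_locales fact
  obtain t s where run: "exec main_com (input_state xs k) t s" "answer s = (if CAP (set xs) k then 1 else 0)"
    "t \<le> 2500 * (Suc n ^ 3 * (2 ^ m) ^ 3)"
    using main_run unfolding runs_in_def runs_def by blast
  have real_power: "real (2 ^ e * a) = 2 powr real e * real a" for e a :: nat
    by (simp add: powr_realpow)
  have poly: "poly (smult 2500 ([:1, 1:] ^ 3)) n = 2500 * Suc n ^ 3" by (simp add: poly_power)
  have "real t \<le> real (2500 * (Suc n ^ 3 * (2 ^ m) ^ 3))" using run(3) by (simp only: of_nat_le_iff)
  also have "(2 ^ m) ^ 3 = (2 :: nat) ^ (3 * (k * (13 * k + 1)))"
    by (simp only: m_def q_def mult.commute[of 3] power_mult)
  also have "2500 * (Suc n ^ 3 * 2 ^ (3 * (k * (13 * k + 1))))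
    = 2 ^ (3 * (k * (13 * k + 1))) * poly (smult 2500 ([:1, 1:] ^ 3)) n"
    by (simp only: poly ac_simps)
  also have "real \<dots> = 2 powr real (3 * (k * (13 * k + 1))) * real (poly (smult 2500 ([:1, 1:] ^ 3)) n)"
    by (rule real_power)
  finally show ?thesis using run(1,2) by blast
qed

lemma exponent_bigo: "(\<lambda>k. real (3 * (k * (13 * k + 1)))) \<in> O(\<lambda>k. real k ^ 2)"
proof -
  \<comment> \<open>The 42 is \<open>39 + 3\<close>, bounding \<open>k\<close> by its
    square.\<close>
  have "3 * (k * (13 * k + 1)) \<le> 42 * k ^ 2" for k :: nat
    using le_square[of k] by (simp add: power2_eq_square algebra_simps)
  then have "norm (real (3 * (k * (13 * k + 1)))) \<le> 42 * norm (real k ^ 2)" for k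
    by (metis norm_of_nat of_nat_le_iff of_nat_mult of_nat_numeral of_nat_power)
  then show ?thesis by (intro bigoI always_eventually allI)
qed

theorem theorem1:
  "\<exists>(prog :: com) (f :: nat \<Rightarrow> real) (p :: nat poly).
     f \<in> O(\<lambda>k. real k ^ 2) \<and>
     (\<forall>(X :: int set) (n :: nat) (k :: nat) (xs :: int list).
        finite X \<and> card X = n \<and> distinct xs \<and> set xs = X \<longrightarrow>
        (\<exists>t s. exec prog (input_state xs k) t s
             \<and> answer s = (if CAP X k then 1 else 0)
             \<and> real t \<le> 2 powr f k * real (poly p n)))"
proof (rule exI[of _ main_com], rule exI[of _ "\<lambda>k. real (3 * (k * (13 * k + 1)))"],
    rule exI[of _ "smult 2500 ([:1, 1:] ^ 3)"], intro conjI allI impI)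
  fix X :: "int set" and n k :: nat and xs :: "int list"
  assume X: "finite X \<and> card X = n \<and> distinct xs \<and> set xs = X"
  then have "length xs = n" "set xs = X" using distinct_card by metis+
  with main_com_correct[of xs k] X show "\<exists>t s. exec main_com (input_state xs k) t s
    \<and> answer s = (if CAP X k then 1 else 0)
    \<and> real t \<le> 2 powr real (3 * (k * (13 * k + 1))) * real (poly (smult 2500 ([:1, 1:] ^ 3)) n)"
    by simp
qed (rule exponent_bigo)

end
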